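(* Let $R$ be a commutative noetherian ring, let $\mathfrak{a}$ be a proper ideal of $R$, let $\mathfrak{b}$ be an ideal of $R$, and let $X$ be an arbitrary non-zero $R$-module (not necessarily finitely generated). Then the following statements hold true. (i) $\mathrm{cd}(\mathfrak{a}+\mathfrak{b},X)\leq \mathrm{ara}(\mathfrak{a})+\mathrm{cd}(\mathfrak{b},X)$. (ii) $\mathrm{cd}(\mathfrak{a}\cap\mathfrak{b},X)\leq \mathrm{ara}(\mathfrak{a})+\mathrm{cd}(\mathfrak{b},X)$. (iii) $\mathrm{cd}(\mathfrak{b},X)\leq \mathrm{cd}(\mathfrak{a},X)+\mathrm{ara}(\mathfrak{b}/\mathfrak{a})$ whenever $\mathfrak{a}\subseteq\mathfrak{b}$.
   Context: For an ideal $\mathfrak{a}$ of $R$, $H^i_{\mathfrak{a}}$ denotes the $i$th local cohomology functor, i.e. the $i$th right derived functor of the $\mathfrak{a}$-torsion functor $\Gamma_{\mathfrak{a}}$. For an $R$-module $X$, the cohomological dimension of $X$ with respect to $\mathfrak{a}$ is $\mathrm{cd}(\mathfrak{a},X):=\sup\{i : H^i_{\mathfrak{a}}(X)\neq 0\}$. $\mathrm{ara}(\mathfrak{a})$ (arithmetic rank) is the least integer $n\ge 0$ such that there are $x_1,\dots,x_n\in R$ with $\sqrt{\mathfrak{a}}=\sqrt{(x_1,\dots,x_n)}$. For $\mathfrak{a}\subseteq\mathfrak{b}$, $\mathrm{ara}(\mathfrak{b}/\mathfrak{a})$ is the arithmetic rank of the ideal $\mathfrak{b}/\mathfrak{a}$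 of $R/\mathfrak{a}$, i.e. the least integer $n\ge 0$ such that there are $x_1,\dots,x_n\in R$ with $\sqrt{\mathfrak{b}}=\sqrt{(x_1,\dots,x_n)+\mathfrak{a}}$. *)

theory Defs
  imports "HOL-Algebra.Module" "HOL-Algebra.Ideal_Product" "HOL-Algebra.Ring_Divisibility"
    "HOL-Library.Extended_Nat"
begin

section \<open>Modules\<close>

definition module_hom ::
  "('a, 'r) ring_scheme \<Rightarrow> ('a, 'm, 'x) module_scheme \<Rightarrow> ('a, 'n, 'y) module_scheme \<Rightarrow> ('m \<Rightarrow> 'n) set"
  where "module_hom R M N =
    {f \<in> hom (add_monoid M) (add_monoid N).
       \<forall>r \<in> carrier R. \<forall>x \<in> carrier M. f (r \<odot>\<^bsub>M\<^esub> x) = r \<odot>\<^bsub>N\<^esub> f x}"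

(* The fields mult and one of a module record carry no meaning; here they are
   filled in as for quotient rings. *)
definition FactModule :: "('a, 'm, 'x) module_scheme \<Rightarrow> 'm set \<Rightarrow> ('a, 'm set) module"
  where "FactModule M N =
    \<lparr>carrier = a_rcosets\<^bsub>M\<^esub> N, monoid.mult = rcoset_mult M N, one = N +>\<^bsub>M\<^esub> \<one>\<^bsub>M\<^esub>,
     ring.zero = N, add = set_add M, smult = (\<lambda>r S. \<Union>x\<in>S. N +>\<^bsub>M\<^esub> (r \<odot>\<^bsub>M\<^esub> x))\<rparr>"

(* The test modules M and N range over all modules whose carrier is a set of
   elements of the type 'u of E.  This is injectivity in the usual sense as soon
   as 'u has at least the cardinality of the ring (Baer's criterion). *)
definition injective_module :: "('a, 'r) ring_scheme \<Rightarrow> ('a, 'u) module \<Rightarrow> bool"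
  where "injective_module R E \<longleftrightarrow>
    module R E \<and>
    (\<forall>(M :: ('a, 'u) module) (N :: ('a, 'u) module). \<forall>f \<in> module_hom R M N. \<forall>g \<in> module_hom R M E.
       module R M \<longrightarrow> module R N \<longrightarrow> inj_on f (carrier M) \<longrightarrow>
       (\<exists>h \<in> module_hom R N E. \<forall>x \<in> carrier M. h (f x) = g x))"


section \<open>Right derived functors\<close>

definition injective_resolution ::
  "('a, 'r) ring_scheme \<Rightarrow> ('a, 'm, 'x) module_scheme \<Rightarrow>
   (nat \<Rightarrow> ('a, 'u) module) \<Rightarrow> (nat \<Rightarrow> 'u \<Rightarrow> 'u) \<Rightarrow> ('m \<Rightarrow> 'u) \<Rightarrow> bool"
  where "injective_resolution R X I d \<epsilon> \<longleftrightarrow>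
    (\<forall>n. injective_module R (I n)) \<and>
    (\<forall>n. d n \<in> module_hom R (I n) (I (Suc n))) \<and>
    \<epsilon> \<in> module_hom R X (I 0) \<and> inj_on \<epsilon> (carrier X) \<and>
    \<epsilon> ` carrier X = a_kernel (I 0) (I 1) (d 0) \<and>
    (\<forall>n. d n ` carrier (I n) = a_kernel (I (Suc n)) (I (Suc (Suc n))) (d (Suc n)))"

(* A type large enough to contain injective resolutions of modules with carrier in 'm
   over a noetherian ring with carrier in 'a: its cardinality is
   max(|'a|, |'m|, aleph_0).  If R is noetherian and M is a module of at most this
   cardinality, then so is the module obtained from M by freely extending all
   homomorphisms J -> M from (finitely generated) ideals J to R, and the union of
   the countable chain obtained by iterating this construction is an injective
   module containing M.  The type also contains a copy of 'a, as is needed for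
   injective_module to have its usual meaning. *)
type_synonym ('a, 'm) univ = "('a + 'm) list"

definition chosen_injective_resolution ::
  "('a, 'r) ring_scheme \<Rightarrow> ('a, 'm, 'x) module_scheme \<Rightarrow>
   (nat \<Rightarrow> ('a, ('a, 'm) univ) module) \<times> (nat \<Rightarrow> ('a, 'm) univ \<Rightarrow> ('a, 'm) univ)"
  where "chosen_injective_resolution R X =
    (SOME (I, d). \<exists>\<epsilon>. injective_resolution R X I d \<epsilon>)"

definition cohomology ::
  "(nat \<Rightarrow> ('a, 'u) module) \<Rightarrow> (nat \<Rightarrow> 'u \<Rightarrow> 'u) \<Rightarrow> nat \<Rightarrow> ('a, 'u set) module"
  where "cohomology C d i =
    FactModule ((C i)\<lparr>carrier := a_kernel (C i) (C (Suc i)) (d i)\<rparr>)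
      (case i of 0 \<Rightarrow> {\<zero>\<^bsub>C 0\<^esub>} | Suc j \<Rightarrow> d j ` carrier (C j))"

(* A functor is given by its action F on modules and its action F' on
   homomorphisms f : M -> N, the latter written F' M N f. *)
definition right_derived ::
  "('a, 'r) ring_scheme \<Rightarrow>
   (('a, ('a, 'm) univ) module \<Rightarrow> ('a, 'v) module) \<Rightarrow>
   (('a, ('a, 'm) univ) module \<Rightarrow> ('a, ('a, 'm) univ) module \<Rightarrow>
      (('a, 'm) univ \<Rightarrow> ('a, 'm) univ) \<Rightarrow> 'v \<Rightarrow> 'v) \<Rightarrow>
   nat \<Rightarrow> ('a, 'm, 'x) module_scheme \<Rightarrow> ('a, 'v set) module"
  where "right_derived R F F' i X =
    (case chosen_injective_resolution R X of (I, d) \<Rightarrow>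
       cohomology (\<lambda>n. F (I n)) (\<lambda>n. F' (I n) (I (Suc n)) (d n)) i)"


section \<open>Local cohomology and cohomological dimension\<close>

definition torsion ::
  "('a, 'r) ring_scheme \<Rightarrow> 'a set \<Rightarrow> ('a, 'm, 'x) module_scheme \<Rightarrow> ('a, 'm, 'x) module_scheme"
  where "torsion R \<aa> M =
    M\<lparr>carrier := {x \<in> carrier M. \<exists>n::nat. \<forall>r \<in> \<aa> [^]\<^bsub>ideals_set R\<^esub> n. r \<odot>\<^bsub>M\<^esub> x = \<zero>\<^bsub>M\<^esub>}\<rparr>"

definition torsion_hom ::
  "('a, 'r) ring_scheme \<Rightarrow> 'a set \<Rightarrow> ('a, 'm, 'x) module_scheme \<Rightarrow> ('a, 'n, 'y) module_scheme \<Rightarrow>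
   ('m \<Rightarrow> 'n) \<Rightarrow> 'm \<Rightarrow> 'n"
  where "torsion_hom R \<aa> M N f = restrict f (carrier (torsion R \<aa> M))"

definition local_cohomology ::
  "('a, 'r) ring_scheme \<Rightarrow> 'a set \<Rightarrow> nat \<Rightarrow> ('a, 'm, 'x) module_scheme \<Rightarrow>
   ('a, ('a, 'm) univ set) module"
  where "local_cohomology R \<aa> i X = right_derived R (torsion R \<aa>) (torsion_hom R \<aa>) i X"

(* The supremum is taken in the natural numbers with infinity, so it is 0 if all
   local cohomology modules vanish.  (With the value -infinity instead, the bound
   for cd of an intersection would fail: over the integers take the ideals (3), (2)
   and the module Z/3, or over a field the ideals 0, (1) and the field itself.) *)
definition cd :: "('a, 'r) ring_scheme \<Rightarrow> 'a set \<Rightarrow> ('a, 'm, 'x) module_scheme \<Rightarrow> enat"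
  where "cd R \<aa> X =
    Sup {enat i |i. carrier (local_cohomology R \<aa> i X) \<noteq> {\<zero>\<^bsub>local_cohomology R \<aa> i X\<^esub>}}"


section \<open>Arithmetic rank\<close>

definition radical :: "('a, 'r) ring_scheme \<Rightarrow> 'a set \<Rightarrow> 'a set"
  where "radical R \<aa> = {x \<in> carrier R. \<exists>n::nat. x [^]\<^bsub>R\<^esub> n \<in> \<aa>}"

definition ara :: "('a, 'r) ring_scheme \<Rightarrow> 'a set \<Rightarrow> nat"
  where "ara R \<aa> =
    (LEAST n. \<exists>xs. length xs = n \<and> set xs \<subseteq> carrier R \<and> radical R \<aa> = radical R (Idl\<^bsub>R\<^esub> (set xs)))"

definition ara_quotient :: "('a, 'r) ring_scheme \<Rightarrow> 'a set \<Rightarrow> 'a set \<Rightarrow> nat"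
  where "ara_quotient R \<bb> \<aa> = ara (R Quot \<aa>) ((\<lambda>x. \<aa> +>\<^bsub>R\<^esub> x) ` \<bb>)"

end

theory Submission
  imports Defs "HOL-Algebra.IntRing" "HOL-Library.Equipollence" Complex_Main
begin

text \<open>
  All local cohomology modules of \<open>X\<close> are computed from one injective resolution \<open>I\<close> of \<open>X\<close>, so
  the inequalities are statements about the subcomplexes of torsion elements of \<open>I\<close>.  Three facts
  make them elementary.

  The \<open>\<aa>\<close>-torsion elements of a module are those \<open>w\<close> for which every element of \<open>\<aa>\<close> has a power
  killing \<open>w\<close>, that is, \<open>\<aa> \<subseteq> \<surd>(Ann w)\<close> (\<open>torsion_eq_power_torsion\<close>; here \<open>\<aa>\<close> is finitely
  generated).  Hence the torsion only depends on \<open>\<surd>\<aa>\<close>, it makes sense for any set \<open>S\<close> of ring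
  elements, and enlarging \<open>S\<close> intersects torsion parts.

  An element \<open>w\<close> of an injective module is divisible by any ring element \<open>x\<close> up to \<open>x\<close>-torsion, and the
  quotient can be chosen to be killed by all of \<open>Ann w\<close> (\<open>exists_divisor_up_to_torsion\<close>).  So this
  division stays inside every torsion part.  It is the elementary form of the exactness of
  \<open>0 \<rightarrow> \<Gamma>\<^sub>x E \<rightarrow> E \<rightarrow> E\<^sub>x \<rightarrow> 0\<close> for the torsion part \<open>E\<close> of an injective module.

  Chasing the first steps of the long exact sequence that belongs to this short one shows that adding
  one element \<open>x\<close> to \<open>S\<close> raises the last non-vanishing degree by at most one (\<open>vanishes_insert\<close>).
  Iterating over \<open>ara(\<aa>)\<close> elements that generate \<open>\<aa>\<close> up to radical, starting from \<open>\<bb>\<close>, gives the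
  bound for \<open>\<aa> + \<bb>\<close>; iterating over elements that generate \<open>\<bb>\<close> up to radical over \<open>\<aa>\<close> gives the bound
  for \<open>\<aa> \<subseteq> \<bb>\<close>.  For the intersection, divisibility also yields \<open>\<Gamma>\<^bsub>\<aa> \<inter> \<bb>\<^esub> E = \<Gamma>\<^sub>\<aa> E + \<Gamma>\<^sub>\<bb> E\<close>
  (\<open>power_torsion_split\<close>), and the resulting Mayer-Vietoris argument (\<open>vanishes_if_split\<close>) bounds
  \<open>cd(\<aa> \<inter> \<bb>)\<close> by the bounds for \<open>\<aa>\<close>, \<open>\<bb>\<close> and \<open>\<aa> + \<bb>\<close>.

  It remains to know that the chosen resolution is one, i.e. that injective resolutions exist inside the
  type \<open>('a, 'm) univ\<close>.  Maps with prescribed kernel into a huge injective module come from characters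
  with values in the nonzero complex numbers, a divisible group (\<open>module_hom_coind_with_kernel\<close>).
  Closing the image under the module operations and under solutions of finite linear systems gives a
  submodule that fits into the type, and it is still injective because ideals are finitely generated
  (\<open>small_baer_submodule\<close>).  Each step of the resolution is such a map whose kernel is the previous
  image.
\<close>

section \<open>Baer's criterion\<close>

lemma (in cring) ideal_of_smult_closed:
  assumes "J \<subseteq> carrier R" "\<zero> \<in> J"
    and add: "\<And>a b. a \<in> J \<Longrightarrow> b \<in> J \<Longrightarrow> a \<oplus> b \<in> J"
    and mult: "\<And>r a. r \<in> carrier R \<Longrightarrow> a \<in> J \<Longrightarrow> r \<otimes> a \<in> J"
  shows "ideal J R"
proof (rule idealI)
  show "ring R" by unfold_locales
  show "subgroup J (add_monoid R)"
  proof (rule add.subgroupI)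
    show "\<ominus> a \<in> J" if "a \<in> J" for a
      using mult[of "\<ominus> \<one>" a] that assms(1) by (auto simp: l_minus)
  qed (use assms in auto)
  show "r \<otimes> a \<in> J" if "a \<in> J" "r \<in> carrier R" for a r using mult that by blast
  then show "a \<otimes> r \<in> J" if "a \<in> J" "r \<in> carrier R" for a r
    using that m_comm[of a r] assms(1) by auto
qed

text \<open>
  Injectivity in the form that Baer's criterion gives it.  Unlike injectivity tested on modules with
  carriers in one fixed type, this condition passes between modules over different types.
\<close>

definition baer :: "('a, 'r) ring_scheme \<Rightarrow> ('a, 'e, 'z) module_scheme \<Rightarrow> bool"
  where "baer R E \<longleftrightarrow>
    (\<forall>J \<phi>. ideal J R \<longrightarrow> \<phi> \<in> J \<rightarrow> carrier E \<longrightarrow>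
       (\<forall>r\<in>J. \<forall>s\<in>J. \<phi> (r \<oplus>\<^bsub>R\<^esub> s) = \<phi> r \<oplus>\<^bsub>E\<^esub> \<phi> s) \<longrightarrow>
       (\<forall>r\<in>carrier R. \<forall>s\<in>J. \<phi> (r \<otimes>\<^bsub>R\<^esub> s) = r \<odot>\<^bsub>E\<^esub> \<phi> s) \<longrightarrow>
       (\<exists>e\<in>carrier E. \<forall>r\<in>J. \<phi> r = r \<odot>\<^bsub>E\<^esub> e))"

lemma baerD:
  assumes "baer R E" "ideal J R" "\<And>r. r \<in> J \<Longrightarrow> \<phi> r \<in> carrier E"
    and "\<And>r s. r \<in> J \<Longrightarrow> s \<in> J \<Longrightarrow> \<phi> (r \<oplus>\<^bsub>R\<^esub> s) = \<phi> r \<oplus>\<^bsub>E\<^esub> \<phi> s"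
    and "\<And>r s. r \<in> carrier R \<Longrightarrow> s \<in> J \<Longrightarrow> \<phi> (r \<otimes>\<^bsub>R\<^esub> s) = r \<odot>\<^bsub>E\<^esub> \<phi> s"
  obtains e where "e \<in> carrier E" "\<And>r. r \<in> J \<Longrightarrow> \<phi> r = r \<odot>\<^bsub>E\<^esub> e"
proof -
  have "\<phi> \<in> J \<rightarrow> carrier E" using assms(3) by auto
  then have "\<exists>e\<in>carrier E. \<forall>r\<in>J. \<phi> r = r \<odot>\<^bsub>E\<^esub> e"
    using assms unfolding baer_def by blast
  then show thesis using that by blast
qed

text \<open>
  Graphs of homomorphisms from a submodule of \<open>N\<close> to \<open>E\<close>.  Working with graphs turns extension of
  homomorphisms into inclusion of sets, as Zorn's lemma wants it, and lets a homomorphism on a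
  submodule like \<open>L + R m\<close> be given by non-unique representations; the last condition is
  well-definedness.
\<close>

definition partial_hom ::
  "('a, 'r) ring_scheme \<Rightarrow> ('a, 'n, 'y) module_scheme \<Rightarrow> ('a, 'e, 'z) module_scheme \<Rightarrow> ('n \<times> 'e) set \<Rightarrow> bool"
  where "partial_hom R N E H \<longleftrightarrow>
    H \<subseteq> carrier N \<times> carrier E \<and> (\<zero>\<^bsub>N\<^esub>, \<zero>\<^bsub>E\<^esub>) \<in> H \<and>
    (\<forall>x y x' y'. (x, y) \<in> H \<longrightarrow> (x', y') \<in> H \<longrightarrow> (x \<oplus>\<^bsub>N\<^esub> x', y \<oplus>\<^bsub>E\<^esub> y') \<in> H) \<and>
    (\<forall>r\<in>carrier R. \<forall>x y. (x, y) \<in> H \<longrightarrow> (r \<odot>\<^bsub>N\<^esub> x, r \<odot>\<^bsub>E\<^esub> y) \<in> H) \<and>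
    (\<forall>y. (\<zero>\<^bsub>N\<^esub>, y) \<in> H \<longrightarrow> y = \<zero>\<^bsub>E\<^esub>)"

lemma partial_homD:
  assumes "partial_hom R N E H"
  shows "(x, y) \<in> H \<Longrightarrow> x \<in> carrier N" "(x, y) \<in> H \<Longrightarrow> y \<in> carrier E"
    and "(\<zero>\<^bsub>N\<^esub>, \<zero>\<^bsub>E\<^esub>) \<in> H"
    and "(x, y) \<in> H \<Longrightarrow> (x', y') \<in> H \<Longrightarrow> (x \<oplus>\<^bsub>N\<^esub> x', y \<oplus>\<^bsub>E\<^esub> y') \<in> H"
    and "r \<in> carrier R \<Longrightarrow> (x, y) \<in> H \<Longrightarrow> (r \<odot>\<^bsub>N\<^esub> x, r \<odot>\<^bsub>E\<^esub> y) \<in> H"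
    and "(\<zero>\<^bsub>N\<^esub>, y) \<in> H \<Longrightarrow> y = \<zero>\<^bsub>E\<^esub>"
  using assms unfolding partial_hom_def by auto

lemma (in module) smult_minus_one:
  assumes "x \<in> carrier M" shows "(\<ominus> \<one>) \<odot>\<^bsub>M\<^esub> x = \<ominus>\<^bsub>M\<^esub> x"
  using assms smult_l_minus[OF R.one_closed assms] by simp

lemma partial_hom_unique:
  assumes "module R N" "module R E" "partial_hom R N E H" "(x, y) \<in> H" "(x, y') \<in> H"
  shows "y = y'"
proof -
  interpret N: module R N by fact
  interpret E: module R E by fact
  have c: "x \<in> carrier N" "y \<in> carrier E" "y' \<in> carrier E"
    using partial_homD(1,2)[OF assms(3)] assms(4,5) by auto
  have "((\<ominus>\<^bsub>R\<^esub> \<one>\<^bsub>R\<^esub>) \<odot>\<^bsub>N\<^esub> x, (\<ominus>\<^bsub>R\<^esub> \<one>\<^bsub>R\<^esub>) \<odot>\<^bsub>E\<^esub> y') \<in> H"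
    using partial_homD(5)[OF assms(3) _ assms(5)] by simp
  then have "(x \<oplus>\<^bsub>N\<^esub> (\<ominus>\<^bsub>N\<^esub> x), y \<oplus>\<^bsub>E\<^esub> (\<ominus>\<^bsub>E\<^esub> y')) \<in> H"
    using partial_homD(4)[OF assms(3,4)] c by (simp add: N.smult_minus_one E.smult_minus_one)
  then have "y \<oplus>\<^bsub>E\<^esub> (\<ominus>\<^bsub>E\<^esub> y') = \<zero>\<^bsub>E\<^esub>"
    using partial_homD(6)[OF assms(3)] c by (simp add: N.M.r_neg)
  then show ?thesis using c E.M.minus_equality[of y "\<ominus>\<^bsub>E\<^esub> y'"] by simp
qed

text \<open>
  The step of Baer's argument: the ring elements that move \<open>x\<close> into the domain form an ideal, and the
  element \<open>e\<close> that represents the homomorphism on this ideal is a possible value at \<open>x\<close>.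
\<close>

lemma partial_hom_extend_one:
  assumes "module R N" "module R E" "baer R E" "partial_hom R N E H" and x: "x \<in> carrier N"
  obtains H' where "partial_hom R N E H'" "H \<subseteq> H'" "x \<in> Domain H'"
proof -
  interpret N: module R N by fact
  interpret E: module R E by fact
  note H = assms(4)
  have HS: "\<And>u v. (u, v) \<in> H \<Longrightarrow> u \<in> carrier N \<and> v \<in> carrier E"
    using partial_homD(1,2)[OF H] by blast
  have H0: "(\<zero>\<^bsub>N\<^esub>, \<zero>\<^bsub>E\<^esub>) \<in> H"
    and Ha: "\<And>x y x' y'. (x, y) \<in> H \<Longrightarrow> (x', y') \<in> H \<Longrightarrow> (x \<oplus>\<^bsub>N\<^esub> x', y \<oplus>\<^bsub>E\<^esub> y') \<in> H"
    and Hs: "\<And>r x y. r \<in> carrier R \<Longrightarrow> (x, y) \<in> H \<Longrightarrow> (r \<odot>\<^bsub>N\<^esub> x, r \<odot>\<^bsub>E\<^esub> y) \<in> H"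
    by (rule partial_homD(3)[OF H],
        erule (1) partial_homD(4)[OF H], erule (1) partial_homD(5)[OF H])
  define J where "J = {r \<in> carrier R. r \<odot>\<^bsub>N\<^esub> x \<in> Domain H}"
  define \<phi> where "\<phi> r = (THE y. (r \<odot>\<^bsub>N\<^esub> x, y) \<in> H)" for r
  have \<phi>_eq: "\<phi> r = y" if "(r \<odot>\<^bsub>N\<^esub> x, y) \<in> H" for r y
    unfolding \<phi>_def using that partial_hom_unique[OF assms(1,2) H that] by blast
  have \<phi>: "(r \<odot>\<^bsub>N\<^esub> x, \<phi> r) \<in> H" if "r \<in> J" for r
    using that \<phi>_eq unfolding J_def by auto
  have Jc: "\<And>r. r \<in> J \<Longrightarrow> r \<in> carrier R" unfolding J_def by auto
  have J: "ideal J R"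
  proof (rule N.R.ideal_of_smult_closed)
    show "J \<subseteq> carrier R" using Jc by blast
    show "\<zero>\<^bsub>R\<^esub> \<in> J" unfolding J_def using H0 x by auto
    show "a \<oplus>\<^bsub>R\<^esub> b \<in> J" if "a \<in> J" "b \<in> J" for a b
      using Ha[OF \<phi>[OF that(1)] \<phi>[OF that(2)]] Jc[OF that(1)] Jc[OF that(2)] x
      unfolding J_def by (auto simp: N.smult_l_distr)
    show "r \<otimes>\<^bsub>R\<^esub> a \<in> J" if "r \<in> carrier R" "a \<in> J" for r a
      using Hs[OF that(1) \<phi>[OF that(2)]] that(1) Jc[OF that(2)] x
      unfolding J_def by (auto simp: N.smult_assoc1)
  qed
  obtain e where e: "e \<in> carrier E" "\<And>r. r \<in> J \<Longrightarrow> \<phi> r = r \<odot>\<^bsub>E\<^esub> e"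
  proof (rule baerD[OF assms(3) J, of \<phi>])
    show "\<phi> r \<in> carrier E" if "r \<in> J" for r using HS \<phi>[OF that] by auto
    show "\<phi> (r \<oplus>\<^bsub>R\<^esub> s) = \<phi> r \<oplus>\<^bsub>E\<^esub> \<phi> s" if "r \<in> J" "s \<in> J" for r s
      by (rule \<phi>_eq) (use Ha[OF \<phi>[OF that(1)] \<phi>[OF that(2)]] that Jc x in \<open>simp add: N.smult_l_distr\<close>)
    show "\<phi> (r \<otimes>\<^bsub>R\<^esub> s) = r \<odot>\<^bsub>E\<^esub> \<phi> s" if "r \<in> carrier R" "s \<in> J" for r s
      by (rule \<phi>_eq) (use Hs[OF that(1) \<phi>[OF that(2)]] that Jc x in \<open>simp add: N.smult_assoc1\<close>)
  qed auto
  define H' where "H' = {(u \<oplus>\<^bsub>N\<^esub> r \<odot>\<^bsub>N\<^esub> x, v \<oplus>\<^bsub>E\<^esub> r \<odot>\<^bsub>E\<^esub> e) | u v r. (u, v) \<in> H \<and> r \<in> carrier R}"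
  have "partial_hom R N E H'"
    unfolding partial_hom_def
  proof (intro conjI allI impI ballI)
    show "H' \<subseteq> carrier N \<times> carrier E" unfolding H'_def using HS x e by auto
    show "(\<zero>\<^bsub>N\<^esub>, \<zero>\<^bsub>E\<^esub>) \<in> H'"
      unfolding H'_def using H0 x e by (intro CollectI exI[of _ "\<zero>\<^bsub>N\<^esub>"] exI[of _ "\<zero>\<^bsub>E\<^esub>"] exI[of _ "\<zero>\<^bsub>R\<^esub>"]) auto
  next
    fix y z y' z' assume "(y, z) \<in> H'" "(y', z') \<in> H'"
    then obtain u v r u' v' r' where *: "(u, v) \<in> H" "r \<in> carrier R" "(u', v') \<in> H" "r' \<in> carrier R"
      "y = u \<oplus>\<^bsub>N\<^esub> r \<odot>\<^bsub>N\<^esub> x" "z = v \<oplus>\<^bsub>E\<^esub> r \<odot>\<^bsub>E\<^esub> e" "y' = u' \<oplus>\<^bsub>N\<^esub> r' \<odot>\<^bsub>N\<^esub> x" "z' = v' \<oplus>\<^bsub>E\<^esub> r' \<odot>\<^bsub>E\<^esub> e"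
      unfolding H'_def by auto
    have "y \<oplus>\<^bsub>N\<^esub> y' = (u \<oplus>\<^bsub>N\<^esub> u') \<oplus>\<^bsub>N\<^esub> (r \<oplus>\<^bsub>R\<^esub> r') \<odot>\<^bsub>N\<^esub> x"
      using * HS[OF *(1)] HS[OF *(3)] x by (simp add: N.smult_l_distr N.M.a_ac)
    moreover have "z \<oplus>\<^bsub>E\<^esub> z' = (v \<oplus>\<^bsub>E\<^esub> v') \<oplus>\<^bsub>E\<^esub> (r \<oplus>\<^bsub>R\<^esub> r') \<odot>\<^bsub>E\<^esub> e"
      using * HS[OF *(1)] HS[OF *(3)] e by (simp add: E.smult_l_distr E.M.a_ac)
    ultimately show "(y \<oplus>\<^bsub>N\<^esub> y', z \<oplus>\<^bsub>E\<^esub> z') \<in> H'"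
      unfolding H'_def using Ha[OF *(1,3)] *(2,4) by blast
  next
    fix t y z assume t: "t \<in> carrier R" and "(y, z) \<in> H'"
    then obtain u v r where *: "(u, v) \<in> H" "r \<in> carrier R"
      "y = u \<oplus>\<^bsub>N\<^esub> r \<odot>\<^bsub>N\<^esub> x" "z = v \<oplus>\<^bsub>E\<^esub> r \<odot>\<^bsub>E\<^esub> e"
      unfolding H'_def by auto
    have "t \<odot>\<^bsub>N\<^esub> y = t \<odot>\<^bsub>N\<^esub> u \<oplus>\<^bsub>N\<^esub> (t \<otimes>\<^bsub>R\<^esub> r) \<odot>\<^bsub>N\<^esub> x"
      using * HS[OF *(1)] x t by (simp add: N.smult_r_distr N.smult_assoc1)
    moreover have "t \<odot>\<^bsub>E\<^esub> z = t \<odot>\<^bsub>E\<^esub> v \<oplus>\<^bsub>E\<^esub> (t \<otimes>\<^bsub>R\<^esub> r) \<odot>\<^bsub>E\<^esub> e"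
      using * HS[OF *(1)] e t by (simp add: E.smult_r_distr E.smult_assoc1)
    ultimately show "(t \<odot>\<^bsub>N\<^esub> y, t \<odot>\<^bsub>E\<^esub> z) \<in> H'"
      unfolding H'_def using Hs[OF t *(1)] *(2) t by blast
  next
    fix z assume "(\<zero>\<^bsub>N\<^esub>, z) \<in> H'"
    then obtain u v r where *: "(u, v) \<in> H" "r \<in> carrier R"
      "u \<oplus>\<^bsub>N\<^esub> r \<odot>\<^bsub>N\<^esub> x = \<zero>\<^bsub>N\<^esub>" "z = v \<oplus>\<^bsub>E\<^esub> r \<odot>\<^bsub>E\<^esub> e"
      unfolding H'_def by auto
    note c = HS[OF *(1)]
    have "((\<ominus>\<^bsub>R\<^esub> \<one>\<^bsub>R\<^esub>) \<odot>\<^bsub>N\<^esub> u, (\<ominus>\<^bsub>R\<^esub> \<one>\<^bsub>R\<^esub>) \<odot>\<^bsub>E\<^esub> v) \<in> H" using Hs *(1) by simp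
    moreover have "r \<odot>\<^bsub>N\<^esub> x = \<ominus>\<^bsub>N\<^esub> u"
      using * c x N.M.minus_equality[of "r \<odot>\<^bsub>N\<^esub> x" u] by (simp add: N.M.a_comm)
    ultimately have m: "(r \<odot>\<^bsub>N\<^esub> x, \<ominus>\<^bsub>E\<^esub> v) \<in> H"
      using c by (simp add: N.smult_minus_one E.smult_minus_one)
    then have "r \<in> J" unfolding J_def using * by auto
    then have "r \<odot>\<^bsub>E\<^esub> e = \<ominus>\<^bsub>E\<^esub> v" using e \<phi>_eq[OF m] by auto
    then show "z = \<zero>\<^bsub>E\<^esub>" using * c by (simp add: E.M.r_neg)
  qed
  moreover have "H \<subseteq> H'"
  proof
    fix p assume "p \<in> H"
    then obtain u v where p: "p = (u, v)" "(u, v) \<in> H" by (cases p) auto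
    then show "p \<in> H'" unfolding H'_def using HS[OF p(2)] x e
      by (intro CollectI exI[of _ u] exI[of _ v] exI[of _ "\<zero>\<^bsub>R\<^esub>"]) auto
  qed
  moreover have "(x, e) \<in> H'"
    unfolding H'_def using H0 x e by (intro CollectI exI[of _ "\<zero>\<^bsub>N\<^esub>"] exI[of _ "\<zero>\<^bsub>E\<^esub>"] exI[of _ "\<one>\<^bsub>R\<^esub>"]) auto
  ultimately show thesis by (intro that[of H']) auto
qed

lemma partial_hom_Union_chain:
  assumes "C \<noteq> {}" "subset.chain {H. partial_hom R N E H} C"
  shows "partial_hom R N E (\<Union>C)"
proof -
  have C: "\<And>H. H \<in> C \<Longrightarrow> partial_hom R N E H"
    and lin: "\<And>H H'. H \<in> C \<Longrightarrow> H' \<in> C \<Longrightarrow> H \<subseteq> H' \<or> H' \<subseteq> H"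
    using assms(2) unfolding subset.chain_def by auto
  show ?thesis
    unfolding partial_hom_def
  proof (intro conjI allI impI ballI)
    show "\<Union>C \<subseteq> carrier N \<times> carrier E" using partial_homD(1,2)[OF C] by auto
    show "(\<zero>\<^bsub>N\<^esub>, \<zero>\<^bsub>E\<^esub>) \<in> \<Union>C" using partial_homD(3)[OF C] assms(1) by blast
    show "y = \<zero>\<^bsub>E\<^esub>" if "(\<zero>\<^bsub>N\<^esub>, y) \<in> \<Union>C" for y
      using that partial_homD(6)[OF C] by blast
    show "(r \<odot>\<^bsub>N\<^esub> x, r \<odot>\<^bsub>E\<^esub> y) \<in> \<Union>C" if "r \<in> carrier R" "(x, y) \<in> \<Union>C" for r x y
      using that partial_homD(5)[OF C] by blast
    show "(x \<oplus>\<^bsub>N\<^esub> x', y \<oplus>\<^bsub>E\<^esub> y') \<in> \<Union>C" if xy: "(x, y) \<in> \<Union>C" "(x', y') \<in> \<Union>C" for x y x' y'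
    proof -
      obtain H H' where "H \<in> C" "H' \<in> C" "(x, y) \<in> H" "(x', y') \<in> H'" using xy by auto
      then obtain G where "G \<in> C" "(x, y) \<in> G" "(x', y') \<in> G" using lin by blast
      then show ?thesis using partial_homD(4)[OF C[of G]] by blast
    qed
  qed
qed

text \<open>
  Baer's criterion in the form used below: by maximality and the previous step, a maximal extension is
  defined everywhere.
\<close>

lemma partial_hom_extend:
  assumes "module R N" "module R E" "baer R E" "partial_hom R N E H"
  obtains h where "h \<in> module_hom R N E" "\<And>x y. (x, y) \<in> H \<Longrightarrow> h x = y"
proof -
  let ?A = "{G. partial_hom R N E G \<and> H \<subseteq> G}"
  have "\<exists>G\<in>?A. \<forall>G'\<in>?A. G \<subseteq> G' \<longrightarrow> G' = G"
  proof (rule subset_Zorn_nonempty)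
    show "?A \<noteq> {}" using assms(4) by blast
    fix C assume C: "C \<noteq> {}" "subset.chain ?A C"
    have CA: "C \<subseteq> ?A" using C(2) by (simp add: subset_chain_def)
    have "subset.chain {H. partial_hom R N E H} C"
      using C(2) by (auto simp: subset_chain_def)
    then have "partial_hom R N E (\<Union>C)" by (rule partial_hom_Union_chain[OF C(1)])
    moreover have "H \<subseteq> \<Union>C"
    proof -
      obtain G where "G \<in> C" using C(1) by auto
      then show ?thesis using CA by auto
    qed
    ultimately show "\<Union>C \<in> ?A" by simp
  qed
  then obtain G where G: "partial_hom R N E G" "H \<subseteq> G"
    and max: "\<And>G'. partial_hom R N E G' \<Longrightarrow> G \<subseteq> G' \<Longrightarrow> G' = G"
    by (metis (mono_tags, lifting) mem_Collect_eq order_trans)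
  have dom: "x \<in> Domain G" if "x \<in> carrier N" for x
    using partial_hom_extend_one[OF assms(1-3) G(1) that] max by metis
  define h where "h x = (THE y. (x, y) \<in> G)" for x
  have h: "h x = y" if "(x, y) \<in> G" for x y
    unfolding h_def using that partial_hom_unique[OF assms(1,2) G(1) that] by blast
  have hG: "(x, h x) \<in> G" if "x \<in> carrier N" for x using dom[OF that] h by auto
  have "h \<in> module_hom R N E"
    unfolding module_hom_def
  proof (intro CollectI conjI ballI)
    show "h \<in> hom (add_monoid N) (add_monoid E)"
      using partial_homD(2)[OF G(1) hG] partial_homD(4)[OF G(1) hG hG]
      by (intro homI) (auto intro!: h)
    show "h (r \<odot>\<^bsub>N\<^esub> x) = r \<odot>\<^bsub>E\<^esub> h x" if "r \<in> carrier R" "x \<in> carrier N" for r x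
      using partial_homD(5)[OF G(1) that(1) hG[OF that(2)]] by (rule h)
  qed
  then show thesis using h G(2) by (intro that[of h]) auto
qed

lemma module_homD:
  assumes "f \<in> module_hom R M N"
  shows "x \<in> carrier M \<Longrightarrow> f x \<in> carrier N"
    and "x \<in> carrier M \<Longrightarrow> y \<in> carrier M \<Longrightarrow> f (x \<oplus>\<^bsub>M\<^esub> y) = f x \<oplus>\<^bsub>N\<^esub> f y"
    and "r \<in> carrier R \<Longrightarrow> x \<in> carrier M \<Longrightarrow> f (r \<odot>\<^bsub>M\<^esub> x) = r \<odot>\<^bsub>N\<^esub> f x"
  using assms unfolding module_hom_def hom_def by auto

lemma module_homI:
  assumes "\<And>x. x \<in> carrier M \<Longrightarrow> f x \<in> carrier N"
    and "\<And>x y. x \<in> carrier M \<Longrightarrow> y \<in> carrier M \<Longrightarrow> f (x \<oplus>\<^bsub>M\<^esub> y) = f x \<oplus>\<^bsub>N\<^esub> f y"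
    and "\<And>r x. r \<in> carrier R \<Longrightarrow> x \<in> carrier M \<Longrightarrow> f (r \<odot>\<^bsub>M\<^esub> x) = r \<odot>\<^bsub>N\<^esub> f x"
  shows "f \<in> module_hom R M N"
  using assms unfolding module_hom_def hom_def by auto

lemma module_hom_zero:
  assumes "module R M" "module R N" "f \<in> module_hom R M N"
  shows "f \<zero>\<^bsub>M\<^esub> = \<zero>\<^bsub>N\<^esub>"
proof -
  interpret M: module R M by fact
  interpret N: module R N by fact
  have "f (\<zero>\<^bsub>R\<^esub> \<odot>\<^bsub>M\<^esub> \<zero>\<^bsub>M\<^esub>) = \<zero>\<^bsub>R\<^esub> \<odot>\<^bsub>N\<^esub> f \<zero>\<^bsub>M\<^esub>"
    by (rule module_homD(3)[OF assms(3)]) auto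
  then show ?thesis using module_homD(1)[OF assms(3), of "\<zero>\<^bsub>M\<^esub>"] by simp
qed

text \<open>
  A homomorphism \<open>g\<close> on \<open>M\<close> and an injective \<open>f\<close> from \<open>M\<close> to \<open>N\<close> amount to the partial homomorphism on
  \<open>N\<close> with the graph of all pairs \<open>(f x, g x)\<close>.
\<close>

lemma injective_module_if_baer:
  fixes E :: "('a, 'u) module"
  assumes "module R E" "baer R E"
  shows "injective_module R E"
  unfolding injective_module_def
proof (intro conjI allI ballI impI)
  show "module R E" by fact
  fix M N :: "('a, 'u) module" and f g
  assume f: "f \<in> module_hom R M N" and g: "g \<in> module_hom R M E"
    and M: "module R M" and N: "module R N" and inj: "inj_on f (carrier M)"
  interpret M: module R M by fact
  interpret N: module R N by fact
  interpret E: module R E by fact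
  let ?H = "(\<lambda>x. (f x, g x)) ` carrier M"
  have H: "partial_hom R N E ?H"
    unfolding partial_hom_def
  proof (intro conjI allI ballI impI)
    show "?H \<subseteq> carrier N \<times> carrier E" using module_homD(1)[OF f] module_homD(1)[OF g] by auto
    show "(\<zero>\<^bsub>N\<^esub>, \<zero>\<^bsub>E\<^esub>) \<in> ?H"
      by (rule image_eqI[of _ _ "\<zero>\<^bsub>M\<^esub>"])
         (simp_all add: module_hom_zero[OF M N f] module_hom_zero[OF M assms(1) g])
  next
    fix x y x' y' assume "(x, y) \<in> ?H" "(x', y') \<in> ?H"
    then obtain a b where "a \<in> carrier M" "b \<in> carrier M" "x = f a" "y = g a" "x' = f b" "y' = g b"
      by auto
    then show "(x \<oplus>\<^bsub>N\<^esub> x', y \<oplus>\<^bsub>E\<^esub> y') \<in> ?H"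
      by (intro image_eqI[of _ _ "a \<oplus>\<^bsub>M\<^esub> b"]) (simp_all add: module_homD(2)[OF f] module_homD(2)[OF g])
  next
    fix r x y assume "r \<in> carrier R" "(x, y) \<in> ?H"
    then obtain a where "r \<in> carrier R" "a \<in> carrier M" "x = f a" "y = g a" by auto
    then show "(r \<odot>\<^bsub>N\<^esub> x, r \<odot>\<^bsub>E\<^esub> y) \<in> ?H"
      by (intro image_eqI[of _ _ "r \<odot>\<^bsub>M\<^esub> a"]) (simp_all add: module_homD(3)[OF f] module_homD(3)[OF g])
  next
    fix y assume "(\<zero>\<^bsub>N\<^esub>, y) \<in> ?H"
    then obtain a where a: "a \<in> carrier M" "f a = \<zero>\<^bsub>N\<^esub>" "y = g a" by auto
    then have "a = \<zero>\<^bsub>M\<^esub>"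
      using inj_onD[OF inj, of a "\<zero>\<^bsub>M\<^esub>"] module_hom_zero[OF M N f] by simp
    then show "y = \<zero>\<^bsub>E\<^esub>" using a module_hom_zero[OF M assms(1) g] by simp
  qed
  obtain h where "h \<in> module_hom R N E" "\<And>x y. (x, y) \<in> ?H \<Longrightarrow> h x = y"
    by (rule partial_hom_extend[OF N assms(1,2) H]) (rule that)
  then show "\<exists>h\<in>module_hom R N E. \<forall>x\<in>carrier M. h (f x) = g x" by (intro bexI[of _ h]) auto
qed

text \<open>
  Transport of structure along a map that is injective on the carrier.  It moves modules into the type
  in which test modules and resolutions live.
\<close>

definition copy_module :: "('m \<Rightarrow> 'u) \<Rightarrow> ('a, 'm, 'x) module_scheme \<Rightarrow> ('a, 'u) module"
  where "copy_module \<iota> M =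
    \<lparr>carrier = \<iota> ` carrier M, monoid.mult = (\<lambda>_ _. \<iota> \<zero>\<^bsub>M\<^esub>), one = \<iota> \<zero>\<^bsub>M\<^esub>, ring.zero = \<iota> \<zero>\<^bsub>M\<^esub>,
     add = (\<lambda>x y. \<iota> (inv_into (carrier M) \<iota> x \<oplus>\<^bsub>M\<^esub> inv_into (carrier M) \<iota> y)),
     smult = (\<lambda>r x. \<iota> (r \<odot>\<^bsub>M\<^esub> inv_into (carrier M) \<iota> x))\<rparr>"

lemma copy_module_simps:
  assumes "inj_on \<iota> (carrier M)"
  shows "carrier (copy_module \<iota> M) = \<iota> ` carrier M"
    and "\<zero>\<^bsub>copy_module \<iota> M\<^esub> = \<iota> \<zero>\<^bsub>M\<^esub>"
    and "x \<in> carrier M \<Longrightarrow> y \<in> carrier M \<Longrightarrow> \<iota> x \<oplus>\<^bsub>copy_module \<iota> M\<^esub> \<iota> y = \<iota> (x \<oplus>\<^bsub>M\<^esub> y)"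
    and "x \<in> carrier M \<Longrightarrow> r \<odot>\<^bsub>copy_module \<iota> M\<^esub> \<iota> x = \<iota> (r \<odot>\<^bsub>M\<^esub> x)"
  using assms by (auto simp: copy_module_def)

lemma copy_module_is_module:
  assumes "module R M" and inj: "inj_on \<iota> (carrier M)"
  shows "module R (copy_module \<iota> M)"
proof -
  interpret M: module R M by fact
  note [simp] = copy_module_simps[OF inj]
  show ?thesis
  proof (rule moduleI)
    show "cring R" by (rule M.R.is_cring)
    show "abelian_group (copy_module \<iota> M)"
    proof (rule abelian_groupI)
      show "\<exists>y\<in>carrier (copy_module \<iota> M). y \<oplus>\<^bsub>copy_module \<iota> M\<^esub> x = \<zero>\<^bsub>copy_module \<iota> M\<^esub>"
        if x: "x \<in> carrier (copy_module \<iota> M)" for x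
      proof -
        obtain a where a: "a \<in> carrier M" "x = \<iota> a" using x by auto
        show ?thesis
          by (rule bexI[of _ "\<iota> (\<ominus>\<^bsub>M\<^esub> a)"]) (simp_all add: a M.M.l_neg)
      qed
    qed (auto simp: M.M.a_ac)
  qed (auto simp: M.smult_l_distr M.smult_r_distr M.smult_assoc1)
qed

definition ideal_module :: "('a, 'r) ring_scheme \<Rightarrow> 'a set \<Rightarrow> ('a, 'a) module"
  where "ideal_module R J =
    \<lparr>carrier = J, monoid.mult = monoid.mult R, one = \<one>\<^bsub>R\<^esub>, ring.zero = \<zero>\<^bsub>R\<^esub>,
     add = add R, smult = monoid.mult R\<rparr>"

lemma ideal_module_is_module:
  assumes "cring R" "ideal J R"
  shows "module R (ideal_module R J)"
proof -
  interpret R: cring R by fact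
  interpret J: ideal J R by fact
  have [simp]: "\<And>x. x \<in> J \<Longrightarrow> x \<in> carrier R" by (rule J.Icarr)
  show ?thesis
  proof (rule moduleI)
    show "abelian_group (ideal_module R J)"
    proof (rule abelian_groupI)
      show "\<exists>y\<in>carrier (ideal_module R J). y \<oplus>\<^bsub>ideal_module R J\<^esub> x = \<zero>\<^bsub>ideal_module R J\<^esub>"
        if "x \<in> carrier (ideal_module R J)" for x
        using that by (intro bexI[of _ "\<ominus>\<^bsub>R\<^esub> x"]) (auto simp: ideal_module_def R.l_neg J.a_inv_closed)
    qed (auto simp: ideal_module_def R.a_ac J.a_closed)
  qed (auto simp: ideal_module_def assms R.l_distr R.r_distr R.m_assoc J.I_l_closed)
qed

text \<open>
  The inclusion of an ideal into the ring, copied into the type \<open>'u\<close>, is one of the test situations of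
  injectivity; the embedding of the ring into \<open>'u\<close> is what makes the copy possible.
\<close>

lemma baer_if_injective_module:
  fixes E :: "('a, 'u) module" and \<iota> :: "'a \<Rightarrow> 'u"
  assumes "cring R" "injective_module R E" and inj: "inj \<iota>"
  shows "baer R E"
  unfolding baer_def
proof (intro allI impI)
  fix J \<phi>
  assume J: "ideal J R" and \<phi>: "\<phi> \<in> J \<rightarrow> carrier E"
    and a: "\<forall>r\<in>J. \<forall>s\<in>J. \<phi> (r \<oplus>\<^bsub>R\<^esub> s) = \<phi> r \<oplus>\<^bsub>E\<^esub> \<phi> s"
    and s: "\<forall>r\<in>carrier R. \<forall>s\<in>J. \<phi> (r \<otimes>\<^bsub>R\<^esub> s) = r \<odot>\<^bsub>E\<^esub> \<phi> s"
  interpret R: cring R by fact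
  interpret J: ideal J R by fact
  have JR: "\<And>x. x \<in> J \<Longrightarrow> x \<in> carrier R" by (rule J.Icarr)
  have inj': "inj_on \<iota> A" for A using inj by (rule inj_on_subset) simp
  note cs = copy_module_simps[OF inj']
  define M where "M = copy_module \<iota> (ideal_module R J)"
  define N where "N = copy_module \<iota> (ideal_module R (carrier R))"
  have M: "module R M" unfolding M_def by (intro copy_module_is_module ideal_module_is_module assms J inj')
  have N: "module R N" unfolding N_def by (intro copy_module_is_module ideal_module_is_module assms R.oneideal inj')
  have id: "id \<in> module_hom R M N"
    by (rule module_homI) (auto simp: M_def N_def cs ideal_module_def JR)
  have g: "\<phi> \<circ> inv_into UNIV \<iota> \<in> module_hom R M E"
    by (rule module_homI) (use \<phi> a s inj in \<open>auto simp: M_def cs ideal_module_def\<close>)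
  obtain h where h: "h \<in> module_hom R N E" "\<And>x. x \<in> carrier M \<Longrightarrow> h x = (\<phi> \<circ> inv_into UNIV \<iota>) x"
    using assms(2) M N id g unfolding injective_module_def by (metis id_apply inj_on_id)
  have one: "\<iota> \<one>\<^bsub>R\<^esub> \<in> carrier N" by (auto simp: N_def cs ideal_module_def)
  have "\<phi> r = r \<odot>\<^bsub>E\<^esub> h (\<iota> \<one>\<^bsub>R\<^esub>)" if "r \<in> J" for r
  proof -
    have "\<phi> r = h (\<iota> r)" using h(2)[of "\<iota> r"] that inj by (simp add: M_def cs ideal_module_def)
    also have "\<iota> r = r \<odot>\<^bsub>N\<^esub> \<iota> \<one>\<^bsub>R\<^esub>"
      using JR[OF that] by (simp add: N_def cs ideal_module_def)
    also have "h \<dots> = r \<odot>\<^bsub>E\<^esub> h (\<iota> \<one>\<^bsub>R\<^esub>)" by (rule module_homD(3)[OF h(1) JR[OF that] one])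
    finally show ?thesis .
  qed
  then show "\<exists>e\<in>carrier E. \<forall>r\<in>J. \<phi> r = r \<odot>\<^bsub>E\<^esub> e"
    using module_homD(1)[OF h(1) one] by blast
qed

section \<open>Characters\<close>

text \<open>
  The multiplicative group of nonzero complex numbers as a module over the integers.  It is divisible
  and has roots of unity of all orders, so it serves as injective cogenerator for abelian groups.
\<close>

definition cstar_module :: "(int, complex) module"
  where "cstar_module =
    \<lparr>carrier = {z. z \<noteq> 0}, monoid.mult = (*), one = 1, ring.zero = 1, add = (*),
     smult = (\<lambda>k z. z powi k)\<rparr>"

definition zmodule :: "('m, 'y) ring_scheme \<Rightarrow> (int, 'm) module"
  where "zmodule G =
    \<lparr>carrier = carrier G, monoid.mult = monoid.mult G, one = \<one>\<^bsub>G\<^esub>, ring.zero = \<zero>\<^bsub>G\<^esub>,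
     add = add G, smult = (\<lambda>k x. (add_pow G (k) x))\<rparr>"

lemma cstar_module_is_module: "module \<Z> cstar_module"
proof (rule moduleI)
  show "cring \<Z>" by (rule int_is_cring)
  show "abelian_group cstar_module"
  proof (rule abelian_groupI)
    show "\<exists>y\<in>carrier cstar_module. y \<oplus>\<^bsub>cstar_module\<^esub> x = \<zero>\<^bsub>cstar_module\<^esub>"
      if "x \<in> carrier cstar_module" for x
      using that by (intro bexI[of _ "inverse x"]) (auto simp: cstar_module_def)
  qed (auto simp: cstar_module_def)
qed (auto simp: cstar_module_def power_int_add power_int_mult_distrib power_int_mult[symmetric] mult.commute)

lemma zmodule_is_module:
  assumes "abelian_group G" shows "module \<Z> (zmodule G)"
proof -
  interpret G: abelian_group G by fact
  show ?thesis
  proof (rule moduleI)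
    show "cring \<Z>" by (rule int_is_cring)
    show "abelian_group (zmodule G)"
    proof (rule abelian_groupI)
      show "\<exists>y\<in>carrier (zmodule G). y \<oplus>\<^bsub>zmodule G\<^esub> x = \<zero>\<^bsub>zmodule G\<^esub>"
        if "x \<in> carrier (zmodule G)" for x
        using that by (intro bexI[of _ "\<ominus>\<^bsub>G\<^esub> x"]) (auto simp: zmodule_def G.l_neg)
    qed (auto simp: zmodule_def G.a_ac)
  qed (auto simp: zmodule_def G.add.int_pow_mult G.add.int_pow_distrib G.add.int_pow_pow mult.commute)
qed

lemma int_ideal_eq_multiples:
  assumes "ideal J \<Z>"
  obtains d :: int where "d \<ge> 0" "J = {k. d dvd k}"
proof -
  interpret J: ideal J \<Z> by fact
  have add: "a + b \<in> J" if "a \<in> J" "b \<in> J" for a b using J.a_closed[OF that] by simp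
  have mult: "k * a \<in> J" if "a \<in> J" for a k using J.I_l_closed[OF that, of k] by simp
  show thesis
  proof (cases "\<exists>a\<in>J. a > 0")
    case False
    have "a = 0" if "a \<in> J" for a
      using False that mult[OF that, of "-1"] by (metis mult_minus1 neg_0_less_iff_less linorder_neqE)
    moreover have "0 \<in> J" using J.zero_closed by simp
    ultimately show thesis by (intro that[of 0]) auto
  next
    case True
    define n where "n = (LEAST n::nat. n > 0 \<and> int n \<in> J)"
    have "\<exists>n::nat. n > 0 \<and> int n \<in> J" using True by (metis zero_less_imp_eq_int)
    then have n: "n > 0" "int n \<in> J" unfolding n_def by (metis (mono_tags, lifting) LeastI_ex)+
    have min: "m = 0" if "int m \<in> J" "m < n" for m
      using not_less_Least[of m "\<lambda>n. n > 0 \<and> int n \<in> J"] that unfolding n_def by auto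
    have "int n dvd k" if "k \<in> J" for k
    proof -
      have "k mod int n = k + (- (k div int n)) * int n" by (simp add: minus_div_mult_eq_mod[symmetric])
      then have "k mod int n \<in> J" using add[OF that mult[OF n(2), of "- (k div int n)"]] by simp
      then have "nat (k mod int n) = 0"
        using n(1) by (intro min) (auto simp: nat_less_iff)
      moreover have "k mod int n \<ge> 0" using n(1) by simp
      ultimately show ?thesis by (metis dvd_eq_mod_eq_0 nat_eq_iff2 of_nat_0 int_nat_eq)
    qed
    moreover have "k \<in> J" if "int n dvd k" for k
      using that mult[OF n(2)] by (auto simp: dvd_def mult.commute)
    ultimately show thesis by (intro that[of "int n"]) auto
  qed
qed

text \<open>
  Ideals of the integers are principal, so the condition only asks for roots of given order.
\<close>

lemma baer_cstar_module: "baer \<Z> cstar_module"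
  unfolding baer_def
proof (intro allI impI)
  fix J and \<phi> :: "int \<Rightarrow> complex"
  assume J: "ideal J \<Z>" and \<phi>: "\<phi> \<in> J \<rightarrow> carrier cstar_module"
    and a: "\<forall>r\<in>J. \<forall>s\<in>J. \<phi> (r \<oplus>\<^bsub>\<Z>\<^esub> s) = \<phi> r \<oplus>\<^bsub>cstar_module\<^esub> \<phi> s"
    and s: "\<forall>r\<in>carrier \<Z>. \<forall>s\<in>J. \<phi> (r \<otimes>\<^bsub>\<Z>\<^esub> s) = r \<odot>\<^bsub>cstar_module\<^esub> \<phi> s"
  obtain d :: int where d: "d \<ge> 0" "J = {k. d dvd k}" by (rule int_ideal_eq_multiples[OF J])
  have dJ: "d \<in> J" using d by simp
  have z: "\<phi> d \<noteq> 0" using \<phi> dJ by (auto simp: cstar_module_def)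
  have \<phi>m: "\<phi> (k * d) = \<phi> d powi k" for k using s dJ by (simp add: cstar_module_def)
  \<comment> \<open>If \<open>d = 0\<close> then \<open>\<phi> d = 1\<close>, and \<open>e = 1\<close> is a root as well.\<close>
  have "\<exists>e. e \<noteq> 0 \<and> e powi d = \<phi> d"
  proof (cases "d = 0")
    case True
    then show ?thesis using \<phi>m[of 0] by (intro exI[of _ 1]) simp
  next
    case False
    define n where "n = nat d"
    have n: "d = int n" "n > 0" using d(1) False by (auto simp: n_def)
    define e where "e = of_real (root n (cmod (\<phi> d))) * cis (Arg (\<phi> d) / real n)"
    have "e ^ n = of_real (cmod (\<phi> d)) * cis (Arg (\<phi> d))"
      using n(2) by (simp add: e_def power_mult_distrib DeMoivre flip: of_real_power)
    also have "\<dots> = \<phi> d" using rcis_cmod_Arg[of "\<phi> d"] by (simp add: rcis_def)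
    finally have en: "e ^ n = \<phi> d" .
    then have "e \<noteq> 0" using z n(2) by (metis zero_power)
    then show ?thesis using en n(1) by (intro exI[of _ e]) simp
  qed
  then obtain e where e: "e \<noteq> 0" "e powi d = \<phi> d" by blast
  have "\<phi> r = r \<odot>\<^bsub>cstar_module\<^esub> e" if "r \<in> J" for r
  proof -
    obtain k where "r = k * d" using \<open>r \<in> J\<close> d(2) by (auto simp: dvd_def mult.commute)
    then show ?thesis using \<phi>m[of k] e(2)
      by (simp add: cstar_module_def mult.commute[of k d] power_int_mult)
  qed
  then show "\<exists>e\<in>carrier cstar_module. \<forall>r\<in>J. \<phi> r = r \<odot>\<^bsub>cstar_module\<^esub> e"
    using e by (auto simp: cstar_module_def)
qed

definition character :: "('m, 'y) ring_scheme \<Rightarrow> ('m \<Rightarrow> complex) \<Rightarrow> bool"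
  where "character G \<chi> \<longleftrightarrow>
    (\<forall>x\<in>carrier G. \<chi> x \<noteq> 0) \<and> (\<forall>x\<in>carrier G. \<forall>y\<in>carrier G. \<chi> (x \<oplus>\<^bsub>G\<^esub> y) = \<chi> x * \<chi> y)"

text \<open>
  Baer's criterion over the integers, for homomorphisms to the nonzero complex numbers.
\<close>

lemma extend_character:
  assumes "abelian_group G" and HG: "H \<subseteq> carrier G \<times> {z. z \<noteq> 0}" and H0: "(\<zero>\<^bsub>G\<^esub>, 1) \<in> H"
    and Ha: "\<And>x y x' y'. (x, y) \<in> H \<Longrightarrow> (x', y') \<in> H \<Longrightarrow> (x \<oplus>\<^bsub>G\<^esub> x', y * y') \<in> H"
    and Hm: "\<And>x y. (x, y) \<in> H \<Longrightarrow> (\<ominus>\<^bsub>G\<^esub> x, inverse y) \<in> H"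
    and H1: "\<And>y. (\<zero>\<^bsub>G\<^esub>, y) \<in> H \<Longrightarrow> y = 1"
  obtains \<chi> where "character G \<chi>" "\<And>x y. (x, y) \<in> H \<Longrightarrow> \<chi> x = y"
proof -
  interpret G: abelian_group G by fact
  have nat: "((add_pow G (int n) x), y powi (int n)) \<in> H" if "(x, y) \<in> H" for x y n
  proof (induction n)
    case 0
    then show ?case using H0 by (simp add: add_pow_def)
  next
    case (Suc n)
    have x: "x \<in> carrier G" and y: "y \<noteq> 0" using that HG by auto
    have "(add_pow G (int n) x) \<oplus>\<^bsub>G\<^esub> x = (add_pow G (int n) x) \<oplus>\<^bsub>G\<^esub> (add_pow G (1::int) x)" using x by simp
    also have "\<dots> = (add_pow G (int (Suc n)) x)"
      using x by (simp only: G.add.int_pow_mult[symmetric]) (simp add: add.commute)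
    finally show ?case using Ha[OF Suc that] y by (simp add: mult.commute power_int_add)
  qed
  have int: "((add_pow G (k) x), y powi k) \<in> H" if xy: "(x, y) \<in> H" for x y and k :: int
  proof (cases "k \<ge> 0")
    case True
    then show ?thesis using nat[OF xy, of "nat k"] by simp
  next
    case False
    have x: "x \<in> carrier G" using xy HG by auto
    show ?thesis
      using Hm[OF nat[OF xy, of "nat (- k)"]] False x
      by (simp add: G.add.int_pow_neg[symmetric] power_int_minus[symmetric])
  qed
  have H: "partial_hom \<Z> (zmodule G) cstar_module H"
    unfolding partial_hom_def
    using HG H0 Ha H1 int by (simp add: zmodule_def cstar_module_def)
  obtain h where h: "h \<in> module_hom \<Z> (zmodule G) cstar_module" "\<And>x y. (x, y) \<in> H \<Longrightarrow> h x = y"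
    by (rule partial_hom_extend[OF zmodule_is_module[OF assms(1)] cstar_module_is_module baer_cstar_module H]) (rule that)
  have "character G h"
    unfolding character_def
    using module_homD(1,2)[OF h(1)] by (simp add: zmodule_def cstar_module_def)
  then show thesis using h(2) that by simp
qed

text \<open>
  The values \<open>[k]m \<mapsto> \<zeta>\<^sup>k\<close> define a character on the subgroup generated by \<open>N\<close> and \<open>m\<close> that is
  trivial on \<open>N\<close>, provided that \<open>\<zeta>\<^sup>k = 1\<close> whenever \<open>[k]m \<in> N\<close>.  Such a \<open>\<zeta> \<noteq> 1\<close> exists if \<open>m \<notin> N\<close>.
\<close>

lemma exists_root_of_unity:
  assumes "ideal J \<Z>" "1 \<notin> J"
  obtains \<zeta> :: complex where "\<zeta> \<noteq> 0" "\<zeta> \<noteq> 1" "\<And>k. k \<in> J \<Longrightarrow> \<zeta> powi k = 1"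
proof -
  obtain d :: int where d: "d \<ge> 0" "J = {k. d dvd k}" by (rule int_ideal_eq_multiples[OF assms(1)])
  show thesis
  proof (cases "d = 0")
    case True
    then show thesis using d by (intro that[of "-1"]) auto
  next
    case False
    have "d \<noteq> 1" using assms(2) d by auto
    define n where "n = nat d"
    have n: "d = int n" "n \<ge> 2" using d(1) False \<open>d \<noteq> 1\<close> by (auto simp: n_def)
    define \<zeta> where "\<zeta> = cis (2 * pi / real n)"
    have "\<zeta> ^ n = 1" using n(2) by (simp add: \<zeta>_def DeMoivre)
    then have "\<zeta> powi k = 1" if "k \<in> J" for k
      using that d(2) n(1) by (auto simp: power_int_mult)
    moreover have "\<zeta> \<noteq> 1"
    proof
      assume "\<zeta> = 1"
      then have "cos (2 * pi / real n) = cos 0" by (simp add: \<zeta>_def complex_eq_iff)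
      moreover have "cos (2 * pi / real n) < cos 0"
      proof (rule cos_monotone_0_pi)
        show "0 < 2 * pi / real n" using n(2) by simp
        show "2 * pi / real n \<le> pi" using n(2) by (simp add: field_simps)
      qed simp
      ultimately show False by simp
    qed
    ultimately show thesis by (intro that[of \<zeta>]) (auto simp: \<zeta>_def)
  qed
qed

lemma character_separates:
  assumes "abelian_group G" "additive_subgroup N G" "m \<in> carrier G" "m \<notin> N"
  obtains \<chi> where "character G \<chi>" "\<And>x. x \<in> N \<Longrightarrow> \<chi> x = 1" "\<chi> m \<noteq> 1"
proof -
  interpret G: abelian_group G by fact
  interpret N: additive_subgroup N G by fact
  have NG: "\<And>x. x \<in> N \<Longrightarrow> x \<in> carrier G" by (rule N.a_Hcarr)
  note pow = G.add.int_pow_mult[OF assms(3)] G.add.int_pow_neg[OF assms(3)]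
  define J where "J = {k::int. (add_pow G (k) m) \<in> N}"
  have J: "ideal J \<Z>"
  proof (rule cring.ideal_of_smult_closed[OF int_is_cring])
    show "\<zero>\<^bsub>\<Z>\<^esub> \<in> J" by (simp add: J_def add_pow_def)
    show "a \<oplus>\<^bsub>\<Z>\<^esub> b \<in> J" if "a \<in> J" "b \<in> J" for a b
      using that by (simp add: J_def pow)
    show "r \<otimes>\<^bsub>\<Z>\<^esub> a \<in> J" if "a \<in> J" for r a
    proof -
      have a: "(add_pow G (a) m) \<in> N" using that by (simp add: J_def)
      have "add_pow G r (add_pow G a m) \<in> N"
        using a G.add.subgroup_int_pow_closed[OF N.a_subgroup a] by blast
      then show ?thesis using assms(3) by (simp add: J_def G.add.int_pow_pow mult.commute)
    qed
  qed simp
  have 1: "1 \<notin> J" using assms(3,4) by (simp add: J_def)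
  obtain \<zeta> :: complex where \<zeta>: "\<zeta> \<noteq> 0" "\<zeta> \<noteq> 1" "\<And>k. k \<in> J \<Longrightarrow> \<zeta> powi k = 1"
    by (rule exists_root_of_unity[OF J 1]) (rule that)
  define H where "H = {(x \<oplus>\<^bsub>G\<^esub> (add_pow G (k) m), \<zeta> powi k) | x k. x \<in> N}"
  have HI: "(x \<oplus>\<^bsub>G\<^esub> (add_pow G (k) m), \<zeta> powi k) \<in> H" if "x \<in> N" for x k
    using that unfolding H_def by blast
  obtain \<chi> where \<chi>: "character G \<chi>" "\<And>x y. (x, y) \<in> H \<Longrightarrow> \<chi> x = y"
  proof (rule extend_character[OF assms(1), of H])
    show "H \<subseteq> carrier G \<times> {z. z \<noteq> 0}" using NG assms(3) \<zeta>(1) by (auto simp: H_def)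
    show "(\<zero>\<^bsub>G\<^esub>, 1) \<in> H" using HI[OF N.zero_closed, of 0] by (simp add: add_pow_def)
  next
    fix x y x' y' assume "(x, y) \<in> H" "(x', y') \<in> H"
    then obtain u k u' k' where *: "u \<in> N" "u' \<in> N" "x = u \<oplus>\<^bsub>G\<^esub> (add_pow G (k) m)" "y = \<zeta> powi k"
      "x' = u' \<oplus>\<^bsub>G\<^esub> (add_pow G (k') m)" "y' = \<zeta> powi k'"
      unfolding H_def by auto
    show "(x \<oplus>\<^bsub>G\<^esub> x', y * y') \<in> H"
      using HI[OF N.a_closed[OF *(1,2)], of "k + k'"] * NG[OF *(1)] NG[OF *(2)] assms(3) \<zeta>(1)
      by (simp add: pow power_int_add G.a_ac)
  next
    fix x y assume "(x, y) \<in> H"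
    then obtain u k where *: "u \<in> N" "x = u \<oplus>\<^bsub>G\<^esub> (add_pow G (k) m)" "y = \<zeta> powi k"
      unfolding H_def by auto
    show "(\<ominus>\<^bsub>G\<^esub> x, inverse y) \<in> H"
      using HI[OF N.a_inv_closed[OF *(1)], of "- k"] * NG[OF *(1)] assms(3)
      by (simp add: pow power_int_minus G.minus_add G.a_comm)
  next
    fix y assume "(\<zero>\<^bsub>G\<^esub>, y) \<in> H"
    then obtain u k where *: "u \<in> N" "\<zero>\<^bsub>G\<^esub> = u \<oplus>\<^bsub>G\<^esub> (add_pow G (k) m)" "y = \<zeta> powi k"
      unfolding H_def by auto
    have "\<ominus>\<^bsub>G\<^esub> u = (add_pow G (k) m)"
      using G.minus_equality[of "(add_pow G (k) m)" u] * NG[OF *(1)] assms(3) by (simp add: G.a_comm)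
    then have "k \<in> J" using N.a_inv_closed[OF *(1)] by (simp add: J_def)
    then show "y = 1" using \<zeta>(3) *(3) by simp
  qed auto
  have "\<chi> x = 1" if "x \<in> N" for x using \<chi>(2)[OF HI[OF that, of 0]] NG[OF that] by (simp add: add_pow_def)
  moreover have "\<chi> m = \<zeta>" using \<chi>(2)[OF HI[OF N.zero_closed, of 1]] assms(3) by simp
  ultimately show thesis using that \<chi>(1) \<zeta>(2) by blast
qed

section \<open>A large injective module\<close>

text \<open>
  Families, indexed by \<open>'i\<close>, of characters of the additive group of \<open>R\<close>; that is, a power of the
  module coinduced from the nonzero complex numbers.  Characters are normalised to be 1 outside of
  the carrier, so that equality of elements is equality of functions.
\<close>

definition coind :: "('a, 'r) ring_scheme \<Rightarrow> ('a, 'i \<Rightarrow> 'a \<Rightarrow> complex) module"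
  where "coind R =
    \<lparr>carrier = {F. \<forall>i. character R (F i) \<and> (\<forall>r. r \<notin> carrier R \<longrightarrow> F i r = 1)},
     monoid.mult = (\<lambda>F G i r. F i r * G i r), one = (\<lambda>i r. 1), ring.zero = (\<lambda>i r. 1),
     add = (\<lambda>F G i r. F i r * G i r),
     smult = (\<lambda>s F i r. if r \<in> carrier R then F i (r \<otimes>\<^bsub>R\<^esub> s) else 1)\<rparr>"

lemma coind_is_module:
  fixes R :: "('a, 'r) ring_scheme"
  assumes "cring R"
  shows "module R (coind R :: ('a, 'i \<Rightarrow> 'a \<Rightarrow> complex) module)"
proof -
  interpret R: cring R by fact
  let ?C = "coind R :: ('a, 'i \<Rightarrow> 'a \<Rightarrow> complex) module"
  show ?thesis
  proof (rule moduleI)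
    show "cring R" by fact
    show "abelian_group ?C"
    proof (rule abelian_groupI)
      show "\<exists>G\<in>carrier ?C. G \<oplus>\<^bsub>?C\<^esub> F = \<zero>\<^bsub>?C\<^esub>" if "F \<in> carrier ?C" for F
      proof (rule bexI[of _ "\<lambda>i r. inverse (F i r)"])
        have "F i r \<noteq> 0" for i r using that by (cases "r \<in> carrier R") (auto simp: coind_def character_def)
        then show "(\<lambda>i r. inverse (F i r)) \<oplus>\<^bsub>?C\<^esub> F = \<zero>\<^bsub>?C\<^esub>" by (simp add: coind_def)
        show "(\<lambda>i r. inverse (F i r)) \<in> carrier ?C" using that by (auto simp: coind_def character_def)
      qed
    qed (auto simp: coind_def character_def mult_ac)
  qed (auto simp: coind_def character_def fun_eq_iff R.l_distr R.r_distr R.m_assoc)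
qed

text \<open>
  Homomorphisms from \<open>J\<close> to a coinduced module correspond to characters of \<open>J\<close>, by evaluation at
  one, and characters extend from \<open>J\<close> to \<open>R\<close>.
\<close>

lemma baer_coind:
  fixes R :: "('a, 'r) ring_scheme"
  assumes "cring R"
  shows "baer R (coind R :: ('a, 'i \<Rightarrow> 'a \<Rightarrow> complex) module)"
  unfolding baer_def
proof (intro allI impI)
  interpret R: cring R by fact
  let ?C = "coind R :: ('a, 'i \<Rightarrow> 'a \<Rightarrow> complex) module"
  interpret C: module R ?C by (rule coind_is_module[OF assms])
  fix J and \<phi> :: "'a \<Rightarrow> 'i \<Rightarrow> 'a \<Rightarrow> complex"
  assume J: "ideal J R" and \<phi>: "\<phi> \<in> J \<rightarrow> carrier ?C"
    and a: "\<forall>r\<in>J. \<forall>s\<in>J. \<phi> (r \<oplus>\<^bsub>R\<^esub> s) = \<phi> r \<oplus>\<^bsub>?C\<^esub> \<phi> s"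
    and s: "\<forall>r\<in>carrier R. \<forall>s\<in>J. \<phi> (r \<otimes>\<^bsub>R\<^esub> s) = r \<odot>\<^bsub>?C\<^esub> \<phi> s"
  interpret J: ideal J R by fact
  have JR: "\<And>x. x \<in> J \<Longrightarrow> x \<in> carrier R" by (rule J.Icarr)
  have nz: "\<phi> r i t \<noteq> 0" if "r \<in> J" "t \<in> carrier R" for r i t
  proof -
    have "\<phi> r \<in> carrier ?C" using \<phi> that(1) by blast
    then show ?thesis using that(2) by (simp add: coind_def character_def)
  qed
  have add: "\<phi> (r \<oplus>\<^bsub>R\<^esub> t) i u = \<phi> r i u * \<phi> t i u" if "r \<in> J" "t \<in> J" for r t i u
    using a that by (simp add: coind_def)
  have zero: "\<phi> \<zero>\<^bsub>R\<^esub> i \<one>\<^bsub>R\<^esub> = 1" for i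
    using add[OF J.zero_closed J.zero_closed, of i "\<one>\<^bsub>R\<^esub>"] nz[OF J.zero_closed R.one_closed, of i] by simp
  have "\<exists>\<psi>. character R \<psi> \<and> (\<forall>r\<in>J. \<psi> r = \<phi> r i \<one>\<^bsub>R\<^esub>)" for i
  proof -
    let ?H = "(\<lambda>r. (r, \<phi> r i \<one>\<^bsub>R\<^esub>)) ` J"
    obtain \<psi> where "character R \<psi>" "\<And>x y. (x, y) \<in> ?H \<Longrightarrow> \<psi> x = y"
    proof (rule extend_character[of R ?H])
      show "abelian_group R" by unfold_locales
      show "?H \<subseteq> carrier R \<times> {z. z \<noteq> 0}" using JR nz by auto
      show "(\<zero>\<^bsub>R\<^esub>, 1) \<in> ?H" using zero J.zero_closed by (intro image_eqI[of _ _ "\<zero>\<^bsub>R\<^esub>"]) auto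
      show "(x \<oplus>\<^bsub>R\<^esub> x', y * y') \<in> ?H" if "(x, y) \<in> ?H" "(x', y') \<in> ?H" for x y x' y'
        using that add J.a_closed by (intro image_eqI[of _ _ "x \<oplus>\<^bsub>R\<^esub> x'"]) auto
      show "(\<ominus>\<^bsub>R\<^esub> x, inverse y) \<in> ?H" if "(x, y) \<in> ?H" for x y
      proof -
        have x: "x \<in> J" "y = \<phi> x i \<one>\<^bsub>R\<^esub>" using that by auto
        have "\<phi> (\<ominus>\<^bsub>R\<^esub> x) i \<one>\<^bsub>R\<^esub> * \<phi> x i \<one>\<^bsub>R\<^esub> = 1"
          using add[OF J.a_inv_closed[OF x(1)] x(1)] zero JR[OF x(1)] by (metis R.l_neg)
        then show ?thesis using x J.a_inv_closed[OF x(1)]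
          by (intro image_eqI[of _ _ "\<ominus>\<^bsub>R\<^esub> x"]) (auto simp: inverse_unique mult.commute)
      qed
      show "y = 1" if "(\<zero>\<^bsub>R\<^esub>, y) \<in> ?H" for y using that zero by auto
    qed (rule that)
    then show ?thesis by (intro exI[of _ \<psi>]) auto
  qed
  then obtain \<psi> where \<psi>: "\<And>i. character R (\<psi> i)" "\<And>i r. r \<in> J \<Longrightarrow> \<psi> i r = \<phi> r i \<one>\<^bsub>R\<^esub>" by metis
  define e where "e i r = (if r \<in> carrier R then \<psi> i r else 1)" for i r
  have "e \<in> carrier ?C" using \<psi>(1) by (simp add: coind_def character_def e_def)
  moreover have "\<phi> r = r \<odot>\<^bsub>?C\<^esub> e" if r: "r \<in> J" for r
  proof (intro ext)
    fix i t
    show "\<phi> r i t = (r \<odot>\<^bsub>?C\<^esub> e) i t"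
    proof (cases "t \<in> carrier R")
      case True
      have "(r \<odot>\<^bsub>?C\<^esub> e) i t = \<phi> (t \<otimes>\<^bsub>R\<^esub> r) i \<one>\<^bsub>R\<^esub>"
        using True JR[OF r] \<psi>(2)[OF J.I_l_closed[OF r True]] by (simp add: coind_def e_def)
      also have "\<phi> (t \<otimes>\<^bsub>R\<^esub> r) = t \<odot>\<^bsub>?C\<^esub> \<phi> r" using s True r by blast
      also have "(t \<odot>\<^bsub>?C\<^esub> \<phi> r) i \<one>\<^bsub>R\<^esub> = \<phi> r i t" using True by (simp add: coind_def)
      finally show ?thesis by simp
    next
      case False
      have "\<phi> r \<in> carrier ?C" using \<phi> r by blast
      then show ?thesis using False by (simp add: coind_def)
    qed
  qed
  ultimately show "\<exists>e\<in>carrier ?C. \<forall>r\<in>J. \<phi> r = r \<odot>\<^bsub>?C\<^esub> e" by blast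
qed

text \<open>
  The index type consists of all functions \<open>\<chi>\<close> on \<open>M\<close>; the component at a character \<open>\<chi>\<close> that is trivial
  on \<open>N\<close> sends \<open>m\<close> to \<open>r \<mapsto> \<chi>(r m)\<close>, and the other components are trivial.  Since these characters
  separate points modulo \<open>N\<close>, the kernel is exactly \<open>N\<close>.
\<close>

lemma module_hom_coind_with_kernel:
  fixes R :: "('a, 'r) ring_scheme" and M :: "('a, 'm, 'x) module_scheme"
  assumes "module R M" "submodule N R M"
  obtains f where "f \<in> module_hom R M (coind R :: ('a, ('m \<Rightarrow> complex) \<Rightarrow> 'a \<Rightarrow> complex) module)"
    "a_kernel M (coind R :: ('a, ('m \<Rightarrow> complex) \<Rightarrow> 'a \<Rightarrow> complex) module) f = N"
proof -
  interpret M: module R M by fact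
  let ?C = "coind R :: ('a, ('m \<Rightarrow> complex) \<Rightarrow> 'a \<Rightarrow> complex) module"
  note N = M.submoduleE[OF assms(2)]
  have ab: "abelian_group M" by unfold_locales
  have asub: "additive_subgroup N M"
    using assms(2) by (intro additive_subgroup.intro) (rule submodule.axioms(1))
  define f where "f m = (\<lambda>\<chi> r. if r \<in> carrier R \<and> character M \<chi> \<and> (\<forall>x\<in>N. \<chi> x = 1) then \<chi> (r \<odot>\<^bsub>M\<^esub> m) else 1)"
    for m
  have "f \<in> module_hom R M ?C"
  proof (rule module_homI)
    show "f x \<in> carrier ?C" if "x \<in> carrier M" for x
      using that by (auto simp: coind_def f_def character_def M.smult_l_distr)
    show "f (x \<oplus>\<^bsub>M\<^esub> y) = f x \<oplus>\<^bsub>?C\<^esub> f y" if "x \<in> carrier M" "y \<in> carrier M" for x y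
      using that by (auto simp: coind_def f_def character_def M.smult_r_distr fun_eq_iff)
    show "f (r \<odot>\<^bsub>M\<^esub> x) = r \<odot>\<^bsub>?C\<^esub> f x" if "r \<in> carrier R" "x \<in> carrier M" for r x
      using that by (auto simp: coind_def f_def M.smult_assoc1 fun_eq_iff)
  qed
  moreover have "f m = \<zero>\<^bsub>?C\<^esub> \<longleftrightarrow> m \<in> N" if m: "m \<in> carrier M" for m
  proof
    assume "m \<in> N"
    then have "r \<odot>\<^bsub>M\<^esub> m \<in> N" if "r \<in> carrier R" for r using N(4) that by blast
    then show "f m = \<zero>\<^bsub>?C\<^esub>" by (auto simp: f_def coind_def fun_eq_iff)
  next
    assume 0: "f m = \<zero>\<^bsub>?C\<^esub>"
    show "m \<in> N"
    proof (rule ccontr)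
      assume "m \<notin> N"
      obtain \<chi> where \<chi>: "character M \<chi>" "\<And>x. x \<in> N \<Longrightarrow> \<chi> x = 1" "\<chi> m \<noteq> 1"
        by (rule character_separates[OF ab asub m \<open>m \<notin> N\<close>]) (rule that)
      have "f m \<chi> \<one>\<^bsub>R\<^esub> = \<chi> m" using \<chi>(1,2) m by (simp add: f_def)
      then show False using 0 \<chi>(3) by (simp add: coind_def)
    qed
  qed
  then have "a_kernel M ?C f = N"
    using N(1) by (auto simp: a_kernel_def')
  ultimately show thesis by (rule that)
qed

section \<open>Small injective modules\<close>

lemma UN_lepoll_infinite:
  assumes "infinite B" "I \<lesssim> B" "\<And>i. i \<in> I \<Longrightarrow> A i \<lesssim> B"
  shows "(\<Union>i\<in>I. A i) \<lesssim> B"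
  using assms card_of_UNION_ordLeq_infinite[of B I A] unfolding lepoll_def card_of_ordLeq by blast

lemma Times_lepoll_infinite:
  assumes "infinite U" "A \<lesssim> U" "B \<lesssim> U"
  shows "A \<times> B \<lesssim> U"
proof -
  have "(\<Union>a\<in>A. Pair a ` B) \<lesssim> U"
    using assms by (intro UN_lepoll_infinite) (auto intro: lepoll_trans[OF image_lepoll])
  moreover have "(\<Union>a\<in>A. Pair a ` B) = A \<times> B" by auto
  ultimately show ?thesis by simp
qed

lemma lists_lepoll_infinite:
  assumes "infinite U" "A \<lesssim> U"
  shows "lists A \<lesssim> U"
proof -
  have len: "{xs \<in> lists A. length xs = n} \<lesssim> U" for n
  proof (induction n)
    case 0
    have *: "{xs \<in> lists A. length xs = 0} = {[]}" by auto
    show ?case unfolding * by (rule finite_lepoll_infinite[OF assms(1)]) simp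
  next
    case (Suc n)
    have "{xs \<in> lists A. length xs = Suc n}
        \<subseteq> (\<lambda>(x, xs). x # xs) ` (A \<times> {xs \<in> lists A. length xs = n})"
      by (auto simp: length_Suc_conv image_iff)
    then show ?case
      by (rule lepoll_trans[OF subset_image_lepoll Times_lepoll_infinite[OF assms Suc]])
  qed
  have "(\<Union>n::nat. {xs \<in> lists A. length xs = n}) \<lesssim> U"
    using assms(1) len by (intro UN_lepoll_infinite) (simp_all add: infinite_le_lepoll)
  moreover have "(\<Union>n::nat. {xs \<in> lists A. length xs = n}) = lists A" by auto
  ultimately show ?thesis by simp
qed

text \<open>
  A Loewenheim-Skolem argument: closing a set under a family of finitary operations does not raise
  its cardinality above an infinite bound for the set and for the number of operations.
\<close>

lemma closure_lepoll_infinite: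
  fixes f :: "'i \<Rightarrow> 'e list \<Rightarrow> 'e"
  assumes "infinite U" "I \<lesssim> U" "A \<lesssim> U"
  obtains C where "A \<subseteq> C" "C \<lesssim> U" "\<And>i xs. i \<in> I \<Longrightarrow> set xs \<subseteq> C \<Longrightarrow> f i xs \<in> C"
proof -
  define T where "T = rec_nat A (\<lambda>_ C. C \<union> (\<lambda>(i, xs). f i xs) ` (I \<times> lists C))"
  have T0: "T 0 = A" and TS: "T (Suc n) = T n \<union> (\<lambda>(i, xs). f i xs) ` (I \<times> lists (T n))" for n
    by (simp_all add: T_def)
  have small: "T n \<lesssim> U" for n
  proof (induction n)
    case 0
    then show ?case using assms(3) T0 by simp
  next
    case (Suc n)
    have "(\<lambda>(i, xs). f i xs) ` (I \<times> lists (T n)) \<lesssim> U"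
      by (rule lepoll_trans[OF image_lepoll])
         (intro Times_lepoll_infinite lists_lepoll_infinite assms Suc)
    then have "(\<Union>b\<in>UNIV. if b then T n else (\<lambda>(i, xs). f i xs) ` (I \<times> lists (T n))) \<lesssim> U"
      using Suc finite_lepoll_infinite[OF assms(1), of "UNIV :: bool set"]
      by (intro UN_lepoll_infinite assms) auto
    then show ?case unfolding TS by (simp add: UNIV_bool Un_commute)
  qed
  have mono: "mono T" by (rule incseq_SucI) (auto simp: TS)
  define C where "C = (\<Union>n. T n)"
  have fin: "\<exists>n. set xs \<subseteq> T n" if "set xs \<subseteq> C" for xs
    using that
  proof (induction xs)
    case (Cons x xs)
    then obtain m n where "x \<in> T m" "set xs \<subseteq> T n" by (auto simp: C_def)
    then have "x \<in> T (max m n)" "set xs \<subseteq> T (max m n)"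
      using monoD[OF mono, of m "max m n"] monoD[OF mono, of n "max m n"] by auto
    then show ?case by auto
  qed auto
  show thesis
  proof (rule that[of C])
    show "A \<subseteq> C" using T0 by (auto simp: C_def)
    show "C \<lesssim> U" unfolding C_def using small assms(1)
      by (intro UN_lepoll_infinite) (auto simp: infinite_le_lepoll)
    show "f i xs \<in> C" if i: "i \<in> I" and xs: "set xs \<subseteq> C" for i xs
    proof -
      obtain n where "set xs \<subseteq> T n" using fin[OF xs] by blast
      then have "f i xs \<in> T (Suc n)" using i by (auto simp: TS intro!: image_eqI[of _ _ "(i, xs)"])
      then show ?thesis by (auto simp: C_def)
    qed
  qed
qed

text \<open>
  One family of operations on lists that contains zero, sum, multiplication with a scalar, and the
  solution \<open>e\<close> of the system of equations \<open>r e = x\<close> given by a list of coefficients and a list of right-hand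
  sides.  Without a solution the value is arbitrary and may leave the module.
\<close>

fun module_op :: "('a, 'e, 'z) module_scheme \<Rightarrow> 'a list \<times> bool \<Rightarrow> 'e list \<Rightarrow> 'e"
  where
    "module_op E (rs, False) xs =
      (SOME e. e \<in> carrier E \<and> (\<forall>(r, x)\<in>set (zip rs xs). r \<odot>\<^bsub>E\<^esub> e = x))"
  | "module_op E (rs, True) [] = \<zero>\<^bsub>E\<^esub>"
  | "module_op E (rs, True) [x] = hd rs \<odot>\<^bsub>E\<^esub> x"
  | "module_op E (rs, True) (x # y # xs) = x \<oplus>\<^bsub>E\<^esub> y"

text \<open>
  A homomorphism \<open>\<phi>\<close> from \<open>J = (r\<^sub>1,\<dots>,r\<^sub>n)\<close> to the submodule is represented by an element of \<open>E\<close>, so the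
  finite system \<open>r\<^sub>i e = \<phi>(r\<^sub>i)\<close> is solvable in \<open>E\<close>, hence in the submodule by closure.  This is the only
  point of the construction of resolutions where finite generation of ideals matters.
\<close>

lemma small_baer_submodule:
  assumes "noetherian_ring R" "module R E" "baer R E" "A \<subseteq> carrier E"
    and U: "infinite U" "carrier R \<lesssim> U" "A \<lesssim> U"
  obtains C where "submodule C R E" "A \<subseteq> C" "C \<lesssim> U" "baer R (E\<lparr>carrier := C\<rparr>)"
proof -
  interpret E: module R E by fact
  let ?I = "lists (carrier R) \<times> (UNIV :: bool set)"
  have "?I \<lesssim> U"
    using U finite_lepoll_infinite[OF U(1), of "UNIV :: bool set"]
    by (intro Times_lepoll_infinite lists_lepoll_infinite) auto
  then obtain D where D: "A \<subseteq> D" "D \<lesssim> U"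
    "\<And>i xs. i \<in> ?I \<Longrightarrow> set xs \<subseteq> D \<Longrightarrow> module_op E i xs \<in> D"
    using closure_lepoll_infinite[OF U(1) _ U(3), of ?I "module_op E"] by metis
  \<comment> \<open>Values of the operations without meaning may lie outside of \<open>E\<close>, so the closure is cut down to it.\<close>
  define C where "C = D \<inter> carrier E"
  have CE: "\<And>x. x \<in> C \<Longrightarrow> x \<in> carrier E" by (simp add: C_def)
  have zero: "\<zero>\<^bsub>E\<^esub> \<in> C" using D(3)[of "([], True)" "[]"] by (simp add: C_def)
  have add: "x \<oplus>\<^bsub>E\<^esub> y \<in> C" if "x \<in> C" "y \<in> C" for x y
    using D(3)[of "([], True)" "[x, y]"] that by (simp add: C_def)
  have smult: "r \<odot>\<^bsub>E\<^esub> x \<in> C" if "r \<in> carrier R" "x \<in> C" for r x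
    using D(3)[of "([r], True)" "[x]"] that by (simp add: C_def)
  have sub: "submodule C R E"
  proof (rule E.submoduleI)
    show "\<ominus>\<^bsub>E\<^esub> x \<in> C" if "x \<in> C" for x
      using smult[of "\<ominus>\<^bsub>R\<^esub> \<one>\<^bsub>R\<^esub>" x] that CE by (simp add: E.smult_minus_one)
  qed (use zero add smult CE in auto)
  have "baer R (E\<lparr>carrier := C\<rparr>)"
    unfolding baer_def
  proof (intro allI impI)
    fix J \<phi>
    assume J: "ideal J R" and \<phi>: "\<phi> \<in> J \<rightarrow> carrier (E\<lparr>carrier := C\<rparr>)"
      and a: "\<forall>r\<in>J. \<forall>s\<in>J. \<phi> (r \<oplus>\<^bsub>R\<^esub> s) = \<phi> r \<oplus>\<^bsub>E\<lparr>carrier := C\<rparr>\<^esub> \<phi> s"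
      and s: "\<forall>r\<in>carrier R. \<forall>s\<in>J. \<phi> (r \<otimes>\<^bsub>R\<^esub> s) = r \<odot>\<^bsub>E\<lparr>carrier := C\<rparr>\<^esub> \<phi> s"
    interpret J: ideal J R by fact
    have JR: "\<And>x. x \<in> J \<Longrightarrow> x \<in> carrier R" by (rule J.Icarr)
    have \<phi>C: "\<And>r. r \<in> J \<Longrightarrow> \<phi> r \<in> C" using \<phi> by auto
    obtain e where e: "e \<in> carrier E" "\<And>r. r \<in> J \<Longrightarrow> \<phi> r = r \<odot>\<^bsub>E\<^esub> e"
      by (rule baerD[OF assms(3) J, of \<phi>]) (use \<phi>C CE a s in \<open>auto\<close>)
    obtain B where "B \<subseteq> carrier R" "finite B" "J = Idl\<^bsub>R\<^esub> B"
      using noetherian_ring.finetely_gen[OF assms(1) J] by blast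
    then obtain rs where rs: "set rs \<subseteq> carrier R" "J = Idl\<^bsub>R\<^esub> (set rs)"
      using finite_list by blast
    have rsJ: "set rs \<subseteq> J" using E.R.genideal_self[OF rs(1)] rs(2) by simp
    define e' where "e' = module_op E (rs, False) (map \<phi> rs)"
    have "rs ! i \<odot>\<^bsub>E\<^esub> e = \<phi> (rs ! i)" if "i < length rs" for i
      using e(2)[of "rs ! i"] rsJ nth_mem[OF that] by auto
    then have "\<exists>e. e \<in> carrier E \<and> (\<forall>(r, x)\<in>set (zip rs (map \<phi> rs)). r \<odot>\<^bsub>E\<^esub> e = x)"
      using e(1) by (intro exI[of _ e]) (auto simp: set_zip)
    then have "e' \<in> carrier E \<and> (\<forall>(r, x)\<in>set (zip rs (map \<phi> rs)). r \<odot>\<^bsub>E\<^esub> e' = x)"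
      unfolding e'_def module_op.simps by (rule someI_ex)
    then have e': "e' \<in> carrier E" "\<forall>(r, x)\<in>set (zip rs (map \<phi> rs)). r \<odot>\<^bsub>E\<^esub> e' = x"
      by simp_all
    then have gen: "r \<odot>\<^bsub>E\<^esub> e' = \<phi> r" if "r \<in> set rs" for r
      using that by (fastforce simp: set_zip in_set_conv_nth)
    have "set (map \<phi> rs) \<subseteq> D" using \<phi>C rsJ by (auto simp: C_def)
    then have "e' \<in> D" unfolding e'_def by (intro D(3)) (use rs(1) in auto)
    then have "e' \<in> C" unfolding C_def using e'(1) by simp
    moreover have "\<phi> r = r \<odot>\<^bsub>E\<^esub> e'" if "r \<in> J" for r
    proof -
      have "ideal {r \<in> J. r \<odot>\<^bsub>E\<^esub> e' = r \<odot>\<^bsub>E\<^esub> e} R"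
        by (rule E.R.ideal_of_smult_closed)
           (use e(1) e'(1) JR J.a_closed J.I_l_closed J.zero_closed in
             \<open>auto simp: E.smult_l_distr E.smult_assoc1\<close>)
      moreover have "set rs \<subseteq> {r \<in> J. r \<odot>\<^bsub>E\<^esub> e' = r \<odot>\<^bsub>E\<^esub> e}" using rsJ gen e(2)[symmetric] by auto
      ultimately have "J \<subseteq> {r \<in> J. r \<odot>\<^bsub>E\<^esub> e' = r \<odot>\<^bsub>E\<^esub> e}"
        unfolding rs(2) by (rule E.R.genideal_minimal)
      then have "r \<odot>\<^bsub>E\<^esub> e' = r \<odot>\<^bsub>E\<^esub> e" using that by blast
      then show ?thesis using e(2)[OF that] by simp
    qed
    ultimately show "\<exists>e\<in>carrier (E\<lparr>carrier := C\<rparr>). \<forall>r\<in>J. \<phi> r = r \<odot>\<^bsub>E\<lparr>carrier := C\<rparr>\<^esub> e" by auto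
  qed
  moreover have "A \<subseteq> C" using D(1) assms(4) by (auto simp: C_def)
  moreover have "C \<lesssim> U" using D(2) by (auto simp: C_def intro: lepoll_trans[OF subset_imp_lepoll])
  ultimately show thesis using that sub by blast
qed

lemma baer_copy_module:
  assumes "module R E" "baer R E" and inj: "inj_on \<iota> (carrier E)"
  shows "baer R (copy_module \<iota> E)"
  unfolding baer_def
proof (intro allI impI)
  note cs = copy_module_simps[OF inj]
  let ?C = "copy_module \<iota> E"
  fix J \<phi>
  assume J: "ideal J R" and \<phi>: "\<phi> \<in> J \<rightarrow> carrier ?C"
    and a: "\<forall>r\<in>J. \<forall>s\<in>J. \<phi> (r \<oplus>\<^bsub>R\<^esub> s) = \<phi> r \<oplus>\<^bsub>?C\<^esub> \<phi> s"
    and s: "\<forall>r\<in>carrier R. \<forall>s\<in>J. \<phi> (r \<otimes>\<^bsub>R\<^esub> s) = r \<odot>\<^bsub>?C\<^esub> \<phi> s"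
  interpret E: module R E by fact
  interpret J: ideal J R by fact
  have JR: "\<And>x. x \<in> J \<Longrightarrow> x \<in> carrier R" by (rule J.Icarr)
  define \<psi> where "\<psi> r = inv_into (carrier E) \<iota> (\<phi> r)" for r
  have \<phi>m: "\<phi> r \<in> \<iota> ` carrier E" if "r \<in> J" for r using \<phi> that cs(1) by auto
  have \<psi>: "\<psi> r \<in> carrier E" "\<phi> r = \<iota> (\<psi> r)" if "r \<in> J" for r
    using inv_into_into[OF \<phi>m[OF that]] f_inv_into_f[OF \<phi>m[OF that]] by (simp_all add: \<psi>_def)
  have \<psi>_eq: "\<psi> r = x" if "\<phi> r = \<iota> x" "x \<in> carrier E" for r x
    using that inj by (simp add: \<psi>_def)
  obtain e where e: "e \<in> carrier E" "\<And>r. r \<in> J \<Longrightarrow> \<psi> r = r \<odot>\<^bsub>E\<^esub> e"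
  proof (rule baerD[OF assms(2) J, of \<psi>])
    show "\<psi> (r \<oplus>\<^bsub>R\<^esub> t) = \<psi> r \<oplus>\<^bsub>E\<^esub> \<psi> t" if "r \<in> J" "t \<in> J" for r t
      using a that by (intro \<psi>_eq) (simp_all add: \<psi> cs)
    show "\<psi> (r \<otimes>\<^bsub>R\<^esub> t) = r \<odot>\<^bsub>E\<^esub> \<psi> t" if "r \<in> carrier R" "t \<in> J" for r t
      using s that by (intro \<psi>_eq) (simp_all add: \<psi> cs)
  qed (simp_all add: \<psi>)
  have "\<phi> r = r \<odot>\<^bsub>?C\<^esub> \<iota> e" if "r \<in> J" for r
    unfolding \<psi>(2)[OF that] e(2)[OF that] cs(4)[OF e(1)] ..
  then show "\<exists>e\<in>carrier ?C. \<forall>r\<in>J. \<phi> r = r \<odot>\<^bsub>?C\<^esub> e" using e(1) cs(1) by blast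
qed

text \<open>
  With \<open>N = 0\<close> this says that there are enough injectives within the type \<open>'u\<close>; general \<open>N\<close> replaces an
  embedding of the quotient by \<open>N\<close>.
\<close>

lemma injective_module_with_kernel:
  fixes R :: "('a, 'r) ring_scheme" and M :: "('a, 'm, 'x) module_scheme"
  assumes "noetherian_ring R" "module R M" "submodule N R M"
    and U: "infinite (UNIV :: 'u set)" "carrier R \<lesssim> (UNIV :: 'u set)" "carrier M \<lesssim> (UNIV :: 'u set)"
  obtains E :: "('a, 'u) module" and f
  where "injective_module R E" "f \<in> module_hom R M E" "a_kernel M E f = N"
proof -
  let ?C = "coind R :: ('a, ('m \<Rightarrow> complex) \<Rightarrow> 'a \<Rightarrow> complex) module"
  interpret M: module R M by fact
  obtain f where f: "f \<in> module_hom R M ?C" "a_kernel M ?C f = N"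
    by (rule module_hom_coind_with_kernel[OF assms(2,3)])
  have C: "module R ?C" "baer R ?C"
    using coind_is_module[OF M.R.is_cring] baer_coind[OF M.R.is_cring] .
  interpret C: module R ?C by fact
  have img: "f ` carrier M \<subseteq> carrier ?C" using module_homD(1)[OF f(1)] by auto
  have sm: "f ` carrier M \<lesssim> (UNIV :: 'u set)" using image_lepoll U(3) by (rule lepoll_trans)
  obtain D where D: "submodule D R ?C" "f ` carrier M \<subseteq> D" "D \<lesssim> (UNIV :: 'u set)"
      "baer R (?C\<lparr>carrier := D\<rparr>)"
    by (rule small_baer_submodule[OF assms(1) C img U(1,2) sm])
  let ?D = "?C\<lparr>carrier := D\<rparr>"
  have Dm: "module R ?D" by (rule submodule.submodule_is_module[OF D(1) C(1)])
  obtain \<iota> :: "_ \<Rightarrow> 'u" where "inj_on \<iota> D" using D(3) by (auto simp: lepoll_def)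
  then have inj: "inj_on \<iota> (carrier ?D)" by simp
  note cs = copy_module_simps[OF inj]
  have zD: "\<zero>\<^bsub>?C\<^esub> \<in> D" using subgroup.one_closed[OF submodule.axioms(1)[OF D(1)]] by simp
  show thesis
  proof (rule that[of "copy_module \<iota> ?D" "\<iota> \<circ> f"])
    show "injective_module R (copy_module \<iota> ?D)"
      by (intro injective_module_if_baer copy_module_is_module baer_copy_module Dm D(4) inj)
    have fD: "f x \<in> D" if "x \<in> carrier M" for x using D(2) that by auto
    show "\<iota> \<circ> f \<in> module_hom R M (copy_module \<iota> ?D)"
      by (rule module_homI) (simp_all add: cs fD module_homD[OF f(1)] del: module.update_convs)
    show "a_kernel M (copy_module \<iota> ?D) (\<iota> \<circ> f) = N"
      unfolding f(2)[symmetric] a_kernel_def' using inj fD zD by (auto simp: cs inj_on_eq_iff)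
  qed
qed

section \<open>Injective resolutions\<close>

lemma image_is_submodule:
  assumes "module R M" "module R N" "f \<in> module_hom R M N"
  shows "submodule (f ` carrier M) R N"
proof -
  interpret M: module R M by fact
  interpret N: module R N by fact
  note f = module_homD[OF assms(3)]
  have smult: "r \<odot>\<^bsub>N\<^esub> x \<in> f ` carrier M" if r: "r \<in> carrier R" and x: "x \<in> f ` carrier M" for r x
  proof -
    obtain a where a: "a \<in> carrier M" "x = f a" using x by auto
    then have "r \<odot>\<^bsub>N\<^esub> x = f (r \<odot>\<^bsub>M\<^esub> a)" using f(3)[OF r a(1)] by simp
    then show ?thesis using M.smult_closed[OF r a(1)] by simp
  qed
  have sub: "f ` carrier M \<subseteq> carrier N" using f(1) by auto
  show ?thesis
  proof (rule N.submoduleI)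
    show "\<zero>\<^bsub>N\<^esub> \<in> f ` carrier M" using module_hom_zero[OF assms] by (metis M.M.zero_closed image_eqI)
    show "x \<oplus>\<^bsub>N\<^esub> y \<in> f ` carrier M" if x: "x \<in> f ` carrier M" and y: "y \<in> f ` carrier M" for x y
    proof -
      obtain a b where a: "a \<in> carrier M" "x = f a" "b \<in> carrier M" "y = f b" using x y by auto
      then have "x \<oplus>\<^bsub>N\<^esub> y = f (a \<oplus>\<^bsub>M\<^esub> b)" using f(2)[OF a(1,3)] by simp
      then show ?thesis using a(1,3) by simp
    qed
    show "\<ominus>\<^bsub>N\<^esub> x \<in> f ` carrier M" if "x \<in> f ` carrier M" for x
      using smult[OF _ that, of "\<ominus>\<^bsub>R\<^esub> \<one>\<^bsub>R\<^esub>"] sub that N.smult_minus_one by auto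
  qed (use sub smult in auto)
qed

lemma module_hom_inj_on:
  assumes "module R M" "module R N" "f \<in> module_hom R M N" "a_kernel M N f = {\<zero>\<^bsub>M\<^esub>}"
  shows "inj_on f (carrier M)"
proof (rule inj_onI)
  interpret M: module R M by fact
  interpret N: module R N by fact
  fix x y assume *: "x \<in> carrier M" "y \<in> carrier M" "f x = f y"
  let ?z = "x \<oplus>\<^bsub>M\<^esub> (\<ominus>\<^bsub>R\<^esub> \<one>\<^bsub>R\<^esub>) \<odot>\<^bsub>M\<^esub> y"
  have "f ?z = f x \<oplus>\<^bsub>N\<^esub> (\<ominus>\<^bsub>R\<^esub> \<one>\<^bsub>R\<^esub>) \<odot>\<^bsub>N\<^esub> f y"
    using * by (simp add: module_homD[OF assms(3)])
  also have "\<dots> = \<zero>\<^bsub>N\<^esub>"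
    using * module_homD(1)[OF assms(3)] by (simp add: N.smult_minus_one N.M.r_neg)
  finally have "?z \<in> a_kernel M N f" using * by (simp add: a_kernel_def')
  then have "x \<oplus>\<^bsub>M\<^esub> \<ominus>\<^bsub>M\<^esub> y = \<zero>\<^bsub>M\<^esub>" using assms(4) * by (simp add: M.smult_minus_one)
  then show "x = y" using M.M.minus_equality[of x "\<ominus>\<^bsub>M\<^esub> y"] * by simp
qed

text \<open>
  The resolution is built by dependent choice on pairs of an injective module and the image of the
  previous map in it, which becomes the kernel of the next map.
\<close>

lemma injective_resolution_exists:
  fixes R :: "('a, 'r) ring_scheme" and X :: "('a, 'm, 'x) module_scheme"
  assumes "noetherian_ring R" "module R X"
    and U: "infinite (UNIV :: 'u set)" "carrier R \<lesssim> (UNIV :: 'u set)" "carrier X \<lesssim> (UNIV :: 'u set)"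
  shows "\<exists>(I :: nat \<Rightarrow> ('a, 'u) module) d \<epsilon>. injective_resolution R X I d \<epsilon>"
proof -
  interpret X: module R X by fact
  have z: "submodule {\<zero>\<^bsub>X\<^esub>} R X" by (rule X.submoduleI) auto
  obtain E :: "('a, 'u) module" and \<epsilon> where
    E: "injective_module R E" "\<epsilon> \<in> module_hom R X E" "a_kernel X E \<epsilon> = {\<zero>\<^bsub>X\<^esub>}"
    by (rule injective_module_with_kernel[OF assms(1,2) z U])
  have Em: "module R E" using E(1) by (simp add: injective_module_def)
  \<comment> \<open>The case \<open>n = 0\<close> pins the start of the sequence to the embedding of \<open>X\<close>.\<close>
  let ?P = "\<lambda>n (M :: ('a, 'u) module, K).
    injective_module R M \<and> submodule K R M \<and> (n = (0 :: nat) \<longrightarrow> M = E \<and> K = \<epsilon> ` carrier X)"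
  let ?Q = "\<lambda>(n :: nat) (M :: ('a, 'u) module, K) (M' :: ('a, 'u) module, K').
    \<exists>d\<in>module_hom R M M'. a_kernel M M' d = K \<and> d ` carrier M = K'"
  have "\<exists>s. \<forall>n. ?P n (s n) \<and> ?Q n (s n) (s (Suc n))"
  proof (rule dependent_nat_choice)
    show "\<exists>s. ?P 0 s"
      using E image_is_submodule[OF assms(2) Em E(2)] by (intro exI[of _ "(E, \<epsilon> ` carrier X)"]) simp
    fix s n assume s: "?P n s"
    obtain M :: "('a, 'u) module" and K where MK: "s = (M, K)" by (cases s)
    have M: "module R M" "submodule K R M" using s MK by (auto simp: injective_module_def)
    have U': "carrier M \<lesssim> (UNIV :: 'u set)" by (simp add: subset_imp_lepoll)
    obtain M' :: "('a, 'u) module" and d where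
      M': "injective_module R M'" "d \<in> module_hom R M M'" "a_kernel M M' d = K"
      by (rule injective_module_with_kernel[OF assms(1) M U(1,2) U'])
    have "module R M'" using M'(1) by (simp add: injective_module_def)
    then have "submodule (d ` carrier M) R M'" by (intro image_is_submodule M M')
    then show "\<exists>s'. ?P (Suc n) s' \<and> ?Q n s s'"
      using M' MK by (intro exI[of _ "(M', d ` carrier M)"]) auto
  qed
  then obtain s where s: "\<forall>n. ?P n (s n) \<and> ?Q n (s n) (s (Suc n))" by (rule exE)
  define I where "I n = fst (s n)" for n
  define K where "K n = snd (s n)" for n
  have sIK: "s n = (I n, K n)" for n by (simp add: I_def K_def)
  have step: "\<exists>d. d \<in> module_hom R (I n) (I (Suc n)) \<and> a_kernel (I n) (I (Suc n)) d = K n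
      \<and> d ` carrier (I n) = K (Suc n)" for n
    using s[rule_format, THEN conjunct2, of n] unfolding sIK prod.case by blast
  define d where "d n = (SOME d. d \<in> module_hom R (I n) (I (Suc n)) \<and>
      a_kernel (I n) (I (Suc n)) d = K n \<and> d ` carrier (I n) = K (Suc n))" for n
  have d: "d n \<in> module_hom R (I n) (I (Suc n))" "a_kernel (I n) (I (Suc n)) (d n) = K n"
    "d n ` carrier (I n) = K (Suc n)" for n
    using someI_ex[OF step[of n], folded d_def] by blast+
  have P: "injective_module R (I n) \<and> submodule (K n) R (I n) \<and>
      (n = 0 \<longrightarrow> I n = E \<and> K n = \<epsilon> ` carrier X)" for n
    using s[rule_format, THEN conjunct1, of n] unfolding sIK prod.case .
  have I: "injective_module R (I n)" for n using P[of n] by blast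
  have I0: "I 0 = E" "K 0 = \<epsilon> ` carrier X" using P[of 0] by blast+
  have "injective_resolution R X I d \<epsilon>"
    unfolding injective_resolution_def
  proof (intro conjI allI I d(1))
    show "\<epsilon> \<in> module_hom R X (I 0)" using E(2) I0(1) by simp
    show "inj_on \<epsilon> (carrier X)" by (rule module_hom_inj_on[OF assms(2) Em E(2,3)])
    show "\<epsilon> ` carrier X = a_kernel (I 0) (I 1) (d 0)" using d(2)[of 0] I0(2) by simp
    show "d n ` carrier (I n) = a_kernel (I (Suc n)) (I (Suc (Suc n))) (d (Suc n))" for n
      using d(2)[of "Suc n"] d(3)[of n] by simp
  qed
  then show ?thesis by (intro exI)
qed

section \<open>Torsion\<close>

definition ann :: "('a, 'r) ring_scheme \<Rightarrow> ('a, 'm, 'x) module_scheme \<Rightarrow> 'm \<Rightarrow> 'a set"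
  where "ann R M w = {r \<in> carrier R. r \<odot>\<^bsub>M\<^esub> w = \<zero>\<^bsub>M\<^esub>}"

text \<open>
  For an ideal of a noetherian ring these are the torsion elements (\<open>torsion_eq_power_torsion\<close>).  In this
  form the exponent may depend on the ring element, and the set \<open>S\<close> need not be an ideal.
\<close>

definition power_torsion :: "('a, 'r) ring_scheme \<Rightarrow> 'a set \<Rightarrow> ('a, 'm, 'x) module_scheme \<Rightarrow> 'm set"
  where "power_torsion R S M =
    {w \<in> carrier M. \<forall>r\<in>S. \<exists>n::nat. (r [^]\<^bsub>R\<^esub> n) \<odot>\<^bsub>M\<^esub> w = \<zero>\<^bsub>M\<^esub>}"

lemma power_torsionD:
  assumes "w \<in> power_torsion R S M"
  shows "w \<in> carrier M" "r \<in> S \<Longrightarrow> \<exists>n::nat. (r [^]\<^bsub>R\<^esub> n) \<odot>\<^bsub>M\<^esub> w = \<zero>\<^bsub>M\<^esub>"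
  using assms unfolding power_torsion_def by auto

lemma power_torsionI:
  assumes "w \<in> carrier M" "\<And>r. r \<in> S \<Longrightarrow> \<exists>n::nat. (r [^]\<^bsub>R\<^esub> n) \<odot>\<^bsub>M\<^esub> w = \<zero>\<^bsub>M\<^esub>"
  shows "w \<in> power_torsion R S M"
  using assms unfolding power_torsion_def by auto

lemma power_torsion_Un:
  "power_torsion R (S \<union> T) M = power_torsion R S M \<inter> power_torsion R T M"
  unfolding power_torsion_def by auto

context module
begin

lemma ann_ideal:
  assumes "w \<in> carrier M" shows "ideal (ann R M w) R"
  by (rule R.ideal_of_smult_closed)
     (use assms in \<open>auto simp: ann_def smult_l_distr smult_assoc1\<close>)

lemma pow_smult_add:
  assumes "r \<in> carrier R" "w \<in> carrier M"
  shows "(r [^] (m + n :: nat)) \<odot>\<^bsub>M\<^esub> w = (r [^] m) \<odot>\<^bsub>M\<^esub> ((r [^] n) \<odot>\<^bsub>M\<^esub> w)"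
  using assms by (simp add: R.nat_pow_mult[symmetric] smult_assoc1)

lemma pow_smult_zero_mono:
  assumes "r \<in> carrier R" "w \<in> carrier M" "(r [^] (n :: nat)) \<odot>\<^bsub>M\<^esub> w = \<zero>\<^bsub>M\<^esub>"
  shows "(r [^] (m + n)) \<odot>\<^bsub>M\<^esub> w = \<zero>\<^bsub>M\<^esub>"
  using assms by (simp add: pow_smult_add)

lemma smult_commute:
  assumes "r \<in> carrier R" "s \<in> carrier R" "w \<in> carrier M"
  shows "r \<odot>\<^bsub>M\<^esub> (s \<odot>\<^bsub>M\<^esub> w) = s \<odot>\<^bsub>M\<^esub> (r \<odot>\<^bsub>M\<^esub> w)"
  using assms by (simp add: smult_assoc1[symmetric] R.m_comm)

lemma power_torsion_add:
  assumes S: "S \<subseteq> carrier R" and u: "u \<in> power_torsion R S M" and v: "v \<in> power_torsion R S M"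
  shows "u \<oplus>\<^bsub>M\<^esub> v \<in> power_torsion R S M"
proof (rule power_torsionI)
  note c = power_torsionD(1)[OF u] power_torsionD(1)[OF v]
  show "u \<oplus>\<^bsub>M\<^esub> v \<in> carrier M" using c by simp
  fix r assume "r \<in> S"
  then have r: "r \<in> carrier R" using S by auto
  obtain n m :: nat where n: "(r [^] n) \<odot>\<^bsub>M\<^esub> u = \<zero>\<^bsub>M\<^esub>" and m: "(r [^] m) \<odot>\<^bsub>M\<^esub> v = \<zero>\<^bsub>M\<^esub>"
    using power_torsionD(2)[OF u \<open>r \<in> S\<close>] power_torsionD(2)[OF v \<open>r \<in> S\<close>] by auto
  have "(r [^] (m + n)) \<odot>\<^bsub>M\<^esub> (u \<oplus>\<^bsub>M\<^esub> v) = \<zero>\<^bsub>M\<^esub>"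
    using pow_smult_zero_mono[OF r c(1) n, of m] pow_smult_zero_mono[OF r c(2) m, of n] r c
    by (simp add: smult_r_distr add.commute)
  then show "\<exists>n::nat. (r [^] n) \<odot>\<^bsub>M\<^esub> (u \<oplus>\<^bsub>M\<^esub> v) = \<zero>\<^bsub>M\<^esub>" ..
qed

text \<open>
  Membership depends on the annihilator only.  This is why the division below, which controls
  annihilators, respects every torsion part at once.
\<close>

lemma power_torsion_ann_mono:
  assumes "S \<subseteq> carrier R" "u \<in> power_torsion R S M" "v \<in> carrier M" "ann R M u \<subseteq> ann R M v"
  shows "v \<in> power_torsion R S M"
proof (rule power_torsionI)
  fix r assume "r \<in> S"
  then obtain n :: nat where "(r [^] n) \<odot>\<^bsub>M\<^esub> u = \<zero>\<^bsub>M\<^esub>" using power_torsionD(2)[OF assms(2)] by blast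
  moreover have "r [^] n \<in> carrier R" using assms(1) \<open>r \<in> S\<close> by auto
  ultimately have "r [^] n \<in> ann R M v" using assms(4) by (auto simp: ann_def)
  then show "\<exists>n::nat. (r [^] n) \<odot>\<^bsub>M\<^esub> v = \<zero>\<^bsub>M\<^esub>" by (auto simp: ann_def)
qed (rule assms(3))

lemma power_torsion_smult:
  assumes "S \<subseteq> carrier R" "u \<in> power_torsion R S M" "a \<in> carrier R"
  shows "a \<odot>\<^bsub>M\<^esub> u \<in> power_torsion R S M"
  using power_torsionD(1)[OF assms(2)] assms(3)
  by (intro power_torsion_ann_mono[OF assms(1,2)]) (auto simp: ann_def smult_commute[of _ a])

lemma power_torsion_minus:
  assumes "S \<subseteq> carrier R" "u \<in> power_torsion R S M"
  shows "\<ominus>\<^bsub>M\<^esub> u \<in> power_torsion R S M"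
  using power_torsion_smult[OF assms, of "\<ominus> \<one>"] power_torsionD(1)[OF assms(2)]
  by (simp add: smult_minus_one)

end

lemma power_torsion_module_hom:
  assumes "module R M" "module R N" "f \<in> module_hom R M N" "S \<subseteq> carrier R" "w \<in> power_torsion R S M"
  shows "f w \<in> power_torsion R S N"
proof (rule power_torsionI)
  interpret M: module R M by fact
  note f = module_homD[OF assms(3)]
  have w: "w \<in> carrier M" by (rule power_torsionD(1)[OF assms(5)])
  then show "f w \<in> carrier N" by (rule f(1))
  fix r assume r: "r \<in> S"
  then obtain n :: nat where n: "(r [^]\<^bsub>R\<^esub> n) \<odot>\<^bsub>M\<^esub> w = \<zero>\<^bsub>M\<^esub>" using power_torsionD(2)[OF assms(5)] by blast
  have "r [^]\<^bsub>R\<^esub> n \<in> carrier R" using r assms(4) by auto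
  then have "(r [^]\<^bsub>R\<^esub> n) \<odot>\<^bsub>N\<^esub> f w = \<zero>\<^bsub>N\<^esub>"
    using f(3)[of "r [^]\<^bsub>R\<^esub> n" w] w n module_hom_zero[OF assms(1-3)] by simp
  then show "\<exists>n::nat. (r [^]\<^bsub>R\<^esub> n) \<odot>\<^bsub>N\<^esub> f w = \<zero>\<^bsub>N\<^esub>" ..
qed

section \<open>Radicals\<close>

text \<open>
  The usual binomial argument, as an induction on \<open>n + m\<close>; the factor \<open>z\<close> absorbs the powers that are
  split off.
\<close>

lemma (in cring) power_sum_in_ideal:
  assumes J: "ideal J R" and x: "x \<in> carrier R" and y: "y \<in> carrier R" and z: "z \<in> carrier R"
    and "(x [^] (n :: nat)) \<otimes> z \<in> J" "(y [^] (m :: nat)) \<otimes> z \<in> J"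
  shows "((x \<oplus> y) [^] (n + m)) \<otimes> z \<in> J"
proof -
  interpret J: ideal J R by fact
  show ?thesis using z assms(5,6)
  proof (induction "n + m" arbitrary: n m z)
    case 0
    then show ?case by simp
  next
    case (Suc k)
    show ?case
    proof (cases "n = 0 \<or> m = 0")
      case True
      then have "z \<in> J" using Suc.prems by auto
      then show ?thesis using x y by (intro J.I_l_closed) auto
    next
      case False
      then obtain n' m' where nm: "n = Suc n'" "m = Suc m'" by (cases n; cases m) auto
      have "((x \<oplus> y) [^] (n' + m)) \<otimes> (x \<otimes> z) \<in> J"
      proof (rule Suc.hyps(1))
        have "y [^] m \<otimes> (x \<otimes> z) = x \<otimes> (y [^] m \<otimes> z)" using x y Suc.prems(1) by (simp add: m_lcomm)
        then show "y [^] m \<otimes> (x \<otimes> z) \<in> J" using J.I_l_closed[OF Suc.prems(3) x] by simp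
        show "x [^] n' \<otimes> (x \<otimes> z) \<in> J" using Suc.prems(1,2) x nm(1) by (simp add: m_assoc)
      qed (use Suc.hyps(2) nm x Suc.prems(1) in auto)
      moreover have "((x \<oplus> y) [^] (n + m')) \<otimes> (y \<otimes> z) \<in> J"
      proof (rule Suc.hyps(1))
        have "x [^] n \<otimes> (y \<otimes> z) = y \<otimes> (x [^] n \<otimes> z)" using x y Suc.prems(1) by (simp add: m_lcomm)
        then show "x [^] n \<otimes> (y \<otimes> z) \<in> J" using J.I_l_closed[OF Suc.prems(2) y] by simp
        show "y [^] m' \<otimes> (y \<otimes> z) \<in> J" using Suc.prems(1,3) y nm(2) by (simp add: m_assoc)
      qed (use Suc.hyps(2) nm y Suc.prems(1) in auto)
      ultimately have "((x \<oplus> y) [^] (n' + m)) \<otimes> (x \<otimes> z) \<oplus> ((x \<oplus> y) [^] (n + m')) \<otimes> (y \<otimes> z) \<in> J"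
        by (rule J.a_closed)
      moreover have "n + m' = n' + m" "n + m = Suc (n' + m)" using nm by auto
      ultimately show ?thesis
        using x y Suc.prems(1) by (simp add: r_distr l_distr m_assoc)
    qed
  qed
qed

lemma (in cring) radical_ideal:
  assumes "ideal J R" shows "ideal (radical R J) R"
proof (rule ideal_of_smult_closed)
  interpret J: ideal J R by fact
  show "radical R J \<subseteq> carrier R" by (auto simp: radical_def)
  have "\<zero> [^] (1 :: nat) \<in> J" by simp
  then show "\<zero> \<in> radical R J" unfolding radical_def by blast
  show "a \<oplus> b \<in> radical R J" if "a \<in> radical R J" "b \<in> radical R J" for a b
  proof -
    obtain n m :: nat where "a \<in> carrier R" "b \<in> carrier R" "a [^] n \<in> J" "b [^] m \<in> J"
      using \<open>a \<in> radical R J\<close> \<open>b \<in> radical R J\<close> by (auto simp: radical_def)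
    then have "(a \<oplus> b) [^] (n + m) \<in> J" using power_sum_in_ideal[OF assms, of a b \<one> n m] by simp
    then show ?thesis using \<open>a \<in> carrier R\<close> \<open>b \<in> carrier R\<close> unfolding radical_def by blast
  qed
  show "r \<otimes> a \<in> radical R J" if r: "r \<in> carrier R" and a: "a \<in> radical R J" for r a
  proof -
    obtain n :: nat where n: "a \<in> carrier R" "a [^] n \<in> J" using a by (auto simp: radical_def)
    then have "(r \<otimes> a) [^] n \<in> J" using r J.I_l_closed[OF n(2), of "r [^] n"] by (simp add: nat_pow_distrib)
    then show ?thesis using r n(1) unfolding radical_def by blast
  qed
qed

lemma (in cring) subset_radical:
  assumes "J \<subseteq> carrier R" shows "J \<subseteq> radical R J"
proof
  fix x assume "x \<in> J"
  then have "x [^] (1 :: nat) \<in> J" using assms by auto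
  then show "x \<in> radical R J" using assms \<open>x \<in> J\<close> unfolding radical_def by blast
qed

lemma (in cring) subset_radical_iff:
  assumes "ideal J R" "S \<subseteq> carrier R"
  shows "S \<subseteq> radical R J \<longleftrightarrow> radical R (Idl S) \<subseteq> radical R J"
proof
  assume "S \<subseteq> radical R J"
  then have sub: "Idl S \<subseteq> radical R J" by (intro genideal_minimal radical_ideal assms)
  show "radical R (Idl S) \<subseteq> radical R J"
  proof
    fix x assume "x \<in> radical R (Idl S)"
    then obtain n :: nat where x: "x \<in> carrier R" "x [^] n \<in> Idl S" by (auto simp: radical_def)
    then have "x [^] n \<in> radical R J" using sub by blast
    then obtain m :: nat where "(x [^] n) [^] m \<in> J" by (auto simp: radical_def)
    then have "x [^] (n * m) \<in> J" using x(1) by (simp add: nat_pow_pow)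
    then show "x \<in> radical R J" using x(1) unfolding radical_def by blast
  qed
next
  assume "radical R (Idl S) \<subseteq> radical R J"
  moreover have "Idl S \<subseteq> carrier R" using genideal_ideal[OF assms(2)] by (auto dest: ideal.Icarr)
  ultimately show "S \<subseteq> radical R J"
    using genideal_self[OF assms(2)] subset_radical[of "Idl S"] by blast
qed

text \<open>
  The reason why torsion depends on the radical only.
\<close>

lemma (in module) power_torsion_iff:
  assumes "S \<subseteq> carrier R"
  shows "w \<in> power_torsion R S M \<longleftrightarrow> w \<in> carrier M \<and> S \<subseteq> radical R (ann R M w)"
  using assms unfolding power_torsion_def radical_def ann_def by auto

lemma (in module) power_torsion_radical_mono:
  assumes "S \<subseteq> carrier R" "T \<subseteq> carrier R" "radical R (Idl S) \<subseteq> radical R (Idl T)"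
  shows "power_torsion R T M \<subseteq> power_torsion R S M"
proof
  fix w assume w: "w \<in> power_torsion R T M"
  then have wM: "w \<in> carrier M" by (rule power_torsionD)
  have "radical R (Idl T) \<subseteq> radical R (ann R M w)"
    using w R.subset_radical_iff[OF ann_ideal[OF wM] assms(2)] unfolding power_torsion_iff[OF assms(2)] by blast
  then have "radical R (Idl S) \<subseteq> radical R (ann R M w)" using assms(3) by simp
  then have "S \<subseteq> radical R (ann R M w)" using R.subset_radical_iff[OF ann_ideal[OF wM] assms(1)] by blast
  then show "w \<in> power_torsion R S M" using wM power_torsion_iff[OF assms(1)] by blast
qed

lemma (in module) power_torsion_radical_cong:
  assumes "S \<subseteq> carrier R" "T \<subseteq> carrier R" "radical R (Idl S) = radical R (Idl T)"
  shows "power_torsion R S M = power_torsion R T M"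
  using power_torsion_radical_mono[of S T] power_torsion_radical_mono[of T S] assms by auto

lemma (in cring) genideal_of_ideal: "ideal J R \<Longrightarrow> Idl J = J"
  by (meson genideal_minimal genideal_self ideal.Icarr order_refl subset_antisym subsetI)

text \<open>
  The elements annihilated by \<open>J\<^sup>n\<close>, described without products of ideals so that statements about
  powers can be proved by induction on \<open>n\<close>.
\<close>

primrec killed_by_power ::
  "('a, 'r) ring_scheme \<Rightarrow> ('a, 'm, 'x) module_scheme \<Rightarrow> 'a set \<Rightarrow> nat \<Rightarrow> 'm set"
  where
    "killed_by_power R M J 0 = {\<zero>\<^bsub>M\<^esub>}"
  | "killed_by_power R M J (Suc n) = {w \<in> carrier M. \<forall>r\<in>J. r \<odot>\<^bsub>M\<^esub> w \<in> killed_by_power R M J n}"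

context module
begin

lemma killed_by_power_carrier: "killed_by_power R M J n \<subseteq> carrier M"
  by (cases n) auto

lemma killed_by_power_add:
  assumes "J \<subseteq> carrier R" "u \<in> killed_by_power R M J n" "v \<in> killed_by_power R M J n"
  shows "u \<oplus>\<^bsub>M\<^esub> v \<in> killed_by_power R M J n"
  using assms(2,3) by (induction n arbitrary: u v) (use assms(1) in \<open>auto simp: smult_r_distr subset_iff\<close>)

lemma killed_by_power_smult:
  assumes "J \<subseteq> carrier R" "u \<in> killed_by_power R M J n" "a \<in> carrier R"
  shows "a \<odot>\<^bsub>M\<^esub> u \<in> killed_by_power R M J n"
  using assms(2) by (induction n arbitrary: u) (use assms(1,3) in \<open>auto simp: smult_commute[of _ a] subset_iff\<close>)

lemma killed_by_power_antimono:
  assumes "J \<subseteq> J'" shows "killed_by_power R M J' n \<subseteq> killed_by_power R M J n"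
  by (induction n) (use assms in auto)

text \<open>
  If \<open>J\<^sup>n\<close> and \<open>K\<^sup>m\<close> kill \<open>w\<close>, so does \<open>(J + K)\<^sup>n\<^sup>+\<^sup>m\<close>: one factor of \<open>J + K\<close> at a time lowers
  \<open>n\<close> or \<open>m\<close>.
\<close>

lemma killed_by_power_set_add:
  assumes J: "J \<subseteq> carrier R" and K: "K \<subseteq> carrier R"
    and "w \<in> killed_by_power R M J n" "w \<in> killed_by_power R M K m"
  shows "w \<in> killed_by_power R M (J <+>\<^bsub>R\<^esub> K) (n + m)"
  using assms(3,4)
proof (induction "n + m" arbitrary: n m w)
  case 0
  then show ?case by simp
next
  case (Suc k)
  have JK: "J <+>\<^bsub>R\<^esub> K \<subseteq> carrier R" using J K by (auto simp: set_add_def')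
  have wM: "w \<in> carrier M" using Suc.prems(1) killed_by_power_carrier by blast
  show ?case
  proof (cases "n = 0 \<or> m = 0")
    case True
    then have "w = \<zero>\<^bsub>M\<^esub>" using Suc.prems by auto
    moreover have "\<zero>\<^bsub>M\<^esub> \<in> killed_by_power R M (J <+>\<^bsub>R\<^esub> K) l" for l
      by (induction l) (use JK in auto)
    ultimately show ?thesis by simp
  next
    case False
    then obtain n' m' where nm: "n = Suc n'" "m = Suc m'" by (cases n; cases m) auto
    have "r \<odot>\<^bsub>M\<^esub> w \<in> killed_by_power R M (J <+>\<^bsub>R\<^esub> K) k" if r: "r \<in> J <+>\<^bsub>R\<^esub> K" for r
    proof -
      obtain a b where ab: "a \<in> J" "b \<in> K" "r = a \<oplus> b" using r by (auto simp: set_add_def')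
      then have c: "a \<in> carrier R" "b \<in> carrier R" using J K by auto
      have "a \<odot>\<^bsub>M\<^esub> w \<in> killed_by_power R M (J <+>\<^bsub>R\<^esub> K) (n' + m)"
      proof (rule Suc.hyps(1))
        show "k = n' + m" using Suc.hyps(2) nm by simp
        show "a \<odot>\<^bsub>M\<^esub> w \<in> killed_by_power R M J n'" using Suc.prems(1) nm ab by simp
        show "a \<odot>\<^bsub>M\<^esub> w \<in> killed_by_power R M K m" by (rule killed_by_power_smult[OF K Suc.prems(2) c(1)])
      qed
      moreover have "b \<odot>\<^bsub>M\<^esub> w \<in> killed_by_power R M (J <+>\<^bsub>R\<^esub> K) (n + m')"
      proof (rule Suc.hyps(1))
        show "k = n + m'" using Suc.hyps(2) nm by simp
        show "b \<odot>\<^bsub>M\<^esub> w \<in> killed_by_power R M K m'" using Suc.prems(2) nm ab by simp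
        show "b \<odot>\<^bsub>M\<^esub> w \<in> killed_by_power R M J n" by (rule killed_by_power_smult[OF J Suc.prems(1) c(2)])
      qed
      moreover have "n' + m = k" "n + m' = k" using nm Suc.hyps(2) by auto
      ultimately have "a \<odot>\<^bsub>M\<^esub> w \<oplus>\<^bsub>M\<^esub> b \<odot>\<^bsub>M\<^esub> w \<in> killed_by_power R M (J <+>\<^bsub>R\<^esub> K) k"
        by (intro killed_by_power_add[OF JK]) simp_all
      then show ?thesis using ab(3) c wM by (simp add: smult_l_distr)
    qed
    then have "w \<in> killed_by_power R M (J <+>\<^bsub>R\<^esub> K) (Suc k)" using wM by simp
    then show ?thesis unfolding Suc.hyps(2) .
  qed
qed

lemma killed_by_power_cgenideal:
  assumes "x \<in> carrier R" "w \<in> carrier M" "(x [^] (n :: nat)) \<odot>\<^bsub>M\<^esub> w = \<zero>\<^bsub>M\<^esub>"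
  shows "w \<in> killed_by_power R M (PIdl x) n"
  using assms(2,3)
proof (induction n arbitrary: w)
  case 0
  then show ?case by simp
next
  case (Suc n)
  have "r \<odot>\<^bsub>M\<^esub> w \<in> killed_by_power R M (PIdl x) n" if r: "r \<in> PIdl x" for r
  proof -
    obtain s where s: "s \<in> carrier R" "r = s \<otimes> x" using r by (auto simp: cgenideal_def)
    have "(x [^] n) \<odot>\<^bsub>M\<^esub> (r \<odot>\<^bsub>M\<^esub> w) = s \<odot>\<^bsub>M\<^esub> ((x [^] Suc n) \<odot>\<^bsub>M\<^esub> w)"
      using s assms(1) Suc.prems(1) by (simp add: smult_assoc1 smult_commute[of _ s])
    then show ?thesis using Suc.prems s assms(1) by (intro Suc.IH) auto
  qed
  then show ?case using Suc.prems(1) by simp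
qed

text \<open>
  For finitely many generators a uniform exponent exists: the sum of the individual ones.
\<close>

lemma killed_by_power_of_finite_power_torsion:
  assumes "finite S" "S \<subseteq> carrier R" "w \<in> power_torsion R S M"
  shows "\<exists>J n. ideal J R \<and> S \<subseteq> J \<and> w \<in> killed_by_power R M J n"
  using assms
proof (induction S)
  case empty
  have "w \<in> killed_by_power R M {\<zero>} 1" using power_torsionD(1)[OF empty(2)] by simp
  then show ?case using R.zeroideal by blast
next
  case (insert x S)
  have wM: "w \<in> carrier M" by (rule power_torsionD(1)[OF insert.prems(2)])
  have x: "x \<in> carrier R" using insert.prems by auto
  have "w \<in> power_torsion R S M" using insert.prems(2) by (auto simp: power_torsion_def)
  then obtain J n where J: "ideal J R" "S \<subseteq> J" "w \<in> killed_by_power R M J n"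
    using insert.IH insert.prems(1) by blast
  obtain m :: nat where "(x [^] m) \<odot>\<^bsub>M\<^esub> w = \<zero>\<^bsub>M\<^esub>"
    using power_torsionD(2)[OF insert.prems(2), of x] by auto
  then have "w \<in> killed_by_power R M (PIdl x) m" by (rule killed_by_power_cgenideal[OF x wM])
  moreover have P: "ideal (PIdl x) R" by (rule R.cgenideal_ideal[OF x])
  ultimately have w: "w \<in> killed_by_power R M (PIdl x <+>\<^bsub>R\<^esub> J) (m + n)"
    using J by (intro killed_by_power_set_add) (auto dest: ideal.Icarr)
  have "\<zero> \<in> J" "\<zero> \<in> PIdl x"
    using J(1) P by (auto intro: additive_subgroup.zero_closed ideal.axioms(1))
  have "x \<oplus> \<zero> \<in> PIdl x <+>\<^bsub>R\<^esub> J"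
    using R.cgenideal_self[OF x] \<open>\<zero> \<in> J\<close> unfolding set_add_def' by blast
  moreover have "y \<in> PIdl x <+>\<^bsub>R\<^esub> J" if "y \<in> S" for y
  proof -
    have "\<zero> \<oplus> y \<in> PIdl x <+>\<^bsub>R\<^esub> J"
      using that J(2) \<open>\<zero> \<in> PIdl x\<close> unfolding set_add_def' by blast
    then show ?thesis using that insert.prems(1) by auto
  qed
  ultimately have "insert x S \<subseteq> PIdl x <+>\<^bsub>R\<^esub> J"
    using x insert.prems(1) by auto
  then show ?case using R.add_ideals[OF P J(1)] w by blast
qed

lemma ideal_power_ideal:
  assumes "ideal J R" shows "ideal (J [^]\<^bsub>ideals_set R\<^esub> (n :: nat)) R"
  by (induction n) (use assms R.oneideal R.ideal_prod_is_ideal in \<open>auto simp: ideals_set_def\<close>)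

lemma smult_ideal_power_zero:
  assumes J: "ideal J R" and "w \<in> killed_by_power R M J n" "r \<in> J [^]\<^bsub>ideals_set R\<^esub> n"
  shows "r \<odot>\<^bsub>M\<^esub> w = \<zero>\<^bsub>M\<^esub>"
  using assms(2,3)
proof (induction n arbitrary: w r)
  case 0
  then show ?case by (simp add: ideals_set_def)
next
  case (Suc n)
  have wM: "w \<in> carrier M" using Suc.prems(1) by simp
  have car: "\<And>i. i \<in> J [^]\<^bsub>ideals_set R\<^esub> n \<Longrightarrow> i \<in> carrier R" "\<And>j. j \<in> J \<Longrightarrow> j \<in> carrier R"
    using ideal_power_ideal[OF J] J by (auto dest: ideal.Icarr)
  have "r \<in> ideal_prod R (J [^]\<^bsub>ideals_set R\<^esub> n) J" using Suc.prems(2) by (simp add: ideals_set_def)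
  then have "r \<in> carrier R \<and> r \<odot>\<^bsub>M\<^esub> w = \<zero>\<^bsub>M\<^esub>"
  proof induction
    case (prod i j)
    then show ?case using car Suc.IH[of "j \<odot>\<^bsub>M\<^esub> w" i] Suc.prems(1) wM by (simp add: smult_assoc1)
  next
    case (sum s t)
    then show ?case using wM by (simp add: smult_l_distr)
  qed
  then show ?case ..
qed

lemma torsion_eq_power_torsion:
  assumes "noetherian_ring R" and J: "ideal J R"
  shows "carrier (torsion R J M) = power_torsion R J M"
proof (intro equalityI subsetI)
  fix w assume "w \<in> carrier (torsion R J M)"
  then obtain n :: nat where w: "w \<in> carrier M" "\<And>r. r \<in> J [^]\<^bsub>ideals_set R\<^esub> n \<Longrightarrow> r \<odot>\<^bsub>M\<^esub> w = \<zero>\<^bsub>M\<^esub>"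
    by (auto simp: torsion_def)
  have "r [^] n \<in> J [^]\<^bsub>ideals_set R\<^esub> n" if "r \<in> J" for r and n :: nat
  proof (induction n)
    case 0
    then show ?case by (simp add: ideals_set_def)
  next
    case (Suc n)
    then show ?case using that ideal_prod.prod[of "r [^] n" "J [^]\<^bsub>ideals_set R\<^esub> n" r J R]
      by (simp add: ideals_set_def)
  qed
  then show "w \<in> power_torsion R J M" using w by (intro power_torsionI) auto
next
  fix w assume w: "w \<in> power_torsion R J M"
  obtain S where S: "S \<subseteq> carrier R" "finite S" "J = Idl S"
    using noetherian_ring.finetely_gen[OF assms] by blast
  have SJ: "S \<subseteq> J" using R.genideal_self[OF S(1)] S(3) by simp
  have "w \<in> power_torsion R S M" using w SJ by (auto simp: power_torsion_def)
  then obtain K n where K: "ideal K R" "S \<subseteq> K" "w \<in> killed_by_power R M K n"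
    using killed_by_power_of_finite_power_torsion[OF S(2,1)] by blast
  have "J \<subseteq> K" unfolding S(3) by (rule R.genideal_minimal[OF K(1,2)])
  then have "w \<in> killed_by_power R M J n" using K(3) killed_by_power_antimono by blast
  then have "\<forall>r\<in>J [^]\<^bsub>ideals_set R\<^esub> n. r \<odot>\<^bsub>M\<^esub> w = \<zero>\<^bsub>M\<^esub>"
    using smult_ideal_power_zero[OF J] by blast
  then show "w \<in> carrier (torsion R J M)"
    using power_torsionD(1)[OF w] by (auto simp: torsion_def)
qed

end

section \<open>Divisibility up to torsion in injective modules\<close>

text \<open>
  The chain of the annihilators of \<open>x\<^sup>k w\<close> becomes stationary at some \<open>k\<close>.  Then
  \<open>r x\<^sup>k\<^sup>+\<^sup>1 + s \<mapsto> r x\<^sup>k w\<close>, for \<open>s \<in> Ann w\<close>, is well defined on the ideal \<open>(x\<^sup>k\<^sup>+\<^sup>1) + Ann w\<close>: if the left side is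
  zero, then \<open>r\<close> kills \<open>x\<^sup>k\<^sup>+\<^sup>1 w\<close> and hence \<open>x\<^sup>k w\<close>.  By injectivity this is multiplication with
  an element \<open>w'\<close>, and \<open>Ann w\<close> kills \<open>w'\<close> because the summand \<open>s\<close> is sent to zero.
\<close>

lemma exists_divisor_up_to_torsion:
  assumes "noetherian_ring R" "module R E" "baer R E" and x: "x \<in> carrier R" and w: "w \<in> carrier E"
  obtains w' and k :: nat where "w' \<in> carrier E" "ann R E w \<subseteq> ann R E w'"
    "(x [^]\<^bsub>R\<^esub> Suc k) \<odot>\<^bsub>E\<^esub> w' = (x [^]\<^bsub>R\<^esub> k) \<odot>\<^bsub>E\<^esub> w"
proof -
  interpret E: module R E by fact
  let ?J = "\<lambda>k::nat. ann R E ((x [^]\<^bsub>R\<^esub> k) \<odot>\<^bsub>E\<^esub> w)"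
  have pw: "(x [^]\<^bsub>R\<^esub> k) \<odot>\<^bsub>E\<^esub> w \<in> carrier E" for k :: nat using x w by simp
  have mono1: "?J k \<subseteq> ?J (Suc k)" for k
  proof
    fix r assume r: "r \<in> ?J k"
    then have rR: "r \<in> carrier R" by (simp add: ann_def)
    have "(x [^]\<^bsub>R\<^esub> Suc k) \<odot>\<^bsub>E\<^esub> w = x \<odot>\<^bsub>E\<^esub> ((x [^]\<^bsub>R\<^esub> k) \<odot>\<^bsub>E\<^esub> w)"
      using x w E.pow_smult_add[of x w 1 k] by simp
    then have "r \<odot>\<^bsub>E\<^esub> ((x [^]\<^bsub>R\<^esub> Suc k) \<odot>\<^bsub>E\<^esub> w) = x \<odot>\<^bsub>E\<^esub> (r \<odot>\<^bsub>E\<^esub> ((x [^]\<^bsub>R\<^esub> k) \<odot>\<^bsub>E\<^esub> w))"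
      using E.smult_commute[OF rR x pw] by simp
    also have "\<dots> = \<zero>\<^bsub>E\<^esub>" using r x by (simp add: ann_def)
    finally show "r \<in> ?J (Suc k)" using rR by (simp add: ann_def)
  qed
  have mono: "?J m \<subseteq> ?J n" if "m \<le> n" for m n by (rule lift_Suc_mono_le[of ?J, OF mono1 that])
  have chain: "subset.chain {I. ideal I R} (range ?J)"
    unfolding subset_chain_def
  proof (intro conjI ballI)
    show "range ?J \<subseteq> {I. ideal I R}" using E.ann_ideal[OF pw] by blast
    fix A B assume "A \<in> range ?J" "B \<in> range ?J"
    then obtain m n where "A = ?J m" "B = ?J n" by blast
    then show "A \<subseteq> B \<or> B \<subseteq> A" using mono[of m n] mono[of n m] by (cases "m \<le> n") simp_all
  qed
  have "\<Union>(range ?J) \<in> range ?J"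
    by (rule noetherian_ring.ideal_chain_is_trivial[OF assms(1) _ chain]) simp
  then obtain k where "\<Union>(range ?J) = ?J k" by blast
  then have stable: "?J (Suc k) \<subseteq> ?J k" by blast
  let ?x = "x [^]\<^bsub>R\<^esub> Suc k" and ?y = "(x [^]\<^bsub>R\<^esub> k) \<odot>\<^bsub>E\<^esub> w"
  have xR: "?x \<in> carrier R" using x by simp
  have y: "?y \<in> carrier E" by (rule pw)
  let ?N = "ideal_module R (carrier R)"
  have N: "module R ?N" by (rule ideal_module_is_module[OF E.R.is_cring E.R.oneideal])
  define H where "H = {(r \<otimes>\<^bsub>R\<^esub> ?x \<oplus>\<^bsub>R\<^esub> s, r \<odot>\<^bsub>E\<^esub> ?y) | r s. r \<in> carrier R \<and> s \<in> ann R E w}"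
  have HI: "(t, u) \<in> H" if "r \<in> carrier R" "s \<in> ann R E w" "t = r \<otimes>\<^bsub>R\<^esub> ?x \<oplus>\<^bsub>R\<^esub> s" "u = r \<odot>\<^bsub>E\<^esub> ?y" for r s t u
    using that unfolding H_def by blast
  have HE: thesis' if "(t, u) \<in> H"
    "\<And>r s. r \<in> carrier R \<Longrightarrow> s \<in> carrier R \<Longrightarrow> s \<odot>\<^bsub>E\<^esub> w = \<zero>\<^bsub>E\<^esub> \<Longrightarrow> t = r \<otimes>\<^bsub>R\<^esub> ?x \<oplus>\<^bsub>R\<^esub> s \<Longrightarrow> u = r \<odot>\<^bsub>E\<^esub> ?y \<Longrightarrow> thesis'"
    for t u thesis' using that unfolding H_def ann_def by blast
  have annI: "s \<in> ann R E w" if "s \<in> carrier R" "s \<odot>\<^bsub>E\<^esub> w = \<zero>\<^bsub>E\<^esub>" for s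
    using that by (simp add: ann_def)
  have H: "partial_hom R ?N E H"
    unfolding partial_hom_def
  proof (intro conjI allI impI ballI)
    show "H \<subseteq> carrier ?N \<times> carrier E" using xR y by (auto simp: H_def ann_def ideal_module_def)
    show "(\<zero>\<^bsub>?N\<^esub>, \<zero>\<^bsub>E\<^esub>) \<in> H"
      by (rule HI[of "\<zero>\<^bsub>R\<^esub>" "\<zero>\<^bsub>R\<^esub>"]) (use xR y w in \<open>auto intro!: annI simp: ideal_module_def\<close>)
  next
    fix t u t' u' assume "(t, u) \<in> H" "(t', u') \<in> H"
    then obtain r s r' s' where *: "r \<in> carrier R" "s \<in> carrier R" "s \<odot>\<^bsub>E\<^esub> w = \<zero>\<^bsub>E\<^esub>"
        "t = r \<otimes>\<^bsub>R\<^esub> ?x \<oplus>\<^bsub>R\<^esub> s" "u = r \<odot>\<^bsub>E\<^esub> ?y"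
        "r' \<in> carrier R" "s' \<in> carrier R" "s' \<odot>\<^bsub>E\<^esub> w = \<zero>\<^bsub>E\<^esub>"
        "t' = r' \<otimes>\<^bsub>R\<^esub> ?x \<oplus>\<^bsub>R\<^esub> s'" "u' = r' \<odot>\<^bsub>E\<^esub> ?y"
      unfolding H_def ann_def by blast
    show "(t \<oplus>\<^bsub>?N\<^esub> t', u \<oplus>\<^bsub>E\<^esub> u') \<in> H"
    proof (rule HI)
      show "r \<oplus>\<^bsub>R\<^esub> r' \<in> carrier R" using * by simp
      show "s \<oplus>\<^bsub>R\<^esub> s' \<in> ann R E w" using * w by (intro annI) (simp_all add: E.smult_l_distr)
      have "t \<oplus>\<^bsub>R\<^esub> t' = (r \<oplus>\<^bsub>R\<^esub> r') \<otimes>\<^bsub>R\<^esub> ?x \<oplus>\<^bsub>R\<^esub> (s \<oplus>\<^bsub>R\<^esub> s')"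
        unfolding *(4,9) using *(1,2,6,7) xR
        by (simp only: E.R.l_distr E.R.a_ac E.R.m_closed E.R.a_closed)
      then show "t \<oplus>\<^bsub>?N\<^esub> t' = (r \<oplus>\<^bsub>R\<^esub> r') \<otimes>\<^bsub>R\<^esub> ?x \<oplus>\<^bsub>R\<^esub> (s \<oplus>\<^bsub>R\<^esub> s')"
        by (simp add: ideal_module_def)
      show "u \<oplus>\<^bsub>E\<^esub> u' = (r \<oplus>\<^bsub>R\<^esub> r') \<odot>\<^bsub>E\<^esub> ?y"
        unfolding *(5,10) using E.smult_l_distr[OF *(1,6) y] by simp
    qed
  next
    fix a t u assume a: "a \<in> carrier R" and "(t, u) \<in> H"
    then obtain r s where *: "r \<in> carrier R" "s \<in> carrier R" "s \<odot>\<^bsub>E\<^esub> w = \<zero>\<^bsub>E\<^esub>"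
        "t = r \<otimes>\<^bsub>R\<^esub> ?x \<oplus>\<^bsub>R\<^esub> s" "u = r \<odot>\<^bsub>E\<^esub> ?y"
      unfolding H_def ann_def by blast
    show "(a \<odot>\<^bsub>?N\<^esub> t, a \<odot>\<^bsub>E\<^esub> u) \<in> H"
    proof (rule HI)
      show "a \<otimes>\<^bsub>R\<^esub> r \<in> carrier R" using * a by simp
      show "a \<otimes>\<^bsub>R\<^esub> s \<in> ann R E w" using * w a by (intro annI) (simp_all add: E.smult_assoc1)
      have "a \<otimes>\<^bsub>R\<^esub> t = (a \<otimes>\<^bsub>R\<^esub> r) \<otimes>\<^bsub>R\<^esub> ?x \<oplus>\<^bsub>R\<^esub> a \<otimes>\<^bsub>R\<^esub> s"
        unfolding *(4) using *(1,2) a xR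
        by (simp only: E.R.r_distr E.R.m_assoc E.R.m_closed E.R.a_closed)
      then show "a \<odot>\<^bsub>?N\<^esub> t = (a \<otimes>\<^bsub>R\<^esub> r) \<otimes>\<^bsub>R\<^esub> ?x \<oplus>\<^bsub>R\<^esub> a \<otimes>\<^bsub>R\<^esub> s"
        by (simp add: ideal_module_def)
      show "a \<odot>\<^bsub>E\<^esub> u = (a \<otimes>\<^bsub>R\<^esub> r) \<odot>\<^bsub>E\<^esub> ?y"
        unfolding *(5) using E.smult_assoc1[OF a *(1) y] by simp
    qed
  next
    fix u assume "(\<zero>\<^bsub>?N\<^esub>, u) \<in> H"
    then obtain r s where *: "r \<in> carrier R" "s \<in> carrier R" "s \<odot>\<^bsub>E\<^esub> w = \<zero>\<^bsub>E\<^esub>"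
        "\<zero>\<^bsub>?N\<^esub> = r \<otimes>\<^bsub>R\<^esub> ?x \<oplus>\<^bsub>R\<^esub> s" "u = r \<odot>\<^bsub>E\<^esub> ?y"
      unfolding H_def ann_def by blast
    have "(r \<otimes>\<^bsub>R\<^esub> ?x \<oplus>\<^bsub>R\<^esub> s) \<odot>\<^bsub>E\<^esub> w = \<zero>\<^bsub>E\<^esub>"
      unfolding *(4)[symmetric] using w by (simp add: ideal_module_def)
    moreover have "(r \<otimes>\<^bsub>R\<^esub> ?x \<oplus>\<^bsub>R\<^esub> s) \<odot>\<^bsub>E\<^esub> w = (r \<otimes>\<^bsub>R\<^esub> ?x) \<odot>\<^bsub>E\<^esub> w"
      using E.smult_l_distr[of "r \<otimes>\<^bsub>R\<^esub> ?x" s w] *(1-3) xR w by simp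
    moreover have "(r \<otimes>\<^bsub>R\<^esub> ?x) \<odot>\<^bsub>E\<^esub> w = r \<odot>\<^bsub>E\<^esub> (?x \<odot>\<^bsub>E\<^esub> w)"
      by (rule E.smult_assoc1[OF *(1) xR w])
    ultimately have "r \<in> ?J (Suc k)" using *(1) by (simp add: ann_def)
    then show "u = \<zero>\<^bsub>E\<^esub>" using stable *(5) by (auto simp: ann_def)
  qed
  obtain h where h: "h \<in> module_hom R ?N E" "\<And>t u. (t, u) \<in> H \<Longrightarrow> h t = u"
    by (rule partial_hom_extend[OF N assms(2,3) H]) (rule that)
  define w' where "w' = h \<one>\<^bsub>R\<^esub>"
  have w'E: "w' \<in> carrier E" unfolding w'_def by (rule module_homD(1)[OF h(1)]) (simp add: ideal_module_def)
  have mult: "h t = t \<odot>\<^bsub>E\<^esub> w'" if "t \<in> carrier R" for t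
    using module_homD(3)[OF h(1) that, of "\<one>\<^bsub>R\<^esub>"] that by (simp add: ideal_module_def w'_def)
  show thesis
  proof (rule that[OF w'E])
    show "ann R E w \<subseteq> ann R E w'"
    proof
      fix s assume s: "s \<in> ann R E w"
      then have sR: "s \<in> carrier R" by (simp add: ann_def)
      have "(s, \<zero>\<^bsub>E\<^esub>) \<in> H" by (rule HI[OF E.R.zero_closed s]) (use sR xR y in simp_all)
      then show "s \<in> ann R E w'" using h(2) mult[OF sR] sR by (simp add: ann_def)
    qed
    have "(?x, ?y) \<in> H"
      by (rule HI[OF E.R.one_closed annI[OF E.R.zero_closed]]) (use w y xR in \<open>simp_all del: nat_pow_Suc\<close>)
    then show "?x \<odot>\<^bsub>E\<^esub> w' = ?y" using h(2)[of ?x ?y] mult[OF xR] by (simp del: nat_pow_Suc)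
  qed
qed

text \<open>
  The same for division by \<open>x\<^sup>n\<close>, with the error term written as a difference.
\<close>

lemma exists_power_divisor_up_to_torsion:
  assumes "noetherian_ring R" "module R E" "baer R E" and x: "x \<in> carrier R" and w: "w \<in> carrier E"
  obtains w' and m :: nat where "w' \<in> carrier E" "ann R E w \<subseteq> ann R E w'"
    "(x [^]\<^bsub>R\<^esub> m) \<odot>\<^bsub>E\<^esub> (w \<oplus>\<^bsub>E\<^esub> \<ominus>\<^bsub>E\<^esub> ((x [^]\<^bsub>R\<^esub> (n :: nat)) \<odot>\<^bsub>E\<^esub> w')) = \<zero>\<^bsub>E\<^esub>"
proof -
  interpret E: module R E by fact
  let ?x = "x [^]\<^bsub>R\<^esub> n"
  have xR: "?x \<in> carrier R" using x by simp
  obtain w' and k :: nat where w': "w' \<in> carrier E" "ann R E w \<subseteq> ann R E w'"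
    "(?x [^]\<^bsub>R\<^esub> Suc k) \<odot>\<^bsub>E\<^esub> w' = (?x [^]\<^bsub>R\<^esub> k) \<odot>\<^bsub>E\<^esub> w"
    by (rule exists_divisor_up_to_torsion[OF assms(1-3) xR w])
  have "(?x [^]\<^bsub>R\<^esub> Suc k) \<odot>\<^bsub>E\<^esub> w' = (?x [^]\<^bsub>R\<^esub> k) \<odot>\<^bsub>E\<^esub> (?x \<odot>\<^bsub>E\<^esub> w')"
    using xR w'(1) by (simp add: E.smult_assoc1)
  then have "(?x [^]\<^bsub>R\<^esub> k) \<odot>\<^bsub>E\<^esub> (w \<oplus>\<^bsub>E\<^esub> \<ominus>\<^bsub>E\<^esub> (?x \<odot>\<^bsub>E\<^esub> w')) = \<zero>\<^bsub>E\<^esub>"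
    using w w'(1,3) xR by (simp add: E.smult_r_distr E.smult_r_minus E.M.r_neg del: nat_pow_Suc)
  moreover have "?x [^]\<^bsub>R\<^esub> k = x [^]\<^bsub>R\<^esub> (n * k)" using x by (simp add: E.R.nat_pow_pow)
  ultimately show thesis using that w'(1,2) by metis
qed

text \<open>
  Induction on \<open>S\<close>.  In a splitting \<open>w = u + v\<close> for \<open>S\<close>, the element \<open>u\<close> need not be \<open>x\<close>-torsion, but
  \<open>x\<^sup>m u\<close> lies in both torsion parts since \<open>x\<^sup>m w\<close> and \<open>v\<close> are \<open>T\<close>-torsion.  Dividing \<open>x\<^sup>m u\<close> by
  \<open>x\<^sup>m\<close> within both parts gives \<open>u'\<close> such that \<open>u - u'\<close> is \<open>x\<close>-torsion, and \<open>u'\<close> is moved to the other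
  summand.
\<close>

lemma power_torsion_split:
  assumes "noetherian_ring R" "module R E" "baer R E"
    and S: "finite S" "S \<subseteq> carrier R" and T: "T \<subseteq> carrier R" and w: "w \<in> carrier E"
    and "\<And>x. x \<in> S \<Longrightarrow> \<exists>m::nat. (x [^]\<^bsub>R\<^esub> m) \<odot>\<^bsub>E\<^esub> w \<in> power_torsion R T E"
  shows "\<exists>u\<in>power_torsion R S E. \<exists>v\<in>power_torsion R T E. w = u \<oplus>\<^bsub>E\<^esub> v"
  using S assms(8)
proof (induction S)
  case empty
  interpret E: module R E by fact
  have "w \<in> power_torsion R {} E" "\<zero>\<^bsub>E\<^esub> \<in> power_torsion R T E" "w = w \<oplus>\<^bsub>E\<^esub> \<zero>\<^bsub>E\<^esub>"
    using w T by (auto simp: power_torsion_def subset_iff)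
  then show ?case by blast
next
  case (insert x S)
  interpret E: module R E by fact
  have x: "x \<in> carrier R" and S: "S \<subseteq> carrier R" using insert.prems(1) by auto
  obtain u v where u: "u \<in> power_torsion R S E" and v: "v \<in> power_torsion R T E" and uv: "w = u \<oplus>\<^bsub>E\<^esub> v"
    using insert.IH[OF S] insert.prems(2) by blast
  note uE = power_torsionD(1)[OF u] and vE = power_torsionD(1)[OF v]
  obtain m :: nat where m: "(x [^]\<^bsub>R\<^esub> m) \<odot>\<^bsub>E\<^esub> w \<in> power_torsion R T E"
    using insert.prems(2)[of x] by auto
  let ?x = "x [^]\<^bsub>R\<^esub> m"
  have xm: "?x \<in> carrier R" using x by simp
  define q where "q = ?x \<odot>\<^bsub>E\<^esub> u"
  have qE: "q \<in> carrier E" using xm uE by (simp add: q_def)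
  have qS: "q \<in> power_torsion R S E" unfolding q_def by (rule E.power_torsion_smult[OF S u xm])
  have "q = ?x \<odot>\<^bsub>E\<^esub> w \<oplus>\<^bsub>E\<^esub> \<ominus>\<^bsub>E\<^esub> (?x \<odot>\<^bsub>E\<^esub> v)"
    unfolding q_def uv using xm uE vE by (simp add: E.smult_r_distr E.M.a_assoc E.M.r_neg)
  then have qT: "q \<in> power_torsion R T E"
    using E.power_torsion_add[OF T m] E.power_torsion_minus[OF T E.power_torsion_smult[OF T v xm]] by simp
  obtain u' and l :: nat where u': "u' \<in> carrier E" "ann R E q \<subseteq> ann R E u'"
    "(x [^]\<^bsub>R\<^esub> l) \<odot>\<^bsub>E\<^esub> (q \<oplus>\<^bsub>E\<^esub> \<ominus>\<^bsub>E\<^esub> (?x \<odot>\<^bsub>E\<^esub> u')) = \<zero>\<^bsub>E\<^esub>"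
    by (rule exists_power_divisor_up_to_torsion[OF assms(1-3) x qE])
  have u'S: "u' \<in> power_torsion R S E" by (rule E.power_torsion_ann_mono[OF S qS u'(1,2)])
  have u'T: "u' \<in> power_torsion R T E" by (rule E.power_torsion_ann_mono[OF T qT u'(1,2)])
  define p where "p = u \<oplus>\<^bsub>E\<^esub> \<ominus>\<^bsub>E\<^esub> u'"
  have pS: "p \<in> power_torsion R S E"
    unfolding p_def by (rule E.power_torsion_add[OF S u E.power_torsion_minus[OF S u'S]])
  have pE: "p \<in> carrier E" by (rule power_torsionD(1)[OF pS])
  have "?x \<odot>\<^bsub>E\<^esub> p = q \<oplus>\<^bsub>E\<^esub> \<ominus>\<^bsub>E\<^esub> (?x \<odot>\<^bsub>E\<^esub> u')"
    unfolding p_def q_def using xm uE u'(1) by (simp add: E.smult_r_distr E.smult_r_minus)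
  then have "(x [^]\<^bsub>R\<^esub> (l + m)) \<odot>\<^bsub>E\<^esub> p = \<zero>\<^bsub>E\<^esub>"
    using u'(3) E.pow_smult_add[OF x pE, of l m] by simp
  then have "p \<in> power_torsion R (insert x S) E"
    using pS by (auto simp: power_torsion_def)
  moreover have "u' \<oplus>\<^bsub>E\<^esub> v \<in> power_torsion R T E" by (rule E.power_torsion_add[OF T u'T v])
  moreover have "w = p \<oplus>\<^bsub>E\<^esub> (u' \<oplus>\<^bsub>E\<^esub> v)"
  proof -
    have "p \<oplus>\<^bsub>E\<^esub> (u' \<oplus>\<^bsub>E\<^esub> v) = u \<oplus>\<^bsub>E\<^esub> ((\<ominus>\<^bsub>E\<^esub> u' \<oplus>\<^bsub>E\<^esub> u') \<oplus>\<^bsub>E\<^esub> v)"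
      unfolding p_def using uE vE u'(1) by (simp only: E.M.a_assoc E.M.a_inv_closed E.M.a_closed)
    also have "\<dots> = w" unfolding uv using uE vE u'(1) by (simp add: E.M.l_neg)
    finally show ?thesis ..
  qed
  ultimately show ?case by blast
qed

section \<open>Vanishing of cohomology\<close>

text \<open>
  What is used of an injective resolution: exactness in positive degrees and injectivity of the terms.
\<close>

locale injective_complex =
  fixes R :: "('a, 'r) ring_scheme" and I :: "nat \<Rightarrow> ('a, 'u) module" and d :: "nat \<Rightarrow> 'u \<Rightarrow> 'u"
  assumes noetherian: "noetherian_ring R"
    and is_module: "module R (I n)"
    and is_baer: "baer R (I n)"
    and d_hom: "d n \<in> module_hom R (I n) (I (Suc n))"
    and exact: "d n ` carrier (I n) = a_kernel (I (Suc n)) (I (Suc (Suc n))) (d (Suc n))"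
begin

text \<open>
  The cohomology of the \<open>S\<close>-torsion subcomplex vanishes in degree \<open>i + 1\<close>.  The shift leaves out
  degree 0, which cannot raise a supremum of natural numbers.
\<close>

definition vanishes :: "'a set \<Rightarrow> nat \<Rightarrow> bool"
  where "vanishes S i \<longleftrightarrow>
    (\<forall>z\<in>power_torsion R S (I (Suc i)). d (Suc i) z = \<zero>\<^bsub>I (Suc (Suc i))\<^esub> \<longrightarrow>
       (\<exists>y\<in>power_torsion R S (I i). d i y = z))"

lemmas d_closed = module_homD(1)[OF d_hom]
lemmas d_add = module_homD(2)[OF d_hom]
lemmas d_smult = module_homD(3)[OF d_hom]
lemmas d_torsion = power_torsion_module_hom[OF is_module is_module d_hom]

lemma d_zero: "d n \<zero>\<^bsub>I n\<^esub> = \<zero>\<^bsub>I (Suc n)\<^esub>"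
  by (rule module_hom_zero[OF is_module is_module d_hom])

lemma d_d: "x \<in> carrier (I n) \<Longrightarrow> d (Suc n) (d n x) = \<zero>\<^bsub>I (Suc (Suc n))\<^esub>"
  using exact[of n] unfolding a_kernel_def' by auto

lemma d_minus:
  assumes "x \<in> carrier (I n)"
  shows "d n (\<ominus>\<^bsub>I n\<^esub> x) = \<ominus>\<^bsub>I (Suc n)\<^esub> (d n x)"
proof -
  interpret M: module R "I n" by (rule is_module)
  interpret N: module R "I (Suc n)" by (rule is_module)
  have "d n ((\<ominus>\<^bsub>R\<^esub> \<one>\<^bsub>R\<^esub>) \<odot>\<^bsub>I n\<^esub> x) = (\<ominus>\<^bsub>R\<^esub> \<one>\<^bsub>R\<^esub>) \<odot>\<^bsub>I (Suc n)\<^esub> d n x"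
    by (rule d_smult[OF _ assms]) simp
  then show ?thesis
    using M.smult_minus_one[OF assms] N.smult_minus_one[OF d_closed[OF assms]] by simp
qed

lemma vanishes_cong:
  assumes "\<And>n. power_torsion R S (I n) = power_torsion R T (I n)"
  shows "vanishes S i \<longleftrightarrow> vanishes T i"
  unfolding vanishes_def assms ..

lemma vanishes_empty: "vanishes {} i"
  unfolding vanishes_def
proof (intro ballI impI)
  fix z assume "z \<in> power_torsion R {} (I (Suc i))" "d (Suc i) z = \<zero>\<^bsub>I (Suc (Suc i))\<^esub>"
  then have "z \<in> a_kernel (I (Suc i)) (I (Suc (Suc i))) (d (Suc i))"
    by (simp add: power_torsion_def a_kernel_def')
  then have "z \<in> d i ` carrier (I i)" unfolding exact .
  then show "\<exists>y\<in>power_torsion R {} (I i). d i y = z" by (auto simp: power_torsion_def)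
qed

text \<open>
  A cocycle \<open>z\<close> that is \<open>x\<close>-torsion is \<open>d y\<close> for some \<open>y\<close> in the \<open>S\<close>-torsion, with \<open>x\<^sup>n y\<close> a cocycle,
  hence \<open>x\<^sup>n y = d w\<close>.  Writing \<open>w = x\<^sup>n w' + t\<close> with \<open>t\<close> an \<open>x\<close>-torsion element, the element
  \<open>y - d w'\<close> is \<open>x\<close>-torsion as well, and it is still mapped to \<open>z\<close>.
\<close>

lemma vanishes_insert:
  assumes S: "S \<subseteq> carrier R" and x: "x \<in> carrier R" and "vanishes S i" "vanishes S (Suc i)"
  shows "vanishes (insert x S) (Suc i)"
  unfolding vanishes_def
proof (intro ballI impI)
  let ?A = "I i" and ?B = "I (Suc i)" and ?C = "I (Suc (Suc i))" and ?D = "I (Suc (Suc (Suc i)))"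
  interpret A: module R ?A by (rule is_module)
  interpret B: module R ?B by (rule is_module)
  fix z assume z: "z \<in> power_torsion R (insert x S) ?C" and dz: "d (Suc (Suc i)) z = \<zero>\<^bsub>?D\<^esub>"
  have "z \<in> power_torsion R S ?C" using z by (auto simp: power_torsion_def)
  then obtain y where y: "y \<in> power_torsion R S ?B" "d (Suc i) y = z"
    using assms(4) dz unfolding vanishes_def by blast
  note yB = power_torsionD(1)[OF y(1)]
  obtain n :: nat where n: "(x [^]\<^bsub>R\<^esub> n) \<odot>\<^bsub>?C\<^esub> z = \<zero>\<^bsub>?C\<^esub>" using power_torsionD(2)[OF z, of x] by auto
  let ?x = "x [^]\<^bsub>R\<^esub> n"
  have xR: "?x \<in> carrier R" using x by simp
  have "?x \<odot>\<^bsub>?B\<^esub> y \<in> power_torsion R S ?B" by (rule B.power_torsion_smult[OF S y(1) xR])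
  moreover have "d (Suc i) (?x \<odot>\<^bsub>?B\<^esub> y) = \<zero>\<^bsub>?C\<^esub>" using d_smult[OF xR yB] y(2) n by simp
  ultimately obtain w where w: "w \<in> power_torsion R S ?A" "d i w = ?x \<odot>\<^bsub>?B\<^esub> y"
    using assms(3) unfolding vanishes_def by blast
  note wA = power_torsionD(1)[OF w(1)]
  obtain w' and m :: nat where w': "w' \<in> carrier ?A" "ann R ?A w \<subseteq> ann R ?A w'"
    "(x [^]\<^bsub>R\<^esub> m) \<odot>\<^bsub>?A\<^esub> (w \<oplus>\<^bsub>?A\<^esub> \<ominus>\<^bsub>?A\<^esub> (?x \<odot>\<^bsub>?A\<^esub> w')) = \<zero>\<^bsub>?A\<^esub>"
    by (rule exists_power_divisor_up_to_torsion[OF noetherian is_module is_baer x wA])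
  have w'S: "w' \<in> power_torsion R S ?A" by (rule A.power_torsion_ann_mono[OF S w(1) w'(1,2)])
  define y' where "y' = y \<oplus>\<^bsub>?B\<^esub> \<ominus>\<^bsub>?B\<^esub> (d i w')"
  have dw': "d i w' \<in> carrier ?B" by (rule d_closed[OF w'(1)])
  have y'S: "y' \<in> power_torsion R S ?B"
    unfolding y'_def by (intro B.power_torsion_add B.power_torsion_minus d_torsion S y(1) w'S)
  have y'B: "y' \<in> carrier ?B" by (rule power_torsionD(1)[OF y'S])
  let ?t = "w \<oplus>\<^bsub>?A\<^esub> \<ominus>\<^bsub>?A\<^esub> (?x \<odot>\<^bsub>?A\<^esub> w')"
  have tA: "?t \<in> carrier ?A" using wA w'(1) xR by simp
  have xm: "x [^]\<^bsub>R\<^esub> m \<in> carrier R" using x by simp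
  have "?x \<odot>\<^bsub>?B\<^esub> y' = d i ?t"
    unfolding y'_def using wA w'(1) xR yB dw' w(2)
    by (simp add: d_add d_minus d_smult B.smult_r_distr B.smult_r_minus)
  then have "(x [^]\<^bsub>R\<^esub> m) \<odot>\<^bsub>?B\<^esub> (?x \<odot>\<^bsub>?B\<^esub> y') = d i ((x [^]\<^bsub>R\<^esub> m) \<odot>\<^bsub>?A\<^esub> ?t)"
    using d_smult[OF xm tA] by simp
  then have "(x [^]\<^bsub>R\<^esub> (m + n)) \<odot>\<^bsub>?B\<^esub> y' = \<zero>\<^bsub>?B\<^esub>"
    using w'(3) d_zero B.pow_smult_add[OF x y'B, of m n] by simp
  then have "y' \<in> power_torsion R (insert x S) ?B" using y'S by (auto simp: power_torsion_def)
  moreover have "d (Suc i) y' = z"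
  proof -
    interpret C: module R ?C by (rule is_module)
    have "d (Suc i) y' = z \<oplus>\<^bsub>?C\<^esub> \<ominus>\<^bsub>?C\<^esub> (d (Suc i) (d i w'))"
      unfolding y'_def using yB dw' y(2) by (simp add: d_add d_minus)
    then show ?thesis using d_d[OF w'(1)] power_torsionD(1)[OF z] by simp
  qed
  ultimately show "\<exists>y\<in>power_torsion R (insert x S) ?B. d (Suc i) y = z" by blast
qed

lemma vanishes_Un_set:
  assumes S: "S \<subseteq> carrier R" and "\<And>i. N \<le> i \<Longrightarrow> vanishes S i"
    and "set xs \<subseteq> carrier R" "N + length xs \<le> i"
  shows "vanishes (S \<union> set xs) i"
  using assms(3,4)
proof (induction xs arbitrary: i)
  case Nil
  then show ?case using assms(2) by simp
next
  case (Cons x xs)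
  then obtain j where j: "i = Suc j" "N + length xs \<le> j" by (cases i) auto
  have "vanishes (insert x (S \<union> set xs)) (Suc j)"
    using Cons j S by (intro vanishes_insert) auto
  then show ?case using j(1) by simp
qed

text \<open>
  The Mayer-Vietoris sequence of \<open>S\<close> and \<open>T\<close>, for any \<open>U\<close> whose torsion is the sum of the two torsion
  parts.  For a cocycle \<open>z = u + v\<close> the connecting homomorphism is represented by \<open>d u = - d v\<close>, which is
  \<open>d s\<close> with \<open>s\<close> torsion for both sets; then \<open>u - s\<close> and \<open>v + s\<close> are cocycles.
\<close>

lemma vanishes_if_split:
  assumes S: "S \<subseteq> carrier R" and T: "T \<subseteq> carrier R" and U: "U \<subseteq> carrier R"
    and SU: "\<And>n. power_torsion R S (I n) \<subseteq> power_torsion R U (I n)"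
    and TU: "\<And>n. power_torsion R T (I n) \<subseteq> power_torsion R U (I n)"
    and split: "\<And>n w. w \<in> power_torsion R U (I n) \<Longrightarrow>
      \<exists>u\<in>power_torsion R S (I n). \<exists>v\<in>power_torsion R T (I n). w = u \<oplus>\<^bsub>I n\<^esub> v"
    and "vanishes S i" "vanishes T i" "vanishes (S \<union> T) (Suc i)"
  shows "vanishes U i"
  unfolding vanishes_def
proof (intro ballI impI)
  let ?A = "I i" and ?B = "I (Suc i)" and ?C = "I (Suc (Suc i))"
  interpret A: module R ?A by (rule is_module)
  interpret B: module R ?B by (rule is_module)
  interpret C: module R ?C by (rule is_module)
  fix z assume z: "z \<in> power_torsion R U ?B" and dz: "d (Suc i) z = \<zero>\<^bsub>?C\<^esub>"
  obtain u v where u: "u \<in> power_torsion R S ?B" and v: "v \<in> power_torsion R T ?B"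
    and uv: "z = u \<oplus>\<^bsub>?B\<^esub> v"
    using split[OF z] by blast
  note uB = power_torsionD(1)[OF u] and vB = power_torsionD(1)[OF v]
  let ?u = "d (Suc i) u" and ?v = "d (Suc i) v"
  have uC: "?u \<in> carrier ?C" and vC: "?v \<in> carrier ?C" using d_closed uB vB by auto
  have sum: "?u \<oplus>\<^bsub>?C\<^esub> ?v = \<zero>\<^bsub>?C\<^esub>" using dz d_add[OF uB vB] uv by simp
  have eq: "?u = \<ominus>\<^bsub>?C\<^esub> ?v" using C.M.minus_equality[OF sum vC uC] by simp
  have "?u \<in> power_torsion R S ?C" by (rule d_torsion[OF S u])
  moreover have "?u \<in> power_torsion R T ?C"
    unfolding eq by (rule C.power_torsion_minus[OF T d_torsion[OF T v]])
  ultimately have "?u \<in> power_torsion R (S \<union> T) ?C" by (simp add: power_torsion_Un)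
  then obtain s where s: "s \<in> power_torsion R (S \<union> T) ?B" "d (Suc i) s = ?u"
    using assms(9) d_d[OF uB] unfolding vanishes_def by blast
  have sS: "s \<in> power_torsion R S ?B" and sT: "s \<in> power_torsion R T ?B"
    using s(1) by (simp_all add: power_torsion_Un)
  note sB = power_torsionD(1)[OF sS]
  have "u \<oplus>\<^bsub>?B\<^esub> \<ominus>\<^bsub>?B\<^esub> s \<in> power_torsion R S ?B"
    by (intro B.power_torsion_add B.power_torsion_minus S u sS)
  moreover have "d (Suc i) (u \<oplus>\<^bsub>?B\<^esub> \<ominus>\<^bsub>?B\<^esub> s) = \<zero>\<^bsub>?C\<^esub>"
    using uB sB s(2) uC by (simp add: d_add d_minus C.M.r_neg)
  ultimately obtain p where p: "p \<in> power_torsion R S ?A" "d i p = u \<oplus>\<^bsub>?B\<^esub> \<ominus>\<^bsub>?B\<^esub> s"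
    using assms(7) unfolding vanishes_def by blast
  have "s \<oplus>\<^bsub>?B\<^esub> v \<in> power_torsion R T ?B" by (intro B.power_torsion_add T v sT)
  moreover have "d (Suc i) (s \<oplus>\<^bsub>?B\<^esub> v) = \<zero>\<^bsub>?C\<^esub>"
    using vB sB s(2) sum by (simp add: d_add)
  ultimately obtain q where q: "q \<in> power_torsion R T ?A" "d i q = s \<oplus>\<^bsub>?B\<^esub> v"
    using assms(8) unfolding vanishes_def by blast
  note pA = power_torsionD(1)[OF p(1)] and qA = power_torsionD(1)[OF q(1)]
  have "p \<oplus>\<^bsub>?A\<^esub> q \<in> power_torsion R U ?A"
    using p(1) q(1) SU TU by (intro A.power_torsion_add[OF U]) auto
  moreover have "d i (p \<oplus>\<^bsub>?A\<^esub> q) = z"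
  proof -
    have "d i (p \<oplus>\<^bsub>?A\<^esub> q) = u \<oplus>\<^bsub>?B\<^esub> ((\<ominus>\<^bsub>?B\<^esub> s \<oplus>\<^bsub>?B\<^esub> s) \<oplus>\<^bsub>?B\<^esub> v)"
      unfolding d_add[OF pA qA] p(2) q(2) using uB vB sB
      by (simp only: B.M.a_assoc B.M.a_inv_closed B.M.a_closed)
    then show ?thesis using uB vB sB uv by (simp add: B.M.l_neg)
  qed
  ultimately show "\<exists>y\<in>power_torsion R U ?A. d i y = z" by blast
qed

end

section \<open>Cohomological dimension\<close>

lemma carrier_FactModule_trivial_iff:
  assumes "module R M" "submodule N R M" and K: "K \<subseteq> carrier M" "N \<subseteq> K"
  shows "carrier (FactModule (M\<lparr>carrier := K\<rparr>) N) = {\<zero>\<^bsub>FactModule (M\<lparr>carrier := K\<rparr>) N\<^esub>} \<longleftrightarrow> K \<subseteq> N"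
proof -
  interpret M: module R M by fact
  note N = M.submoduleE[OF assms(2)]
  have zN: "\<zero>\<^bsub>M\<^esub> \<in> N" using subgroup.one_closed[OF submodule.axioms(1)[OF assms(2)]] by simp
  define cos where "cos a = (\<Union>h\<in>N. {h \<oplus>\<^bsub>M\<^esub> a})" for a
  have car: "carrier (FactModule (M\<lparr>carrier := K\<rparr>) N) = cos ` K"
    unfolding FactModule_def A_RCOSETS_def' a_r_coset_def' cos_def by auto
  have zero: "\<zero>\<^bsub>FactModule (M\<lparr>carrier := K\<rparr>) N\<^esub> = N" by (simp add: FactModule_def)
  have mem: "a \<in> cos a" if "a \<in> K" for a
    unfolding cos_def using zN that K(1) by (intro UN_I[of "\<zero>\<^bsub>M\<^esub>"]) auto
  have cosN: "cos a = N" if a: "a \<in> N" for a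
  proof (intro equalityI subsetI)
    fix x assume "x \<in> cos a"
    then show "x \<in> N" using N(5) a by (auto simp: cos_def)
  next
    fix x assume x: "x \<in> N"
    have "x = (x \<oplus>\<^bsub>M\<^esub> \<ominus>\<^bsub>M\<^esub> a) \<oplus>\<^bsub>M\<^esub> a"
      using x a N(1) by (simp add: M.M.a_assoc M.M.l_neg subset_iff)
    then show "x \<in> cos a" unfolding cos_def using N(5)[OF x N(3)[OF a]] by blast
  qed
  show ?thesis
    unfolding car zero
  proof
    assume "cos ` K = {N}"
    then show "K \<subseteq> N" using mem by blast
  next
    assume "K \<subseteq> N"
    then have "cos ` K = (\<lambda>_. N) ` K" using cosN by (intro image_cong) auto
    then show "cos ` K = {N}" using zN K(2) by auto
  qed
qed

context injective_complex
begin

lemma ideal_carrier: "ideal J R \<Longrightarrow> J \<subseteq> carrier R"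
  by (auto dest: ideal.Icarr)

lemma carrier_torsion: "ideal J R \<Longrightarrow> carrier (torsion R J (I n)) = power_torsion R J (I n)"
  by (rule module.torsion_eq_power_torsion[OF is_module noetherian])

text \<open>
  Translation from the quotient module of cocycles by coboundaries to elements.
\<close>

lemma cohomology_trivial_iff_vanishes:
  assumes J: "ideal J R"
  shows "carrier (cohomology (\<lambda>n. torsion R J (I n)) (\<lambda>n. torsion_hom R J (I n) (I (Suc n)) (d n)) (Suc i))
      = {\<zero>\<^bsub>cohomology (\<lambda>n. torsion R J (I n)) (\<lambda>n. torsion_hom R J (I n) (I (Suc n)) (d n)) (Suc i)\<^esub>}
    \<longleftrightarrow> vanishes J i"
proof -
  let ?T = "\<lambda>n. power_torsion R J (I n)"
  let ?B = "I (Suc i)" and ?C = "I (Suc (Suc i))"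
  interpret B: module R ?B by (rule is_module)
  note JR = ideal_carrier[OF J]
  define K where "K = {x \<in> ?T (Suc i). d (Suc i) x = \<zero>\<^bsub>?C\<^esub>}"
  define N where "N = d i ` ?T i"
  have tors: "torsion R J (I n) = (I n)\<lparr>carrier := ?T n\<rparr>" for n
    using carrier_torsion[OF J, of n] by (simp add: torsion_def)
  have "a_kernel (torsion R J ?B) (torsion R J ?C) (torsion_hom R J ?B ?C (d (Suc i))) = K"
    unfolding a_kernel_def' torsion_hom_def carrier_torsion[OF J] K_def
    by (auto simp: torsion_def)
  moreover have "torsion_hom R J (I i) ?B (d i) ` carrier (torsion R J (I i)) = N"
    unfolding torsion_hom_def carrier_torsion[OF J] N_def by (intro image_cong) auto
  ultimately have coh: "cohomology (\<lambda>n. torsion R J (I n)) (\<lambda>n. torsion_hom R J (I n) (I (Suc n)) (d n)) (Suc i)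
      = FactModule (?B\<lparr>carrier := K\<rparr>) N"
    by (simp add: cohomology_def tors)
  have NI: "d i x \<in> N" if "x \<in> ?T i" for x using that by (simp add: N_def)
  have "submodule N R ?B"
  proof -
    interpret A: module R "I i" by (rule is_module)
    note TA = power_torsionD(1)[of _ R J "I i"]
    have smult: "r \<odot>\<^bsub>?B\<^esub> x \<in> N" if r: "r \<in> carrier R" and x: "x \<in> N" for r x
    proof -
      obtain a where a: "a \<in> ?T i" "x = d i a" using x by (auto simp: N_def)
      show ?thesis
        using NI[OF A.power_torsion_smult[OF JR a(1) r]] d_smult[OF r TA[OF a(1)]] a(2) by simp
    qed
    have NB: "x \<in> carrier ?B" if "x \<in> N" for x using that d_closed TA by (auto simp: N_def)
    show ?thesis
    proof (rule B.submoduleI)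
      show "N \<subseteq> carrier ?B" using NB by blast
      have "\<zero>\<^bsub>I i\<^esub> \<in> ?T i" using JR by (auto simp: power_torsion_def subset_iff)
      then show "\<zero>\<^bsub>?B\<^esub> \<in> N" using NI d_zero by metis
      show "x \<oplus>\<^bsub>?B\<^esub> y \<in> N" if x: "x \<in> N" and y: "y \<in> N" for x y
      proof -
        obtain a b where a: "a \<in> ?T i" "x = d i a" and b: "b \<in> ?T i" "y = d i b"
          using x y by (auto simp: N_def)
        show ?thesis
          using NI[OF A.power_torsion_add[OF JR a(1) b(1)]] d_add[OF TA[OF a(1)] TA[OF b(1)]] a(2) b(2)
          by simp
      qed
      show "\<ominus>\<^bsub>?B\<^esub> x \<in> N" if "x \<in> N" for x
        using smult[OF _ that, of "\<ominus>\<^bsub>R\<^esub> \<one>\<^bsub>R\<^esub>"] B.smult_minus_one[OF NB[OF that]] by simp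
      show "r \<odot>\<^bsub>?B\<^esub> x \<in> N" if "r \<in> carrier R" "x \<in> N" for r x by (rule smult[OF that])
    qed
  qed
  moreover have "K \<subseteq> carrier ?B" by (auto simp: K_def dest: power_torsionD(1))
  moreover have "N \<subseteq> K"
  proof
    fix x assume "x \<in> N"
    then obtain a where a: "a \<in> ?T i" "x = d i a" by (auto simp: N_def)
    then show "x \<in> K" using d_torsion[OF JR a(1)] d_d[OF power_torsionD(1)[OF a(1)]] by (simp add: K_def)
  qed
  ultimately have "carrier (FactModule (?B\<lparr>carrier := K\<rparr>) N) = {\<zero>\<^bsub>FactModule (?B\<lparr>carrier := K\<rparr>) N\<^esub>} \<longleftrightarrow> K \<subseteq> N"
    by (intro carrier_FactModule_trivial_iff[OF is_module])
  also have "K \<subseteq> N \<longleftrightarrow> vanishes J i"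
    unfolding vanishes_def K_def N_def by (auto simp: image_iff subset_iff)
  finally show ?thesis unfolding coh .
qed

end

lemma cd_le_iff:
  assumes "injective_complex R I d" and J: "ideal J R"
    and "chosen_injective_resolution R X = (I, d)"
  shows "cd R J X \<le> enat N \<longleftrightarrow> (\<forall>i\<ge>N. injective_complex.vanishes R I d J i)"
proof -
  interpret injective_complex R I d by fact
  let ?P = "\<lambda>i. carrier (local_cohomology R J i X) \<noteq> {\<zero>\<^bsub>local_cohomology R J i X\<^esub>}"
  have P: "?P (Suc i) \<longleftrightarrow> \<not> vanishes J i" for i
    using cohomology_trivial_iff_vanishes[OF J, of i]
    by (simp add: local_cohomology_def right_derived_def assms(3))
  have "Sup {enat i |i. Q i} \<le> enat N \<longleftrightarrow> (\<forall>i. Q i \<longrightarrow> i \<le> N)" for Q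
    by (auto simp: Sup_le_iff)
  then have "cd R J X \<le> enat N \<longleftrightarrow> (\<forall>i. ?P i \<longrightarrow> i \<le> N)"
    unfolding cd_def .
  also have "\<dots> \<longleftrightarrow> (\<forall>i\<ge>N. vanishes J i)"
  proof
    assume a: "\<forall>i. ?P i \<longrightarrow> i \<le> N"
    show "\<forall>i\<ge>N. vanishes J i"
    proof (intro allI impI)
      fix i assume "N \<le> i"
      then have "\<not> ?P (Suc i)" using a[rule_format, of "Suc i"] by linarith
      then show "vanishes J i" using P by blast
    qed
  next
    assume a: "\<forall>i\<ge>N. vanishes J i"
    show "\<forall>i. ?P i \<longrightarrow> i \<le> N"
    proof (intro allI impI)
      fix i assume i: "?P i"
      show "i \<le> N"
      proof (cases i)
        case (Suc j)
        then have "\<not> vanishes J j" using i P by blast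
        then show ?thesis using a Suc by (metis not_less_eq_eq)
      qed simp
    qed
  qed
  finally show ?thesis .
qed

text \<open>
  Lists over \<open>'a + 'm\<close> form an infinite type that contains copies of the ring and of the module, as
  the construction of resolutions requires.
\<close>

lemma chosen_injective_resolution_complex:
  fixes R :: "('a, 'r) ring_scheme" and X :: "('a, 'm, 'x) module_scheme"
  assumes "cring R" "noetherian_ring R" "module R X"
  obtains I d where "chosen_injective_resolution R X = (I, d)" "injective_complex R I d"
proof -
  let ?U = "UNIV :: ('a, 'm) univ set"
  have inf: "infinite ?U" by (rule infinite_UNIV_listI)
  have "inj_on (\<lambda>r. [Inl r] :: ('a, 'm) univ) (carrier R)" by (rule inj_onI) simp
  then have RU: "carrier R \<lesssim> ?U" by (auto simp: lepoll_def)
  have "inj_on (\<lambda>x. [Inr x] :: ('a, 'm) univ) (carrier X)" by (rule inj_onI) simp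
  then have XU: "carrier X \<lesssim> ?U" by (auto simp: lepoll_def)
  obtain I d where Id: "chosen_injective_resolution R X = (I, d)" by (cases "chosen_injective_resolution R X")
  have "\<exists>p :: (nat \<Rightarrow> ('a, ('a, 'm) univ) module) \<times> (nat \<Rightarrow> ('a, 'm) univ \<Rightarrow> ('a, 'm) univ).
      case p of (I, d) \<Rightarrow> \<exists>\<epsilon>. injective_resolution R X I d \<epsilon>"
    using injective_resolution_exists[OF assms(2,3) inf RU XU] by auto
  then have "case chosen_injective_resolution R X of (I, d) \<Rightarrow> \<exists>\<epsilon>. injective_resolution R X I d \<epsilon>"
    unfolding chosen_injective_resolution_def by (rule someI_ex)
  then obtain \<epsilon> where r: "injective_resolution R X I d \<epsilon>" using Id by auto
  have inj: "inj (\<lambda>r. [Inl r] :: ('a, 'm) univ)" by (rule injI) simp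
  have I: "injective_module R (I n)" for n using r by (simp add: injective_resolution_def)
  have "injective_complex R I d"
  proof (rule injective_complex.intro)
    show "noetherian_ring R" by fact
    show "module R (I n)" for n using I by (simp add: injective_module_def)
    show "baer R (I n)" for n by (rule baer_if_injective_module[OF assms(1) I inj])
    show "d n \<in> module_hom R (I n) (I (Suc n))" for n using r by (simp add: injective_resolution_def)
    show "d n ` carrier (I n) = a_kernel (I (Suc n)) (I (Suc (Suc n))) (d (Suc n))" for n
      using r by (simp add: injective_resolution_def)
  qed
  then show thesis by (rule that[OF Id])
qed

section \<open>Arithmetic rank\<close>

text \<open>
  The least number in the definition of the arithmetic rank is attained as soon as one finite
  generating list up to radical is known.
\<close>

lemma ara_witness:
  assumes "set ys \<subseteq> carrier R" "radical R J = radical R (Idl\<^bsub>R\<^esub> (set ys))"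
  obtains xs where "length xs = ara R J" "set xs \<subseteq> carrier R" "radical R J = radical R (Idl\<^bsub>R\<^esub> (set xs))"
proof -
  let ?P = "\<lambda>n. \<exists>xs. length xs = n \<and> set xs \<subseteq> carrier R \<and> radical R J = radical R (Idl\<^bsub>R\<^esub> (set xs))"
  have "?P (length ys)" using assms by blast
  then have "?P (ara R J)" unfolding ara_def by (rule LeastI)
  then obtain xs where "length xs = ara R J \<and> set xs \<subseteq> carrier R \<and>
      radical R J = radical R (Idl\<^bsub>R\<^esub> (set xs))"
    by (rule exE)
  then show thesis using that[of xs] by simp
qed

lemma noetherian_generators:
  assumes "noetherian_ring R" "ideal J R"
  obtains xs where "set xs \<subseteq> carrier R" "J = Idl\<^bsub>R\<^esub> (set xs)"
proof -
  obtain A where "A \<subseteq> carrier R" "finite A" "J = Idl\<^bsub>R\<^esub> A"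
    using noetherian_ring.finetely_gen[OF assms] by blast
  then obtain xs where "set xs = A" using finite_list by blast
  show thesis by (rule that[of xs]) (use \<open>set xs = A\<close> \<open>A \<subseteq> carrier R\<close> \<open>J = Idl\<^bsub>R\<^esub> A\<close> in simp_all)
qed

lemma carrier_FactRing: "carrier (R Quot I) = (\<lambda>x. I +>\<^bsub>R\<^esub> x) ` carrier R"
  by (auto simp: FactRing_def A_RCOSETS_def')

lemma FactRing_zero: "\<zero>\<^bsub>R Quot I\<^esub> = I"
  by (simp add: FactRing_def)

context cring
begin

lemma quot_mem_image_iff:
  assumes "ideal I R" "ideal J R" "I \<subseteq> J" "x \<in> carrier R"
  shows "I +> x \<in> (+>) I ` J \<longleftrightarrow> x \<in> J"
proof
  interpret J: ideal J R by fact
  assume "I +> x \<in> (+>) I ` J"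
  then obtain y where y: "y \<in> J" "I +> x = I +> y" by blast
  have "\<zero> \<oplus> x \<in> I +> x"
    using additive_subgroup.zero_closed[OF ideal.axioms(1)[OF assms(1)]] unfolding a_r_coset_def' by blast
  then have "x \<in> I +> y" using y(2) assms(4) by simp
  then obtain h where "h \<in> I" "x = h \<oplus> y" unfolding a_r_coset_def' by blast
  then show "x \<in> J" using J.a_closed y(1) assms(3) by blast
qed simp

lemma radical_quot_iff:
  assumes I: "ideal I R" and "ideal J R" "I \<subseteq> J" "x \<in> carrier R"
  shows "x \<in> radical R J \<longleftrightarrow> I +> x \<in> radical (R Quot I) ((+>) I ` J)"
proof -
  interpret h: ring_hom_ring R "R Quot I" "(+>) I" by (rule ideal.rcos_ring_hom_ring[OF I])
  have "x [^] n \<in> J \<longleftrightarrow> (I +> x) [^]\<^bsub>R Quot I\<^esub> n \<in> (+>) I ` J" for n :: nat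
    using quot_mem_image_iff[OF assms(1-3), of "x [^] n"] h.hom_nat_pow[OF assms(4), of n] assms(4) by simp
  then show ?thesis using assms(4) h.hom_closed[OF assms(4)] unfolding radical_def by simp
qed

lemma image_genideal_Un:
  assumes I: "ideal I R" and S: "S \<subseteq> carrier R"
  shows "(+>) I ` (Idl (I \<union> S)) = Idl\<^bsub>R Quot I\<^esub> ((+>) I ` S)"
proof
  interpret h: ring_hom_ring R "R Quot I" "(+>) I" by (rule ideal.rcos_ring_hom_ring[OF I])
  have IR: "I \<subseteq> carrier R" using I by (auto dest: ideal.Icarr)
  have IS: "I \<union> S \<subseteq> carrier R" using IR S by simp
  have hS: "(+>) I ` S \<subseteq> carrier (R Quot I)" using h.hom_closed S by auto
  let ?K = "Idl\<^bsub>R Quot I\<^esub> ((+>) I ` S)"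
  have K: "ideal ?K (R Quot I)" by (rule h.S.genideal_ideal[OF hS])
  have "I +> x = \<zero>\<^bsub>R Quot I\<^esub>" if "x \<in> I" for x
    unfolding FactRing_zero by (rule a_rcos_zero[OF I that])
  then have "I +> x \<in> ?K" if "x \<in> I" for x
    using that additive_subgroup.zero_closed[OF ideal.axioms(1)[OF K]] by simp
  then have "I \<subseteq> {r \<in> carrier R. I +> r \<in> ?K}" using IR by blast
  moreover have "S \<subseteq> {r \<in> carrier R. I +> r \<in> ?K}"
    using S h.S.genideal_self[OF hS] by auto
  ultimately have "Idl (I \<union> S) \<subseteq> {r \<in> carrier R. I +> r \<in> ?K}"
    by (intro genideal_minimal h.ideal_vimage K) simp
  then show "(+>) I ` (Idl (I \<union> S)) \<subseteq> ?K" by auto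
  have "(+>) I ` S \<subseteq> (+>) I ` (Idl (I \<union> S))" using genideal_self[OF IS] by auto
  then show "?K \<subseteq> (+>) I ` (Idl (I \<union> S))"
    by (intro h.S.genideal_minimal ring_ideal_imp_quot_ideal I genideal_ideal IS)
qed

text \<open>
  Ideals of \<open>R / I\<close> and their radicals are read off from the ideals of \<open>R\<close> that contain \<open>I\<close>, so generators
  up to radical can be lifted.
\<close>

lemma ara_quotient_witness:
  assumes "noetherian_ring R" and I: "ideal I R" and J: "ideal J R" and IJ: "I \<subseteq> J"
  obtains xs where "length xs = ara_quotient R J I" "set xs \<subseteq> carrier R"
    "radical R J = radical R (Idl (I \<union> set xs))"
proof -
  interpret h: ring_hom_ring R "R Quot I" "(+>) I" by (rule ideal.rcos_ring_hom_ring[OF I])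
  have IR: "I \<subseteq> carrier R" using I by (auto dest: ideal.Icarr)
  obtain zs where zs: "set zs \<subseteq> carrier R" "J = Idl (set zs)" by (rule noetherian_generators[OF assms(1) J])
  have IJ_eq: "Idl (I \<union> set zs) = J"
  proof
    show "Idl (I \<union> set zs) \<subseteq> J" using genideal_self[OF zs(1)] zs(2) IJ by (intro genideal_minimal J) auto
    have "set zs \<subseteq> Idl (I \<union> set zs)" using genideal_self[of "I \<union> set zs"] IR zs(1) by auto
    then show "J \<subseteq> Idl (I \<union> set zs)"
      unfolding zs(2) using IR zs(1) by (intro genideal_minimal genideal_ideal) auto
  qed
  have img: "(+>) I ` J = Idl\<^bsub>R Quot I\<^esub> (set (map ((+>) I) zs))"
    using image_genideal_Un[OF I zs(1)] unfolding IJ_eq set_map .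
  have car: "set (map ((+>) I) zs) \<subseteq> carrier (R Quot I)" using h.hom_closed zs(1) by auto
  obtain ys where ys: "length ys = ara (R Quot I) ((+>) I ` J)" "set ys \<subseteq> carrier (R Quot I)"
    "radical (R Quot I) ((+>) I ` J) = radical (R Quot I) (Idl\<^bsub>R Quot I\<^esub> (set ys))"
    by (rule ara_witness[OF car]) (rule arg_cong[OF img])
  have "ys \<in> lists ((+>) I ` carrier R)" using ys(2) unfolding carrier_FactRing by blast
  then obtain xs where xs: "set xs \<subseteq> carrier R" "ys = map ((+>) I) xs"
    unfolding lists_image by blast
  let ?K = "Idl (I \<union> set xs)"
  have IX: "I \<union> set xs \<subseteq> carrier R" using IR xs(1) by simp
  have K: "ideal ?K R" by (rule genideal_ideal[OF IX])
  have IK: "I \<subseteq> ?K" using genideal_self[OF IX] by auto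
  have eq: "radical (R Quot I) ((+>) I ` J) = radical (R Quot I) ((+>) I ` ?K)"
    by (simp only: ys(3) xs(2) image_genideal_Un[OF I xs(1)] set_map)
  have "x \<in> radical R J \<longleftrightarrow> x \<in> radical R ?K" for x
  proof (cases "x \<in> carrier R")
    case True
    then show ?thesis using radical_quot_iff[OF I J IJ True] radical_quot_iff[OF I K IK True] eq by simp
  qed (simp add: radical_def)
  then have "radical R J = radical R ?K" by blast
  moreover have "length xs = ara_quotient R J I" using ys(1) xs(2) by (simp add: ara_quotient_def)
  ultimately show thesis using xs(1) by (intro that[of xs])
qed

end

section \<open>The three inequalities\<close>

lemma (in module) power_torsion_genideal:
  assumes "S \<subseteq> carrier R"
  shows "power_torsion R (Idl S) M = power_torsion R S M"
  using assms R.genideal_ideal[OF assms] R.genideal_of_ideal[OF R.genideal_ideal[OF assms]]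
  by (intro power_torsion_radical_cong) (auto dest: ideal.Icarr)

text \<open>
  For finitely many \<open>s\<close> the exponent of \<open>x\<close> can be chosen independently of \<open>s\<close>.
\<close>

lemma (in module) uniform_power_torsion:
  assumes B: "finite B" "B \<subseteq> carrier R" and x: "x \<in> carrier R" and w: "w \<in> carrier M"
    and "\<And>s. s \<in> B \<Longrightarrow> \<exists>(n::nat) (k::nat). (s [^] n) \<odot>\<^bsub>M\<^esub> ((x [^] k) \<odot>\<^bsub>M\<^esub> w) = \<zero>\<^bsub>M\<^esub>"
  shows "\<exists>k::nat. (x [^] k) \<odot>\<^bsub>M\<^esub> w \<in> power_torsion R B M"
  using B assms(5)
proof (induction B)
  case empty
  show ?case using w x by (intro exI[of _ 0]) (simp add: power_torsion_def)
next
  case (insert s B)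
  obtain k :: nat where k: "(x [^] k) \<odot>\<^bsub>M\<^esub> w \<in> power_torsion R B M" using insert.IH insert.prems by auto
  obtain n l :: nat where nl: "(s [^] n) \<odot>\<^bsub>M\<^esub> ((x [^] l) \<odot>\<^bsub>M\<^esub> w) = \<zero>\<^bsub>M\<^esub>" using insert.prems(2)[of s] by auto
  have s: "s \<in> carrier R" and B: "B \<subseteq> carrier R" using insert.prems(1) by auto
  have xk: "x [^] k \<in> carrier R" "x [^] l \<in> carrier R" and sn: "s [^] n \<in> carrier R" using x s by auto
  have 1: "(x [^] (l + k)) \<odot>\<^bsub>M\<^esub> w \<in> power_torsion R B M"
    unfolding pow_smult_add[OF x w] by (rule power_torsion_smult[OF B k xk(2)])
  have "(s [^] n) \<odot>\<^bsub>M\<^esub> ((x [^] (l + k)) \<odot>\<^bsub>M\<^esub> w) = (x [^] k) \<odot>\<^bsub>M\<^esub> ((s [^] n) \<odot>\<^bsub>M\<^esub> ((x [^] l) \<odot>\<^bsub>M\<^esub> w))"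
    unfolding add.commute[of l k] pow_smult_add[OF x w]
    by (rule smult_commute[OF sn xk(1) smult_closed[OF xk(2) w]])
  also have "\<dots> = \<zero>\<^bsub>M\<^esub>" using nl xk(1) by simp
  finally have "(x [^] (l + k)) \<odot>\<^bsub>M\<^esub> w \<in> power_torsion R (insert s B) M"
    using 1 by (auto simp: power_torsion_def)
  then show ?case ..
qed

text \<open>
  If \<open>x\<^sup>k \<in> J\<close>, then \<open>x\<^sup>k s \<in> J \<inter> K\<close> for the finitely many generators \<open>s\<close> of \<open>K\<close>, so a power of \<open>s\<close> kills
  \<open>x\<^sup>l w\<close> for some \<open>l\<close>.
\<close>

lemma (in module) power_smult_power_torsion_of_inter:
  assumes "noetherian_ring R" and J: "ideal J R" and K: "ideal K R"
    and w: "w \<in> power_torsion R (J \<inter> K) M" and x: "x \<in> radical R J"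
  shows "\<exists>k::nat. (x [^] k) \<odot>\<^bsub>M\<^esub> w \<in> power_torsion R K M"
proof -
  have wM: "w \<in> carrier M" by (rule power_torsionD(1)[OF w])
  obtain bs where bs: "set bs \<subseteq> carrier R" "K = Idl (set bs)" by (rule noetherian_generators[OF assms(1) K])
  obtain k :: nat where k: "x \<in> carrier R" "x [^] k \<in> J" using x by (auto simp: radical_def)
  have xk: "x [^] k \<in> carrier R" using k(1) by simp
  have "\<exists>l::nat. (x [^] l) \<odot>\<^bsub>M\<^esub> w \<in> power_torsion R (set bs) M"
  proof (rule uniform_power_torsion[OF _ bs(1) k(1) wM])
    fix s assume s: "s \<in> set bs"
    then have sR: "s \<in> carrier R" and sK: "s \<in> K" using bs R.genideal_self[OF bs(1)] by auto
    have "s \<otimes> x [^] k \<in> J \<inter> K"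
      using ideal.I_l_closed[OF J k(2) sR] ideal.I_r_closed[OF K sK xk] by simp
    then obtain n :: nat where "((s \<otimes> x [^] k) [^] n) \<odot>\<^bsub>M\<^esub> w = \<zero>\<^bsub>M\<^esub>" using power_torsionD(2)[OF w] by blast
    then have "(s [^] n) \<odot>\<^bsub>M\<^esub> ((x [^] (k * n)) \<odot>\<^bsub>M\<^esub> w) = \<zero>\<^bsub>M\<^esub>"
      using sR k(1) wM by (simp add: R.nat_pow_distrib R.nat_pow_pow smult_assoc1)
    then show "\<exists>(n::nat) (k::nat). (s [^] n) \<odot>\<^bsub>M\<^esub> ((x [^] k) \<odot>\<^bsub>M\<^esub> w) = \<zero>\<^bsub>M\<^esub>" by blast
  qed simp
  then show ?thesis unfolding bs(2) power_torsion_genideal[OF bs(1)] .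
qed

context injective_complex
begin

lemma vanishes_add_ideal:
  assumes J: "ideal J R" and K: "ideal K R"
    and xs: "set xs \<subseteq> carrier R" "radical R J = radical R (Idl\<^bsub>R\<^esub> (set xs))"
    and van: "\<And>i. N \<le> i \<Longrightarrow> vanishes K i" and i: "length xs + N \<le> i"
  shows "vanishes (J <+>\<^bsub>R\<^esub> K) i"
proof -
  have "power_torsion R (J <+>\<^bsub>R\<^esub> K) (I n) = power_torsion R (K \<union> set xs) (I n)" for n
  proof -
    interpret M: module R "I n" by (rule is_module)
    have "power_torsion R (J <+>\<^bsub>R\<^esub> K) (I n) = power_torsion R (J \<union> K) (I n)"
      unfolding M.R.union_genideal[OF J K, symmetric]
      using ideal_carrier[OF J] ideal_carrier[OF K] by (intro M.power_torsion_genideal) simp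
    moreover have "power_torsion R J (I n) = power_torsion R (set xs) (I n)"
      using M.R.genideal_of_ideal[OF J] ideal_carrier[OF J] xs
      by (intro M.power_torsion_radical_cong) simp_all
    ultimately show ?thesis by (simp add: power_torsion_Un Int_commute)
  qed
  then have "vanishes (J <+>\<^bsub>R\<^esub> K) i \<longleftrightarrow> vanishes (K \<union> set xs) i" by (rule vanishes_cong)
  then show ?thesis
    using vanishes_Un_set[OF ideal_carrier[OF K] van xs(1), of N i] i by (simp add: add.commute)
qed

lemma vanishes_inter_ideal:
  assumes J: "ideal J R" and K: "ideal K R"
    and xs: "set xs \<subseteq> carrier R" "radical R J = radical R (Idl\<^bsub>R\<^esub> (set xs))"
    and van: "\<And>i. N \<le> i \<Longrightarrow> vanishes K i" and i: "length xs + N \<le> i"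
  shows "vanishes (J \<inter> K) i"
proof (rule vanishes_if_split[OF xs(1) ideal_carrier[OF K]])
  show "J \<inter> K \<subseteq> carrier R" using ideal_carrier[OF K] by blast
  show "power_torsion R (set xs) (I n) \<subseteq> power_torsion R (J \<inter> K) (I n)" for n
  proof -
    interpret M: module R "I n" by (rule is_module)
    have "power_torsion R (set xs) (I n) = power_torsion R J (I n)"
      using M.R.genideal_of_ideal[OF J] ideal_carrier[OF J] xs
      by (intro M.power_torsion_radical_cong) simp_all
    then show ?thesis by (auto simp: power_torsion_def)
  qed
  show "power_torsion R K (I n) \<subseteq> power_torsion R (J \<inter> K) (I n)" for n
    by (auto simp: power_torsion_def)
  show "\<exists>u\<in>power_torsion R (set xs) (I n). \<exists>v\<in>power_torsion R K (I n). w = u \<oplus>\<^bsub>I n\<^esub> v"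
    if w: "w \<in> power_torsion R (J \<inter> K) (I n)" for n w
  proof (rule power_torsion_split[OF noetherian is_module is_baer _ xs(1) ideal_carrier[OF K]])
    interpret M: module R "I n" by (rule is_module)
    show "w \<in> carrier (I n)" by (rule power_torsionD(1)[OF w])
    fix x assume x: "x \<in> set xs"
    have "Idl\<^bsub>R\<^esub> (set xs) \<subseteq> carrier R" by (rule ideal_carrier[OF M.R.genideal_ideal[OF xs(1)]])
    then have "x \<in> radical R J"
      unfolding xs(2) using x M.R.subset_radical M.R.genideal_self[OF xs(1)] by blast
    then show "\<exists>m::nat. (x [^]\<^bsub>R\<^esub> m) \<odot>\<^bsub>I n\<^esub> w \<in> power_torsion R K (I n)"
      by (rule M.power_smult_power_torsion_of_inter[OF noetherian J K w])
  qed simp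
  show "vanishes (set xs) i"
    using vanishes_Un_set[of "{}" 0 xs i] vanishes_empty xs(1) i by simp
  show "vanishes K i" using van i by simp
  show "vanishes (set xs \<union> K) (Suc i)"
    using vanishes_Un_set[OF ideal_carrier[OF K] van xs(1), of N "Suc i"] i by (simp add: Un_commute)
qed

lemma vanishes_superideal:
  assumes J: "ideal J R" and K: "ideal K R"
    and xs: "set xs \<subseteq> carrier R" "radical R K = radical R (Idl\<^bsub>R\<^esub> (J \<union> set xs))"
    and van: "\<And>i. N \<le> i \<Longrightarrow> vanishes J i" and i: "N + length xs \<le> i"
  shows "vanishes K i"
proof -
  have "power_torsion R K (I n) = power_torsion R (J \<union> set xs) (I n)" for n
  proof -
    interpret M: module R "I n" by (rule is_module)
    show ?thesis
      using M.R.genideal_of_ideal[OF K] xs ideal_carrier[OF J] ideal_carrier[OF K]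
      by (intro M.power_torsion_radical_cong) simp_all
  qed
  then have "vanishes K i \<longleftrightarrow> vanishes (J \<union> set xs) i" by (rule vanishes_cong)
  then show ?thesis using vanishes_Un_set[OF ideal_carrier[OF J] van xs(1) i] by simp
qed

end

theorem corollary2p4:
  fixes R :: "('a, 'r) ring_scheme" and X :: "('a, 'm, 'x) module_scheme"
    and \<aa> \<bb> :: "'a set"
  assumes "cring R" and "noetherian_ring R"
    and "ideal \<aa> R" and "\<aa> \<noteq> carrier R"
    and "ideal \<bb> R"
    and "module R X" and "carrier X \<noteq> {\<zero>\<^bsub>X\<^esub>}"
  shows "cd R (\<aa> <+>\<^bsub>R\<^esub> \<bb>) X \<le> enat (ara R \<aa>) + cd R \<bb> X
    \<and> cd R (\<aa> \<inter> \<bb>) X \<le> enat (ara R \<aa>) + cd R \<bb> X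
    \<and> (\<aa> \<subseteq> \<bb> \<longrightarrow> cd R \<bb> X \<le> cd R \<aa> X + enat (ara_quotient R \<bb> \<aa>))"
proof (intro conjI impI)
  interpret cring R by fact
  obtain I d where Id: "chosen_injective_resolution R X = (I, d)" "injective_complex R I d"
    by (rule chosen_injective_resolution_complex[OF assms(1,2,6)])
  interpret injective_complex R I d by (rule Id(2))
  note cd = cd_le_iff[OF Id(2) _ Id(1)]
  obtain zs where zs: "set zs \<subseteq> carrier R" "\<aa> = Idl\<^bsub>R\<^esub> (set zs)"
    by (rule noetherian_generators[OF assms(2,3)])
  obtain xs where xs: "length xs = ara R \<aa>" "set xs \<subseteq> carrier R"
    "radical R \<aa> = radical R (Idl\<^bsub>R\<^esub> (set xs))"
    by (rule ara_witness[OF zs(1), of \<aa>]) (simp add: zs(2)[symmetric])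
  show "cd R (\<aa> <+>\<^bsub>R\<^esub> \<bb>) X \<le> enat (ara R \<aa>) + cd R \<bb> X"
  proof (cases "cd R \<bb> X")
    case (enat N)
    then have van: "vanishes \<bb> i" if "N \<le> i" for i using cd[OF assms(5), of N] that by simp
    have "vanishes (\<aa> <+>\<^bsub>R\<^esub> \<bb>) i" if "ara R \<aa> + N \<le> i" for i
      by (rule vanishes_add_ideal[OF assms(3,5) xs(2,3) van]) (use that xs(1) in simp_all)
    then show ?thesis using enat cd[OF add_ideals[OF assms(3,5)]] by simp
  qed simp
  show "cd R (\<aa> \<inter> \<bb>) X \<le> enat (ara R \<aa>) + cd R \<bb> X"
  proof (cases "cd R \<bb> X")
    case (enat N)
    then have van: "vanishes \<bb> i" if "N \<le> i" for i using cd[OF assms(5), of N] that by simp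
    have "vanishes (\<aa> \<inter> \<bb>) i" if "ara R \<aa> + N \<le> i" for i
      by (rule vanishes_inter_ideal[OF assms(3,5) xs(2,3) van]) (use that xs(1) in simp_all)
    then show ?thesis using enat cd[OF i_intersect[OF assms(3,5)]] by simp
  qed simp
  assume sub: "\<aa> \<subseteq> \<bb>"
  obtain ys where ys: "length ys = ara_quotient R \<bb> \<aa>" "set ys \<subseteq> carrier R"
    "radical R \<bb> = radical R (Idl\<^bsub>R\<^esub> (\<aa> \<union> set ys))"
    by (rule ara_quotient_witness[OF assms(2,3,5) sub])
  show "cd R \<bb> X \<le> cd R \<aa> X + enat (ara_quotient R \<bb> \<aa>)"
  proof (cases "cd R \<aa> X")
    case (enat N)
    then have van: "vanishes \<aa> i" if "N \<le> i" for i using cd[OF assms(3), of N] that by simp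
    have "vanishes \<bb> i" if "N + ara_quotient R \<bb> \<aa> \<le> i" for i
      by (rule vanishes_superideal[OF assms(3,5) ys(2,3) van]) (use that ys(1) in simp_all)
    then show ?thesis using enat cd[OF assms(5)] by simp
  qed simp
qed

end
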